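(* Let $d\ge1$, $n_k\ge1$, $\alpha\in\mathbb{C}\setminus\{0,1\}$, and let $Q$ be the set of tuples $(i_0,\dots,i_d)$ of integers with $0\le i_k<n_k$ for all $k$ and $i_k=0$ for some $k$. Then for every $0\le j\le d$, the subspace $\bigoplus_{(i_0,\dots,i_d)\in Q}H^j_{\mathrm{dR}}(U_\alpha/\mathbb{C})(i_0,\dots,i_d)$ of $H^j_{\mathrm{dR}}(U_\alpha/\mathbb{C})$ is generated by exterior products of the forms $\frac{dx_i}{x_i-\nu_i}$, $\nu_i\in\mu_{n_i}$. More precisely, for $(i_0,\dots,i_d)\in Q$ put $I=\{k: i_k>0\}$, $I^c=\{0,\dots,d\}\setminus I$, $s=\#I$, and $\omega=\bigwedge_{k\in I}\frac{x_k^{i_k-1}dx_k}{x_k^{n_k}-1}\in H^s_{\mathrm{dR}}(U_\alpha/\mathbb{C})(i_0,\dots,i_d)$. For $l\in I^c$ let $p_l:U_\alpha\to T_l=\mathbb{A}^1(y_l)\setminus\{y_l=1\}$ be given by $p_l^*y_l=x_l^{n_l}$; fix $k_0\in I^c$, put $T=\prod_{l\in I^c\setminus\{k_0\}}T_l$ and $p=\prod p_l:U_\alpha\to T$. Then the map $H^{j-s}_{\mathrm{dR}}(T/\mathbb{C})\to H^j_{\mathrm{dR}}(U_\alpha/\mathbb{C})(i_0,\dots,i_d)$, $x\mapsto\omega\wedge p^*x$, is bijective. In particular $\dim H^j_{\mathrm{dR}}(U_\alpha/\mathbb{C})(i_0,\dots,i_d)=\binom{d-s}{j-s}=\binom{d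-s}{d-j}$.
   Context: $U_\alpha=\operatorname{Spec}\mathbb{C}[x_0,\dots,x_d]/((1-x_0^{n_0})\cdots(1-x_d^{n_d})-\alpha)$; $H(i_0,\dots,i_d)$ is the eigenspace on which $(\nu_0,\dots,\nu_d)\in\mu_{n_0}\times\cdots\times\mu_{n_d}$, acting via $x_k\mapsto\nu_kx_k$, acts by $\nu_0^{i_0}\cdots\nu_d^{i_d}$. *)

theory Defs
  imports Complex_Main "HOL-Library.Poly_Mapping" "HOL-Library.Function_Algebras"
begin

type_synonym mpoly = "(nat \<Rightarrow>\<^sub>0 nat) \<Rightarrow>\<^sub>0 complex"

(* a differential form: coefficient of dx_S (S a finite set of variable indices, wedge in increasing order) *)
type_synonym dform = "nat set \<Rightarrow> mpoly"

definition Var :: "nat \<Rightarrow> mpoly" where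
  "Var k = Poly_Mapping.single (Poly_Mapping.single k 1) 1"

definition Const :: "complex \<Rightarrow> mpoly" where
  "Const c = Poly_Mapping.single 0 c"

definition pderiv_mp :: "nat \<Rightarrow> mpoly \<Rightarrow> mpoly" where
  "pderiv_mp k p = Abs_poly_mapping
     (\<lambda>(m::nat \<Rightarrow>\<^sub>0 nat). of_nat (Poly_Mapping.lookup m k + 1) * Poly_Mapping.lookup p (m + Poly_Mapping.single k 1))"

definition subst_mp :: "(nat \<Rightarrow> mpoly) \<Rightarrow> mpoly \<Rightarrow> mpoly" where
  "subst_mp \<phi> p = (\<Sum>m\<in>Poly_Mapping.keys p. Const (Poly_Mapping.lookup p m) * (\<Prod>v\<in>Poly_Mapping.keys m. \<phi> v ^ Poly_Mapping.lookup m v))"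

definition poly_in :: "nat set \<Rightarrow> mpoly \<Rightarrow> bool" where
  "poly_in V p \<longleftrightarrow> (\<forall>m\<in>Poly_Mapping.keys p. Poly_Mapping.keys m \<subseteq> V)"

definition is_form :: "nat set \<Rightarrow> nat \<Rightarrow> dform \<Rightarrow> bool" where
  "is_form V j \<eta> \<longleftrightarrow> (\<forall>S. \<eta> S \<noteq> 0 \<longrightarrow> S \<subseteq> V \<and> card S = j \<and> poly_in V (\<eta> S))"

(* sign of dx_S /\ dx_T relative to dx_(S Un T) *)
definition sgn_sets :: "nat set \<Rightarrow> nat set \<Rightarrow> complex" where
  "sgn_sets S T = (-1) ^ card {(s, t). s \<in> S \<and> t \<in> T \<and> t < s}"

definition wedge :: "dform \<Rightarrow> dform \<Rightarrow> dform" where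
  "wedge \<eta> \<theta> = (\<lambda>U. if finite U then
      (\<Sum>S\<in>Pow U. Const (sgn_sets S (U - S)) * \<eta> S * \<theta> (U - S)) else 0)"

definition one_form :: dform where
  "one_form = (\<lambda>U. if U = {} then 1 else 0)"

definition pmult :: "mpoly \<Rightarrow> dform \<Rightarrow> dform" where
  "pmult p \<eta> = (\<lambda>S. p * \<eta> S)"

definition cmul :: "complex \<Rightarrow> dform \<Rightarrow> dform" where
  "cmul c \<eta> = pmult (Const c) \<eta>"

definition ext_d :: "dform \<Rightarrow> dform" where
  "ext_d \<eta> = (\<lambda>U. if finite U then
      (\<Sum>k\<in>U. Const (sgn_sets {k} (U - {k})) * pderiv_mp k (\<eta> (U - {k}))) else 0)"

definition dpoly :: "mpoly \<Rightarrow> dform" where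
  "dpoly g = (\<lambda>U. if card U = 1 then pderiv_mp (the_elem U) g else 0)"

definition wedge_list :: "dform list \<Rightarrow> dform" where
  "wedge_list ws = foldr wedge ws one_form"

(* Omega^j = (+)_S A dx_S / (G * Omega^j + dG /\ Omega^(j-1)); this is the submodule of relations *)
definition rel_forms :: "nat set \<Rightarrow> mpoly set \<Rightarrow> nat \<Rightarrow> dform set" where
  "rel_forms V G j = {\<eta>. \<exists>a b. (\<forall>g\<in>G. is_form V j (a g) \<and>
        (if j = 0 then b g = 0 else is_form V (j - 1) (b g))) \<and>
        \<eta> = (\<Sum>g\<in>G. pmult g (a g) + wedge (dpoly g) (b g))}"

definition closed_forms :: "nat set \<Rightarrow> mpoly set \<Rightarrow> nat \<Rightarrow> dform set" where
  "closed_forms V G j = {\<eta>. is_form V j \<eta> \<and> ext_d \<eta> \<in> rel_forms V G (Suc j)}"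

definition exact_forms :: "nat set \<Rightarrow> mpoly set \<Rightarrow> nat \<Rightarrow> dform set" where
  "exact_forms V G j = {\<eta>. is_form V j \<eta> \<and> (\<exists>\<theta>.
        (if j = 0 then \<theta> = 0 else is_form V (j - 1) \<theta>) \<and> \<eta> - ext_d \<theta> \<in> rel_forms V G j)}"

(* H^j = closed / exact; "dim (A/B) = m" for sets of representatives A and B *)
definition quot_dim :: "dform set \<Rightarrow> dform set \<Rightarrow> nat \<Rightarrow> bool" where
  "quot_dim A B m \<longleftrightarrow> (\<exists>e. (\<forall>i<m. e i \<in> A) \<and>
      (\<forall>c. (\<Sum>i<m. cmul (c i) (e i)) \<in> B \<longrightarrow> (\<forall>i<m. c i = 0)) \<and>
      (\<forall>v\<in>A. \<exists>c. v - (\<Sum>i<m. cmul (c i) (e i)) \<in> B))"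

definition pullback :: "nat set \<Rightarrow> (nat \<Rightarrow> mpoly) \<Rightarrow> dform \<Rightarrow> dform" where
  "pullback W \<phi> \<eta> = (\<Sum>S\<in>Pow W. pmult (subst_mp \<phi> (\<eta> S))
       (wedge_list (map (\<lambda>v. dpoly (\<phi> v)) (sorted_list_of_set S))))"

definition mu :: "nat \<Rightarrow> complex set" where
  "mu m = {z. z ^ m = 1}"

definition Uvars :: "nat \<Rightarrow> nat set" where
  "Uvars d = {..d}"

definition Ueq :: "nat \<Rightarrow> (nat \<Rightarrow> nat) \<Rightarrow> complex \<Rightarrow> mpoly" where
  "Ueq d n \<alpha> = (\<Prod>k\<le>d. 1 - Var k ^ n k) - Const \<alpha>"

definition HU_closed where "HU_closed d n \<alpha> j = closed_forms (Uvars d) {Ueq d n \<alpha>} j"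
definition HU_exact where "HU_exact d n \<alpha> j = exact_forms (Uvars d) {Ueq d n \<alpha>} j"

(* representative of the inverse of x_k^(n_k) - 1 in the coordinate ring of U_alpha *)
definition uinv :: "nat \<Rightarrow> (nat \<Rightarrow> nat) \<Rightarrow> complex \<Rightarrow> nat \<Rightarrow> mpoly" where
  "uinv d n \<alpha> k = - (\<Prod>l\<in>{..d} - {k}. 1 - Var l ^ n l) * Const (1 / \<alpha>)"

definition act_poly :: "(nat \<Rightarrow> complex) \<Rightarrow> mpoly \<Rightarrow> mpoly" where
  "act_poly \<nu> p = Abs_poly_mapping (\<lambda>(m::nat \<Rightarrow>\<^sub>0 nat). (\<Prod>k\<in>Poly_Mapping.keys m. \<nu> k ^ Poly_Mapping.lookup m k) * Poly_Mapping.lookup p m)"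

definition act_form :: "(nat \<Rightarrow> complex) \<Rightarrow> dform \<Rightarrow> dform" where
  "act_form \<nu> \<eta> = (\<lambda>S. Const (\<Prod>k\<in>S. \<nu> k) * act_poly \<nu> (\<eta> S))"

definition chi :: "nat \<Rightarrow> (nat \<Rightarrow> nat) \<Rightarrow> (nat \<Rightarrow> complex) \<Rightarrow> complex" where
  "chi d i \<nu> = (\<Prod>k\<le>d. \<nu> k ^ i k)"

definition eig_closed where
  "eig_closed d n \<alpha> i j = {\<eta>\<in>HU_closed d n \<alpha> j. \<forall>\<nu>. (\<forall>k\<le>d. \<nu> k \<in> mu (n k)) \<longrightarrow>
       act_form \<nu> \<eta> - cmul (chi d i \<nu>) \<eta> \<in> HU_exact d n \<alpha> j}"

definition Qset :: "nat \<Rightarrow> (nat \<Rightarrow> nat) \<Rightarrow> (nat \<Rightarrow> nat) set" where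
  "Qset d n = {i. (\<forall>k\<le>d. i k < n k) \<and> (\<forall>k>d. i k = 0) \<and> (\<exists>k\<le>d. i k = 0)}"

definition Qpart where
  "Qpart d n \<alpha> j = {\<eta>. is_form (Uvars d) j \<eta> \<and> (\<exists>\<eta>s. (\<forall>i\<in>Qset d n. \<eta>s i \<in> eig_closed d n \<alpha> i j) \<and>
       \<eta> - (\<Sum>i\<in>Qset d n. \<eta>s i) \<in> HU_exact d n \<alpha> j)}"

(* dx_k/(x_k - nu), using 1/(x_k-nu) = (sum_{m<n_k} nu^(n_k-1-m) x_k^m)/(x_k^(n_k)-1) *)
definition dlog_form :: "nat \<Rightarrow> (nat \<Rightarrow> nat) \<Rightarrow> complex \<Rightarrow> nat \<Rightarrow> complex \<Rightarrow> dform" where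
  "dlog_form d n \<alpha> k \<nu> = (\<lambda>U. if U = {k} then
      (\<Sum>m<n k. Const (\<nu> ^ (n k - 1 - m)) * Var k ^ m) * uinv d n \<alpha> k else 0)"

definition gen_form :: "nat \<Rightarrow> (nat \<Rightarrow> nat) \<Rightarrow> complex \<Rightarrow> nat set \<Rightarrow> (nat \<Rightarrow> complex) \<Rightarrow> dform" where
  "gen_form d n \<alpha> K \<nu> = wedge_list (map (\<lambda>k. dlog_form d n \<alpha> k (\<nu> k)) (sorted_list_of_set K))"

definition Iset :: "nat \<Rightarrow> (nat \<Rightarrow> nat) \<Rightarrow> nat set" where
  "Iset d i = {k. k \<le> d \<and> 0 < i k}"

definition omega :: "nat \<Rightarrow> (nat \<Rightarrow> nat) \<Rightarrow> complex \<Rightarrow> (nat \<Rightarrow> nat) \<Rightarrow> dform" where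
  "omega d n \<alpha> i = wedge_list (map (\<lambda>k U. if U = {k} then Var k ^ (i k - 1) * uinv d n \<alpha> k else 0)
      (sorted_list_of_set (Iset d i)))"

(* T_l presented as Spec C[y_l, z_l]/(z_l (y_l - 1) - 1), y_l = variable 2l, z_l = variable 2l+1 *)
definition Lset :: "nat \<Rightarrow> (nat \<Rightarrow> nat) \<Rightarrow> nat \<Rightarrow> nat set" where
  "Lset d i k0 = ({..d} - Iset d i) - {k0}"

definition Tvars :: "nat set \<Rightarrow> nat set" where
  "Tvars L = (\<lambda>l. 2 * l) ` L \<union> (\<lambda>l. 2 * l + 1) ` L"

definition Tgens :: "nat set \<Rightarrow> mpoly set" where
  "Tgens L = (\<lambda>l. Var (2 * l + 1) * (Var (2 * l) - 1) - 1) ` L"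

(* p^* y_l = x_l^(n_l), hence p^* z_l = 1/(x_l^(n_l) - 1) *)
definition pmap :: "nat \<Rightarrow> (nat \<Rightarrow> nat) \<Rightarrow> complex \<Rightarrow> nat \<Rightarrow> mpoly" where
  "pmap d n \<alpha> v = (if even v then Var (v div 2) ^ n (v div 2) else uinv d n \<alpha> (v div 2))"

definition omega_pull where
  "omega_pull d n \<alpha> i k0 x = wedge (omega d n \<alpha> i) (pullback (Tvars (Lset d i k0)) (pmap d n \<alpha>) x)"

end

theory Submission
  imports Defs "HOL-Library.FuncSet"
begin

text \<open>
  Put \<open>y\<^sub>k = x\<^sub>k\<^sup>n\<^sup>k\<close> and \<open>u\<^sub>k = y\<^sub>k - 1\<close>. The group acts diagonally on monomials, so the eigenspace
  \<open>(i\<^sub>0, \<dots>, i\<^sub>d)\<close> of the cohomology is computed by the forms of that weight. As \<open>i\<^sub>k\<^sub>0 = 0\<close>, such forms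
  involve \<open>x\<^sub>k\<^sub>0\<close> only through \<open>y\<^sub>k\<^sub>0\<close>, which the equation expresses through the units \<open>u\<^sub>l\<close>,
  \<open>l \<noteq> k\<^sub>0\<close>. What remains is a tensor product over \<open>l \<noteq> k\<^sub>0\<close> of two-term complexes. For \<open>i\<^sub>l = 0\<close> it is
  the de Rham complex of \<open>\<complex>[u, u\<inverse>]\<close>, with cohomology spanned by \<open>1\<close> and \<open>du/u\<close>. For \<open>i\<^sub>l > 0\<close> it is
  \<open>x\<^sup>i \<complex>[u, u\<inverse>] \<rightarrow> x\<^sup>i\<^sup>-\<^sup>1 \<complex>[u, u\<inverse>] dx\<close>, whose differential
  \<open>x\<^sup>i u\<^sup>m \<mapsto> x\<^sup>i\<^sup>-\<^sup>1 ((i + mn) u\<^sup>m + mn u\<^sup>m\<^sup>-\<^sup>1) dx\<close> is injective because \<open>n\<close> does not divide \<open>i\<close>, and has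
  cokernel spanned by \<open>x\<^sup>i\<^sup>-\<^sup>1 dx / u\<close>. Taking the images of the differential as part of a basis of
  the one-forms turns the tensor product into a direct sum of Koszul complexes, all acyclic but one,
  on which the differential vanishes. The torus \<open>T\<close> has the same description with all
  \<open>i\<^sub>l = 0\<close>, and \<open>\<omega> \<and> p\<^sup>*\<close> maps basis forms to basis forms up to sign.
\<close>

text \<open>No quotient is ever formed: forms stay polynomial, and each identity is a membership in
  \<open>rels\<close> or \<open>exacts\<close>. These sets ignore degree and variables. The bounds
  are recovered by projecting a decomposition onto a component spanned by monomial forms
  (\<open>filt\<close>), which works because the equations are homogeneous for every grading in use;
  the same projection isolates the weights. The main obstacle is linear independence modulo the
  relations. It is obtained by evaluation at points of the variety: the coordinates other than
  \<open>x_k0\<close> are taken real and so large that the product of their factors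
  \<open>1 - x^n\<close> exceeds \<alpha> in modulus. Then \<open>x_k0\<close> can be solved for and
  is nonzero, and the question reduces to Laurent polynomials in one variable with infinitely many
  zeros. Independence on the torus is transported from the variety by the comparison map. Given
  independence, closedness becomes an equation between coefficients, and contraction with one index
  yields a primitive. Generation by logarithmic forms is Fourier inversion over the roots of unity,
  applied to the basis forms.\<close>

abbreviation lk :: "('a \<Rightarrow>\<^sub>0 'b::zero) \<Rightarrow> 'a \<Rightarrow> 'b" where "lk \<equiv> Poly_Mapping.lookup"
abbreviation sg :: "'a \<Rightarrow> 'b \<Rightarrow> ('a \<Rightarrow>\<^sub>0 'b::zero)" where "sg \<equiv> Poly_Mapping.single"
abbreviation ky :: "('a \<Rightarrow>\<^sub>0 'b::zero) \<Rightarrow> 'a set" where "ky \<equiv> Poly_Mapping.keys"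

section \<open>Constants, monomials and induction on polynomials\<close>

lemma Const_0 [simp]: "Const 0 = 0" and Const_1 [simp]: "Const 1 = 1"
  by (simp_all add: Const_def)

lemma Const_add: "Const (a + b) = Const a + Const b"
  and Const_mult: "Const (a * b) = Const a * Const b"
  and Const_uminus: "Const (- a) = - Const a"
  and Const_diff: "Const (a - b) = Const a - Const b"
  by (simp_all add: Const_def single_add mult_single single_uminus single_diff)

lemma Const_inject [simp]: "Const a = Const b \<longleftrightarrow> a = b"
  by (metis Const_def lookup_single_eq)

lemma Const_power: "Const (a ^ k) = Const a ^ k"
  by (induction k) (simp_all add: Const_mult)

lemma Const_prod: "Const (\<Prod>x\<in>A. h x) = (\<Prod>x\<in>A. Const (h x))"
  by (induction A rule: infinite_finite_induct) (simp_all add: Const_mult)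

lemma Const_of_nat: "Const (of_nat k) = of_nat k"
  by (induction k) (simp_all add: Const_add)

lemma lk_Const_mult [simp]: "lk (Const c * p) m = c * lk p m"
proof -
  have "Const c * p = Poly_Mapping.map ((*) c) p"
    by (simp add: mult_map_scale_conv_mult Const_def)
  then show ?thesis
    by (simp add: map.rep_eq when_def)
qed

lemma mpoly_sum_monomials: "(\<Sum>m\<in>ky p. sg m (lk p m)) = p"
  by (rule poly_mapping_eqI) (auto simp: lookup_sum lookup_single when_def in_keys_iff)

lemma sg_eq_Const_mult: "sg m c = Const c * sg m (1::complex)"
  by (simp add: Const_def mult_single)

text \<open>The set \<open>A\<close> may exceed the support of \<open>m\<close>, the additional
  factors being \<open>Var v ^ 0\<close>; thus all monomials can be written over one common set of
  variables.\<close>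

lemma monomial_eq_prod_Var:
  assumes "finite A" "ky m \<subseteq> A"
  shows "sg m (1::complex) = (\<Prod>v\<in>A. Var v ^ lk m v)"
proof -
  have pow: "Var v ^ k = sg (sg v k) 1" for v k
    by (induction k) (simp_all add: Var_def mult_single flip: single_add)
  have "(\<Prod>v\<in>B. Var v ^ lk m v) = sg (\<Sum>v\<in>B. sg v (lk m v)) 1" if "finite B" for B
    using that by (induction B) (simp_all add: pow mult_single)
  moreover have "(\<Sum>v\<in>A. sg v (lk m v)) = m"
    using assms by (intro poly_mapping_eqI) (auto simp: lookup_sum lookup_single when_def in_keys_iff)
  ultimately show ?thesis using assms by simp
qed

lemma mpoly_induct [case_names mono add]:
  assumes "\<And>m c. P (sg m c)" "\<And>p q. P p \<Longrightarrow> P q \<Longrightarrow> P (p + q)"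
  shows "P (p :: mpoly)"
proof -
  have "P (\<Sum>m\<in>A. sg m (lk p m))" if "finite A" for A
    using that by (induction A) (auto intro: assms assms(1)[of 0 0, simplified])
  then show ?thesis by (metis mpoly_sum_monomials finite_keys)
qed

text \<open>Polynomials in the variables \<open>W\<close> form the subring generated by constants
  and variables, so a property stable under sums and products, such as the chain rule, is checked on
  generators only.\<close>

lemma poly_in_induct [consumes 1, case_names Const Var add mult]:
  assumes "poly_in W p" "\<And>c. P (Const c)" "\<And>v. v \<in> W \<Longrightarrow> P (Var v)"
    "\<And>p q. P p \<Longrightarrow> P q \<Longrightarrow> P (p + q)" "\<And>p q. P p \<Longrightarrow> P q \<Longrightarrow> P (p * q)"
  shows "P p"
proof -
  have pow: "P (Var v ^ k)" if "v \<in> W" for v k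
    using that assms(2)[of 1] assms(3,5) by (induction k) auto
  have prod: "P (\<Prod>v\<in>A. Var v ^ lk m v)" if "finite A" "A \<subseteq> W" for A and m :: "nat \<Rightarrow>\<^sub>0 nat"
    using that assms(2)[of 1] by (induction A) (auto intro: assms(5) pow)
  have sgl: "P (sg m c)" if "ky m \<subseteq> W" for m c
    using prod[of "ky m" m] that assms(2,5)
    by (subst sg_eq_Const_mult, subst monomial_eq_prod_Var[of "ky m"]) auto
  have "P (\<Sum>m\<in>A. sg m (lk p m))" if "finite A" "A \<subseteq> ky p" for A
    using that assms(1) assms(2)[of 0]
    by (induction A) (auto intro!: assms(4) sgl simp: poly_in_def)
  then show ?thesis by (metis mpoly_sum_monomials finite_keys order_refl)
qed

lemma keys_add_nat: "ky (m + m') = ky m \<union> ky (m' :: nat \<Rightarrow>\<^sub>0 nat)"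
  by (auto simp: in_keys_iff lookup_add)

lemma poly_in_Const [simp]: "poly_in W (Const c)"
  by (auto simp: poly_in_def Const_def split: if_splits)

lemma poly_in_1 [simp]: "poly_in W 1" and poly_in_0 [simp]: "poly_in W 0"
  using poly_in_Const[of W 1] poly_in_Const[of W 0] by simp_all

lemma poly_in_Var [simp]: "poly_in W (Var v) \<longleftrightarrow> v \<in> W"
  by (auto simp: poly_in_def Var_def)

lemma poly_in_add: "poly_in W p \<Longrightarrow> poly_in W q \<Longrightarrow> poly_in W (p + q)"
  using keys_add[of p q] by (auto simp: poly_in_def)

lemma poly_in_uminus [simp]: "poly_in W (- p) \<longleftrightarrow> poly_in W p"
  by (auto simp: poly_in_def in_keys_iff)

lemma poly_in_diff: "poly_in W p \<Longrightarrow> poly_in W q \<Longrightarrow> poly_in W (p - q)"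
  using poly_in_add[of W p "- q"] by simp

lemma poly_in_mult:
  assumes "poly_in W p" "poly_in W q" shows "poly_in W (p * q)"
  unfolding poly_in_def
proof
  fix m assume "m \<in> ky (p * q)"
  then obtain a b where "a \<in> ky p" "b \<in> ky q" "m = a + b"
    using keys_mult[of p q] by auto
  with assms show "ky m \<subseteq> W" by (auto simp: poly_in_def keys_add_nat)
qed

lemma poly_in_prod: "(\<And>x. x \<in> A \<Longrightarrow> poly_in W (h x)) \<Longrightarrow> poly_in W (\<Prod>x\<in>A. h x)"
  by (induction A rule: infinite_finite_induct) (auto intro: poly_in_mult)

section \<open>Partial derivatives\<close>

text \<open>Coefficients of \<open>Abs_poly_mapping\<close> are accessible only once the support is
  known to be finite; it lies in the image of \<open>ky p\<close> under lowering the exponent of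
  \<open>k\<close>.\<close>

lemma lookup_pderiv:
  "lk (pderiv_mp k p) m = of_nat (lk m k + 1) * lk p (m + sg k 1)"
proof -
  have "{m. of_nat (lk m k + 1) * lk p (m + sg k 1) \<noteq> 0} \<subseteq> (\<lambda>m'. m' - sg k 1) ` ky p"
  proof
    fix m assume "m \<in> {m. of_nat (lk m k + 1) * lk p (m + sg k 1) \<noteq> 0}"
    then have "m + sg k 1 \<in> ky p" by (auto simp: in_keys_iff)
    moreover have "m = (m + sg k 1) - sg k 1" by simp
    ultimately show "m \<in> (\<lambda>m'. m' - sg k 1) ` ky p" by blast
  qed
  then have "finite {m. of_nat (lk m k + 1) * lk p (m + sg k 1) \<noteq> 0}"
    by (rule finite_subset) simp
  then show ?thesis by (simp add: pderiv_mp_def)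
qed

lemma pderiv_add [simp]: "pderiv_mp k (p + q) = pderiv_mp k p + pderiv_mp k q"
  by (rule poly_mapping_eqI) (simp add: lookup_pderiv lookup_add algebra_simps)

lemma pderiv_uminus [simp]: "pderiv_mp k (- p) = - pderiv_mp k p"
  by (rule poly_mapping_eqI) (simp add: lookup_pderiv)

lemma pderiv_diff [simp]: "pderiv_mp k (p - q) = pderiv_mp k p - pderiv_mp k q"
  by (rule poly_mapping_eqI) (simp add: lookup_pderiv lookup_minus algebra_simps)

lemma pderiv_0 [simp]: "pderiv_mp k 0 = 0"
  by (rule poly_mapping_eqI) (simp add: lookup_pderiv)

lemma pderiv_sum: "pderiv_mp k (\<Sum>x\<in>A. h x) = (\<Sum>x\<in>A. pderiv_mp k (h x))"
  by (induction A rule: infinite_finite_induct) simp_all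

text \<open>Subtraction of exponents is truncated: if \<open>k\<close> does not occur in
  \<open>m\<close>, then \<open>m - sg k 1\<close> is \<open>m\<close> itself, but the coefficient
  \<open>of_nat (lk m k)\<close> is zero.\<close>

lemma pderiv_single: "pderiv_mp k (sg m c) = sg (m - sg k 1) (of_nat (lk m k) * c)"
proof (rule poly_mapping_eqI)
  fix m'
  show "lk (pderiv_mp k (sg m c)) m' = lk (sg (m - sg k 1) (of_nat (lk m k) * c)) m'"
  proof (cases "lk m k = 0")
    case True
    then have "m \<noteq> m' + sg k 1" by (auto simp: lookup_add)
    with True show ?thesis by (simp add: lookup_pderiv lookup_single when_def)
  next
    case False
    then have m: "m = (m - sg k 1) + sg k 1"
      by (intro poly_mapping_eqI) (auto simp: lookup_add lookup_minus lookup_single when_def)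
    then have "m = m' + sg k 1 \<longleftrightarrow> m - sg k 1 = m'" by auto
    moreover have "m - sg k 1 = m' \<Longrightarrow> lk m k = lk m' k + 1"
      by (subst m) (simp add: lookup_add)
    ultimately show ?thesis by (auto simp: lookup_pderiv lookup_single when_def)
  qed
qed

text \<open>Both sides are additive in \<open>p\<close> and in \<open>q\<close>, so monomials
  suffice. The two auxiliary equations hold because truncation of an exponent occurs only together
  with a zero coefficient.\<close>

lemma pderiv_mult: "pderiv_mp k (p * q) = pderiv_mp k p * q + p * pderiv_mp k q"
proof (induction p rule: mpoly_induct)
  case (mono m c)
  show ?case
  proof (induction q rule: mpoly_induct)
    case (mono m' c')
    have 1: "sg (m - sg k 1 + m') (of_nat (lk m k) * c * c') = sg (m + m' - sg k 1) (of_nat (lk m k) * c * c')"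
    proof (cases "lk m k = 0")
      case False
      then have "m - sg k 1 + m' = m + m' - sg k 1"
        by (intro poly_mapping_eqI) (auto simp: lookup_add lookup_minus lookup_single when_def)
      then show ?thesis by simp
    qed simp
    have 2: "sg (m + (m' - sg k 1)) (of_nat (lk m' k) * c * c') = sg (m + m' - sg k 1) (of_nat (lk m' k) * c * c')"
    proof (cases "lk m' k = 0")
      case False
      then have "m + (m' - sg k 1) = m + m' - sg k 1"
        by (intro poly_mapping_eqI) (auto simp: lookup_add lookup_minus lookup_single when_def)
      then show ?thesis by simp
    qed simp
    show ?case using 1 2
      by (simp add: mult_single pderiv_single lookup_add algebra_simps flip: single_add)
  qed (simp add: algebra_simps)
qed (simp add: algebra_simps)

lemma pderiv_Const [simp]: "pderiv_mp k (Const c) = 0"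
  by (simp add: Const_def pderiv_single)

lemma pderiv_1 [simp]: "pderiv_mp k 1 = 0"
  using pderiv_Const[of k 1] by simp

lemma pderiv_Const_mult [simp]: "pderiv_mp k (Const c * p) = Const c * pderiv_mp k p"
  by (simp add: pderiv_mult)

lemma pderiv_Var: "pderiv_mp k (Var v) = (if k = v then 1 else 0)"
  by (auto simp: Var_def pderiv_single lookup_single)

lemma pderiv_power: "pderiv_mp k (p ^ e) = of_nat e * p ^ (e - 1) * pderiv_mp k p"
proof (induction e)
  case (Suc e)
  show ?case by (cases e) (use Suc in \<open>auto simp: pderiv_mult algebra_simps\<close>)
qed simp

lemma pderiv_commute: "pderiv_mp k (pderiv_mp l p) = pderiv_mp l (pderiv_mp k p)"
  by (rule poly_mapping_eqI) (auto simp: lookup_pderiv lookup_add lookup_single when_def ac_simps)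

section \<open>Substitution and evaluation\<close>

text \<open>Cancellation can shrink the support of a sum, so additivity of the substitution needs
  all three expansions over one common set.\<close>

lemma subst_superset:
  assumes "finite A" "ky p \<subseteq> A"
  shows "subst_mp \<phi> p = (\<Sum>m\<in>A. Const (lk p m) * (\<Prod>v\<in>ky m. \<phi> v ^ lk m v))"
  unfolding subst_mp_def using assms
  by (intro sum.mono_neutral_left) (auto simp: in_keys_iff)

lemma subst_add [simp]: "subst_mp \<phi> (p + q) = subst_mp \<phi> p + subst_mp \<phi> q"
proof -
  let ?A = "ky p \<union> ky q"
  have "ky (p + q) \<subseteq> ?A" by (rule keys_add)
  then show ?thesis
    by (subst (1 2 3) subst_superset[of ?A])
       (auto simp: lookup_add Const_add algebra_simps sum.distrib)
qed

lemma subst_0 [simp]: "subst_mp \<phi> 0 = 0"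
  by (simp add: subst_mp_def)

lemma subst_single: "subst_mp \<phi> (sg m c) = Const c * (\<Prod>v\<in>ky m. \<phi> v ^ lk m v)"
  by (subst subst_superset[of "{m}"]) (auto split: if_splits)

lemma subst_mult [simp]: "subst_mp \<phi> (p * q) = subst_mp \<phi> p * subst_mp \<phi> q"
proof (induction p rule: mpoly_induct)
  case (mono m c)
  show ?case
  proof (induction q rule: mpoly_induct)
    case (mono m' c')
    let ?A = "ky m \<union> ky m'"
    have sup: "(\<Prod>v\<in>ky a. \<phi> v ^ lk a v) = (\<Prod>v\<in>?A. \<phi> v ^ lk a v)" if "ky a \<subseteq> ?A" for a
      using that by (intro prod.mono_neutral_left) (auto simp: in_keys_iff)
    show ?case
      by (simp add: mult_single subst_single sup keys_add_nat lookup_add power_add prod.distrib Const_mult)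
  qed (simp add: algebra_simps)
qed (simp add: algebra_simps)

lemma subst_Const [simp]: "subst_mp \<phi> (Const c) = Const c"
  using subst_single[of \<phi> 0 c] by (simp add: Const_def)

lemma subst_1 [simp]: "subst_mp \<phi> 1 = 1"
  using subst_Const[of \<phi> 1] by simp

lemma subst_Var [simp]: "subst_mp \<phi> (Var v) = \<phi> v"
  by (simp add: Var_def subst_single)

lemma subst_uminus [simp]: "subst_mp \<phi> (- p) = - subst_mp \<phi> p"
  by (metis add_eq_0_iff subst_add subst_0 add.right_inverse)

lemma subst_diff [simp]: "subst_mp \<phi> (p - q) = subst_mp \<phi> p - subst_mp \<phi> q"
  using subst_add[of \<phi> p "- q"] by simp

lemma subst_power [simp]: "subst_mp \<phi> (p ^ k) = subst_mp \<phi> p ^ k"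
  by (induction k) simp_all

lemma subst_prod: "subst_mp \<phi> (\<Prod>x\<in>A. h x) = (\<Prod>x\<in>A. subst_mp \<phi> (h x))"
  by (induction A rule: infinite_finite_induct) simp_all

lemma subst_sum: "subst_mp \<phi> (\<Sum>x\<in>A. h x) = (\<Sum>x\<in>A. subst_mp \<phi> (h x))"
  by (induction A rule: infinite_finite_induct) simp_all

text \<open>The chain rule: both sides are derivations along the substitution, so they agree as soon
  as they agree on constants and variables.\<close>

lemma pderiv_subst:
  assumes "finite W" "poly_in W p"
  shows "pderiv_mp k (subst_mp \<phi> p) = (\<Sum>v\<in>W. subst_mp \<phi> (pderiv_mp v p) * pderiv_mp k (\<phi> v))"
  using assms(2)
proof (induction p rule: poly_in_induct)
  case (Var v)
  have "(\<Sum>w\<in>W. subst_mp \<phi> (pderiv_mp w (Var v)) * pderiv_mp k (\<phi> w))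
      = (\<Sum>w\<in>W. if w = v then pderiv_mp k (\<phi> w) else 0)"
    by (intro sum.cong) (auto simp: pderiv_Var)
  then show ?case using Var assms(1) by simp
qed (auto simp: pderiv_mult algebra_simps sum.distrib sum_distrib_left)

text \<open>The value of \<open>p\<close> at the point \<open>x\<close>. Substituting constants
  leaves a constant polynomial (\<open>Const_evp\<close>), so its coefficient at exponent zero loses
  nothing.\<close>

definition evp :: "(nat \<Rightarrow> complex) \<Rightarrow> mpoly \<Rightarrow> complex" where
  "evp x p = lk (subst_mp (\<lambda>v. Const (x v)) p) 0"

lemma Const_evp: "Const (evp x p) = subst_mp (\<lambda>v. Const (x v)) p"
proof -
  have "\<exists>c. subst_mp (\<lambda>v. Const (x v)) p = Const c"
  proof -
    have "poly_in UNIV p" by (simp add: poly_in_def)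
    then show ?thesis
      by (induction p rule: poly_in_induct) (auto simp flip: Const_add Const_mult)
  qed
  then show ?thesis by (auto simp: evp_def Const_def)
qed

lemma evp_add [simp]: "evp x (p + q) = evp x p + evp x q"
  and evp_mult [simp]: "evp x (p * q) = evp x p * evp x q"
  and evp_uminus [simp]: "evp x (- p) = - evp x p"
  and evp_diff [simp]: "evp x (p - q) = evp x p - evp x q"
  and evp_Const [simp]: "evp x (Const c) = c"
  and evp_Var [simp]: "evp x (Var v) = x v"
  and evp_power [simp]: "evp x (p ^ k) = evp x p ^ k"
  and evp_0 [simp]: "evp x 0 = 0" and evp_1 [simp]: "evp x 1 = 1"
  by (subst Const_inject[symmetric], simp add: Const_evp Const_add Const_mult Const_uminus Const_diff Const_power)+

lemma evp_prod: "evp x (\<Prod>a\<in>A. h a) = (\<Prod>a\<in>A. evp x (h a))"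
  by (induction A rule: infinite_finite_induct) simp_all

lemma evp_sum: "evp x (\<Sum>a\<in>A. h a) = (\<Sum>a\<in>A. evp x (h a))"
  by (induction A rule: infinite_finite_induct) simp_all

lemma sum_fun_apply: "(\<Sum>x\<in>A. h x) y = (\<Sum>x\<in>A. h x (y::'b) :: 'c::comm_monoid_add)"
  by (induction A rule: infinite_finite_induct) simp_all

lemmas form_apply = plus_fun_apply zero_fun_apply sum_fun_apply minus_apply uminus_apply

text \<open>As simplification rules the pointwise equations also fire on unapplied sums of forms,
  turning them into abstractions.\<close>

declare form_apply [simp del]

section \<open>Signs of shuffles\<close>

lemma finite_inversions [simp]:
  "finite S \<Longrightarrow> finite T \<Longrightarrow> finite {(s, t). s \<in> S \<and> t \<in> T \<and> (t::nat) < s}"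
  by (rule finite_subset[of _ "S \<times> T"]) auto

lemma sgn_sets_empty [simp]: "sgn_sets {} T = 1" "sgn_sets S {} = 1"
  by (simp_all add: sgn_sets_def)

lemma sgn_sets_Un_left:
  assumes "finite A" "finite B" "finite T" "A \<inter> B = {}"
  shows "sgn_sets (A \<union> B) T = sgn_sets A T * sgn_sets B T"
proof -
  have "{(s, t). s \<in> A \<union> B \<and> t \<in> T \<and> t < s} =
     {(s, t). s \<in> A \<and> t \<in> T \<and> t < s} \<union> {(s, t). s \<in> B \<and> t \<in> T \<and> t < s}" by auto
  moreover have "{(s, t). s \<in> A \<and> t \<in> T \<and> t < s} \<inter> {(s, t). s \<in> B \<and> t \<in> T \<and> t < s} = {}"
    using assms(4) by auto
  ultimately show ?thesis
    using assms by (simp add: sgn_sets_def card_Un_disjoint power_add)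
qed

lemma sgn_sets_Un_right:
  assumes "finite A" "finite B" "finite S" "A \<inter> B = {}"
  shows "sgn_sets S (A \<union> B) = sgn_sets S A * sgn_sets S B"
proof -
  have "{(s, t). s \<in> S \<and> t \<in> A \<union> B \<and> t < s} =
     {(s, t). s \<in> S \<and> t \<in> A \<and> t < s} \<union> {(s, t). s \<in> S \<and> t \<in> B \<and> t < s}" by auto
  moreover have "{(s, t). s \<in> S \<and> t \<in> A \<and> t < s} \<inter> {(s, t). s \<in> S \<and> t \<in> B \<and> t < s} = {}"
    using assms(4) by auto
  ultimately show ?thesis
    using assms by (simp add: sgn_sets_def card_Un_disjoint power_add)
qed

lemma sgn_sets_square [simp]: "sgn_sets S T * sgn_sets S T = 1"
  by (simp add: sgn_sets_def flip: power_mult_distrib)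

lemma sgn_sets_nz [simp]: "sgn_sets S T \<noteq> 0"
  by (simp add: sgn_sets_def)

lemma sgn_sets_singletons: "sgn_sets {k} {l} = (if l < k then -1 else 1)"
proof -
  have "{(s, t). s \<in> {k} \<and> t \<in> {l} \<and> t < s} = (if l < k then {(k, l)} else {})" by auto
  then show ?thesis by (simp add: sgn_sets_def)
qed

lemma sgn_sets_insert_right:
  "finite T \<Longrightarrow> finite S \<Longrightarrow> l \<notin> T \<Longrightarrow> sgn_sets S (insert l T) = sgn_sets S {l} * sgn_sets S T"
  using sgn_sets_Un_right[of "{l}" T S] by simp

lemma sgn_sets_insert_left:
  "finite T \<Longrightarrow> finite S \<Longrightarrow> l \<notin> S \<Longrightarrow> sgn_sets (insert l S) T = sgn_sets {l} T * sgn_sets S T"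
  using sgn_sets_Un_left[of "{l}" S T] by simp

text \<open>Each element of \<open>T\<close> forms an inversion with \<open>k\<close> in exactly one
  of the two orders, so the two signs differ by \<open>(-1) ^ card T\<close>.\<close>

lemma sgn_sets_swap1:
  assumes "finite T" "k \<notin> T" shows "sgn_sets T {k} = (-1) ^ card T * sgn_sets {k} T"
  using assms
proof (induction T)
  case (insert l T)
  then show ?case
    by (auto simp: sgn_sets_insert_left[of "{k}" T l] sgn_sets_insert_right[of T "{k}" l] sgn_sets_singletons)
qed simp

lemma sgn_sets_less:
  assumes "\<And>s t. s \<in> S \<Longrightarrow> t \<in> T \<Longrightarrow> s < t" shows "sgn_sets S T = 1"
proof -
  have "{(s, t). s \<in> S \<and> t \<in> T \<and> t < s} = {}" using assms by (auto dest: less_asym)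
  then show ?thesis unfolding sgn_sets_def by (simp only: card.empty power_0)
qed

text \<open>Order-preserving renumbering keeps inversions. On the torus the coordinate
  \<open>l\<close> is the variable \<open>2 * l\<close>, and this lets both models share their
  signs.\<close>

lemma sgn_sets_image:
  assumes "strict_mono v" shows "sgn_sets (v ` S) (v ` T) = sgn_sets S T"
proof -
  have "{(s, t). s \<in> v ` S \<and> t \<in> v ` T \<and> t < s} = (\<lambda>(s,t). (v s, v t)) ` {(s, t). s \<in> S \<and> t \<in> T \<and> t < s}"
    using strict_mono_less[OF assms] by (auto simp: image_iff)
  moreover have "inj_on (\<lambda>(s,t). (v s, v t)) {(s, t). s \<in> S \<and> t \<in> T \<and> t < s}"
    using strict_mono_eq[OF assms] by (auto simp: inj_on_def)
  ultimately show ?thesis by (simp add: sgn_sets_def card_image)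
qed

section \<open>The exterior algebra of polynomial forms\<close>

definition dterm :: "nat set \<Rightarrow> mpoly \<Rightarrow> dform" where
  "dterm S p = (\<lambda>U. if U = S then p else 0)"

definition is_1form :: "dform \<Rightarrow> bool" where
  "is_1form w \<longleftrightarrow> (\<forall>U. w U \<noteq> 0 \<longrightarrow> (\<exists>k. U = {k}))"

text \<open>The grading involution. It carries the sign in the Leibniz rule and in the exchange with
  one-forms, so neither rule requires a homogeneous form.\<close>

definition twist :: "dform \<Rightarrow> dform" where
  "twist \<eta> = (\<lambda>S. (-1) ^ card S * \<eta> S)"

lemma twist_twist [simp]: "twist (twist \<eta>) = \<eta>"
  by (auto simp: twist_def fun_eq_iff form_apply)

lemma pmult_apply [simp]: "pmult p \<eta> S = p * \<eta> S"
  by (simp add: pmult_def)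

lemma cmul_apply: "cmul c \<eta> S = Const c * \<eta> S"
  by (simp add: cmul_def)

lemma pmult_simps:
  "pmult p (a + b) = pmult p a + pmult p b" "pmult p (a - b) = pmult p a - pmult p b"
  "pmult (p + q) a = pmult p a + pmult q a" "pmult (p - q) a = pmult p a - pmult q a"
  "pmult p 0 = 0" "pmult 0 a = 0" "pmult 1 a = a" "pmult p (- a) = - pmult p a" "pmult (- p) a = - pmult p a"
  "pmult p (pmult q a) = pmult (p * q) a"
  by (auto simp: fun_eq_iff form_apply algebra_simps)

lemma pmult_sum: "pmult p (\<Sum>x\<in>A. h x) = (\<Sum>x\<in>A. pmult p (h x))"
  by (auto simp: fun_eq_iff form_apply sum_distrib_left)

lemma pmult_sum_left: "pmult (\<Sum>x\<in>A. h x) a = (\<Sum>x\<in>A. pmult (h x) a)"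
  by (auto simp: fun_eq_iff form_apply sum_distrib_right)

lemma pmult_dterm [simp]: "pmult p (dterm S q) = dterm S (p * q)"
  by (auto simp: dterm_def fun_eq_iff form_apply)

lemma cmul_simps:
  "cmul c (a + b) = cmul c a + cmul c b" "cmul c (a - b) = cmul c a - cmul c b"
  "cmul (e + c) a = cmul e a + cmul c a" "cmul (e - c) a = cmul e a - cmul c a"
  "cmul c 0 = 0" "cmul 0 a = 0" "cmul 1 a = a" "cmul c (cmul e a) = cmul (c * e) a" "cmul (- c) a = - cmul c a"
  by (simp_all add: cmul_def pmult_simps Const_add Const_diff Const_mult Const_uminus)

lemma cmul_sum: "cmul c (\<Sum>x\<in>A. h x) = (\<Sum>x\<in>A. cmul c (h x))"
  by (simp add: cmul_def pmult_sum)

lemma cmul_dterm [simp]: "cmul c (dterm S q) = dterm S (Const c * q)"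
  by (simp add: cmul_def)

lemma dterm_add: "dterm S (p + q) = dterm S p + dterm S q"
  and dterm_diff: "dterm S (p - q) = dterm S p - dterm S q"
  and dterm_0 [simp]: "dterm S 0 = 0" and dterm_uminus: "dterm S (- p) = - dterm S p"
  by (auto simp: dterm_def fun_eq_iff form_apply)

lemma dterm_sum: "dterm S (\<Sum>x\<in>A. h x) = (\<Sum>x\<in>A. dterm S (h x))"
  by (auto simp: dterm_def fun_eq_iff form_apply)

lemma one_form_dterm: "one_form = dterm {} 1"
  by (simp add: one_form_def dterm_def)

lemma wedge_simps:
  "wedge (a + b) c = wedge a c + wedge b c" "wedge (a - b) c = wedge a c - wedge b c"
  "wedge a (b + c) = wedge a b + wedge a c" "wedge a (b - c) = wedge a b - wedge a c"
  "wedge 0 a = 0" "wedge a 0 = 0" "wedge (- a) b = - wedge a b" "wedge a (- b) = - wedge a b"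
  by (auto simp: wedge_def fun_eq_iff form_apply algebra_simps sum.distrib sum_subtractf sum_negf)

lemma wedge_pmult [simp]:
  "wedge (pmult p a) b = pmult p (wedge a b)" "wedge a (pmult p b) = pmult p (wedge a b)"
  by (auto simp: wedge_def fun_eq_iff form_apply sum_distrib_left ac_simps)

lemma wedge_cmul [simp]:
  "wedge (cmul c a) b = cmul c (wedge a b)" "wedge a (cmul c b) = cmul c (wedge a b)"
  by (simp_all add: cmul_def)

lemma wedge_sum_left: "wedge (\<Sum>x\<in>A. h x) a = (\<Sum>x\<in>A. wedge (h x) a)"
  by (induction A rule: infinite_finite_induct) (simp_all add: wedge_simps)

lemma wedge_sum_right: "wedge a (\<Sum>x\<in>A. h x) = (\<Sum>x\<in>A. wedge a (h x))"
  by (induction A rule: infinite_finite_induct) (simp_all add: wedge_simps)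

text \<open>Useful because the differential agrees with a finite sum of
  \<open>dx_k \<and> \<partial>_k\<close> only on subsets of a finite set of variables.\<close>

lemma wedge_local:
  assumes "\<And>S. S \<subseteq> U \<Longrightarrow> a S = a' S" "\<And>S. S \<subseteq> U \<Longrightarrow> b S = b' S"
  shows "wedge a b U = wedge a' b' U"
  unfolding wedge_def using assms by (auto intro!: sum.cong)

lemma wedge_infinite [simp]: "infinite U \<Longrightarrow> wedge a b U = 0"
  by (simp add: wedge_def)

text \<open>Both sides sum over the ordered partitions of \<open>U\<close> into \<open>R\<close>,
  \<open>B\<close>, \<open>C\<close>. The signs agree since \<open>sgn_sets\<close> is
  multiplicative in each argument: either product equals the sign of the pairs
  \<open>(R, B)\<close>, \<open>(R, C)\<close> and \<open>(B, C)\<close>.\<close>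

lemma wedge_assoc: "wedge (wedge a b) c = wedge a (wedge b c)"
proof
  fix U
  show "wedge (wedge a b) c U = wedge a (wedge b c) U"
  proof (cases "finite U")
    case fin: True
    have finS: "finite S" if "S \<subseteq> U" for S using that fin finite_subset by blast
    let ?f = "\<lambda>S R. Const (sgn_sets S (U - S)) * Const (sgn_sets R (S - R)) * a R * b (S - R) * c (U - S)"
    let ?g = "\<lambda>R B. Const (sgn_sets R (U - R)) * Const (sgn_sets B (U - R - B)) * a R * b B * c (U - R - B)"
    have "wedge (wedge a b) c U = (\<Sum>S\<in>Pow U. \<Sum>R\<in>Pow S. ?f S R)"
      using fin finS by (auto simp: wedge_def sum_distrib_left sum_distrib_right ac_simps intro!: sum.cong)
    also have "\<dots> = (\<Sum>(S,R)\<in>Sigma (Pow U) Pow. ?f S R)"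
      using fin finS by (subst sum.Sigma) auto
    also have "\<dots> = (\<Sum>(R,B)\<in>Sigma (Pow U) (\<lambda>R. Pow (U - R)). ?g R B)"
    proof (rule sum.reindex_bij_witness[where i = "\<lambda>(R,B). (R \<union> B, R)" and j = "\<lambda>(S,R). (R, S - R)"], goal_cases)
      case (5 x)
      then obtain S R where x: "x = (S, R)" "S \<subseteq> U" "R \<subseteq> S" by auto
      define B C where "B = S - R" and "C = U - S"
      have fins: "finite R" "finite B" "finite C" using x finS fin by (auto simp: B_def C_def)
      have eqs: "S = R \<union> B" "U - R = B \<union> C" "U - R - B = C" "R \<inter> B = {}" "B \<inter> C = {}" "S - R = B" "U - S = C" using x by (auto simp: B_def C_def)
      have "sgn_sets S C * sgn_sets R B = sgn_sets R (U - R) * sgn_sets B C"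
        using eqs fins by (simp add: sgn_sets_Un_left sgn_sets_Un_right)
      then have "Const (sgn_sets S C) * Const (sgn_sets R B) = Const (sgn_sets R (U - R)) * Const (sgn_sets B C)"
        by (simp flip: Const_mult)
      then show ?case using x eqs by simp
    qed auto
    also have "\<dots> = (\<Sum>R\<in>Pow U. \<Sum>B\<in>Pow (U - R). ?g R B)"
      using fin by (subst sum.Sigma) auto
    also have "\<dots> = wedge a (wedge b c) U"
      using fin by (auto simp: wedge_def sum_distrib_left sum_distrib_right ac_simps intro!: sum.cong)
    finally show ?thesis .
  qed simp
qed

lemma wedge_dterm_left:
  assumes "finite U"
  shows "wedge (dterm S p) b U = (if S \<subseteq> U then Const (sgn_sets S (U - S)) * p * b (U - S) else 0)"
proof -
  have "wedge (dterm S p) b U = (\<Sum>R\<in>Pow U. if R = S then Const (sgn_sets S (U - S)) * p * b (U - S) else 0)"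
    unfolding wedge_def dterm_def using assms by (simp only: if_True, intro sum.cong) auto
  then show ?thesis using assms by simp
qed

lemma wedge_dterm:
  assumes "finite S" "finite T" "S \<inter> T = {}"
  shows "wedge (dterm S p) (dterm T q) = dterm (S \<union> T) (Const (sgn_sets S T) * p * q)"
proof
  fix U show "wedge (dterm S p) (dterm T q) U = dterm (S \<union> T) (Const (sgn_sets S T) * p * q) U"
  proof (cases "finite U")
    case True
    moreover have "S \<subseteq> U \<and> U - S = T \<longleftrightarrow> U = S \<union> T" using assms by auto
    ultimately have "wedge (dterm S p) (dterm T q) U = (if U = S \<union> T then Const (sgn_sets S (U - S)) * p * q else 0)"
      unfolding wedge_dterm_left[OF \<open>finite U\<close>] by (auto simp: dterm_def)
    moreover have "U = S \<union> T \<Longrightarrow> U - S = T" using assms by auto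
    ultimately show ?thesis by (auto simp: dterm_def)
  qed (use assms in \<open>auto simp: dterm_def\<close>)
qed

lemma wedge_dterm_meet:
  assumes "S \<inter> T \<noteq> {}"
  shows "wedge (dterm S p) (dterm T q) = 0"
proof
  fix U show "wedge (dterm S p) (dterm T q) U = 0 U"
  proof (cases "finite U")
    case True
    have "S \<subseteq> U \<Longrightarrow> U - S \<noteq> T" using assms by auto
    then show ?thesis unfolding wedge_dterm_left[OF True] by (simp add: dterm_def form_apply)
  qed (simp add: form_apply)
qed

lemma is_1form_simps [simp]: "is_1form (dterm {k} p)" "is_1form (dpoly g)" "is_1form 0"
  by (auto simp: form_apply is_1form_def dterm_def dpoly_def card_1_singleton_iff)

lemma wedge_1form_left:
  assumes "is_1form w" "finite U"
  shows "wedge w b U = (\<Sum>k\<in>U. Const (sgn_sets {k} (U - {k})) * w {k} * b (U - {k}))"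
proof -
  have "wedge w b U = (\<Sum>S\<in>(\<lambda>k. {k}) ` U. Const (sgn_sets S (U - S)) * w S * b (U - S))"
    unfolding wedge_def using assms
    by (simp, intro sum.mono_neutral_right) (auto simp: is_1form_def image_iff)
  also have "\<dots> = (\<Sum>k\<in>U. Const (sgn_sets {k} (U - {k})) * w {k} * b (U - {k}))"
    by (subst sum.reindex) (auto simp: inj_on_def)
  finally show ?thesis .
qed

lemma wedge_1form_right:
  assumes "is_1form w" "finite U"
  shows "wedge b w U = (\<Sum>k\<in>U. Const (sgn_sets (U - {k}) {k}) * b (U - {k}) * w {k})"
proof -
  have "wedge b w U = (\<Sum>S\<in>(\<lambda>k. U - {k}) ` U. Const (sgn_sets S (U - S)) * b S * w (U - S))"
    unfolding wedge_def using assms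
  proof (simp, intro sum.mono_neutral_right ballI)
    fix S assume S: "S \<in> Pow U - (\<lambda>k. U - {k}) ` U"
    have "w (U - S) = 0"
    proof (rule ccontr)
      assume "w (U - S) \<noteq> 0"
      then obtain k where "U - S = {k}" using assms by (auto simp: is_1form_def)
      then have "S = U - {k}" "k \<in> U" using S by auto
      then show False using S by auto
    qed
    then show "Const (sgn_sets S (U - S)) * b S * w (U - S) = 0" by simp
  qed auto
  also have "\<dots> = (\<Sum>k\<in>U. Const (sgn_sets (U - {k}) {k}) * b (U - {k}) * w {k})"
  proof (subst sum.reindex)
    have "U - (U - {k}) = {k}" if "k \<in> U" for k using that by auto
    then show "sum ((\<lambda>S. Const (sgn_sets S (U - S)) * b S * w (U - S)) \<circ> (\<lambda>k. U - {k})) U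
       = (\<Sum>k\<in>U. Const (sgn_sets (U - {k}) {k}) * b (U - {k}) * w {k})"
      by (intro sum.cong) simp_all
  qed (auto simp: inj_on_def)
  finally show ?thesis .
qed

text \<open>Moving one index past the others costs the sign from \<open>sgn_sets_swap1\<close>, and
  \<open>twist\<close> records it for every component of \<open>b\<close> at once.\<close>

lemma wedge_1form_commute:
  assumes "is_1form w" shows "wedge b w = wedge w (twist b)"
proof
  fix U show "wedge b w U = wedge w (twist b) U"
  proof (cases "finite U")
    case True
    have "Const (sgn_sets (U - {k}) {k}) = Const (sgn_sets {k} (U - {k})) * (- 1) ^ card (U - {k})" for k
      using True by (simp add: sgn_sets_swap1 Const_mult Const_power Const_uminus)
    then show ?thesis using True assms
      by (simp add: wedge_1form_left wedge_1form_right twist_def ac_simps)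
  qed simp
qed

lemma twist_1form: "is_1form w \<Longrightarrow> twist w = - w"
proof
  fix U assume "is_1form w"
  then have "w U = 0 \<or> (\<exists>k. U = {k})" by (auto simp: is_1form_def)
  then show "twist w U = (- w) U" by (auto simp: twist_def form_apply)
qed

lemma wedge_1form_anticommute:
  "is_1form a \<Longrightarrow> is_1form b \<Longrightarrow> wedge a b = - wedge b a"
  by (simp add: wedge_1form_commute[of b a] twist_1form wedge_simps)

lemma wedge_1form_self: "is_1form a \<Longrightarrow> wedge a a = 0"
proof -
  assume "is_1form a"
  then have "wedge a a = - wedge a a" by (intro wedge_1form_anticommute)
  then have "wedge a a S = - wedge a a S" for S by (metis uminus_apply)
  then show ?thesis by (auto simp: fun_eq_iff form_apply)
qed

section \<open>The exterior derivative\<close>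

definition pderiv_form :: "nat \<Rightarrow> dform \<Rightarrow> dform" where
  "pderiv_form k \<eta> = (\<lambda>S. pderiv_mp k (\<eta> S))"

text \<open>There are infinitely many variables, so the differential is a sum of
  \<open>dx_k \<and> \<partial>_k\<close> only locally, at sets \<open>U\<close> inside a finite
  \<open>V\<close>.\<close>

lemma ext_d_wedge_sum:
  assumes "finite V" "U \<subseteq> V"
  shows "ext_d \<eta> U = (\<Sum>k\<in>V. wedge (dterm {k} 1) (pderiv_form k \<eta>)) U"
proof -
  have U: "finite U" using assms finite_subset by blast
  have "(\<Sum>k\<in>V. wedge (dterm {k} 1) (pderiv_form k \<eta>)) U = (\<Sum>k\<in>U. wedge (dterm {k} 1) (pderiv_form k \<eta>) U)"
    using assms U by (simp add: form_apply, intro sum.mono_neutral_right) (auto simp: wedge_dterm_left)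
  then show ?thesis using U by (simp add: ext_d_def wedge_dterm_left pderiv_form_def)
qed

lemma pderiv_form_wedge: "pderiv_form k (wedge a b) = wedge (pderiv_form k a) b + wedge a (pderiv_form k b)"
  by (auto simp: fun_eq_iff form_apply pderiv_form_def wedge_def pderiv_sum pderiv_mult algebra_simps sum.distrib intro!: sum.cong)

lemma ext_d_infinite [simp]: "infinite U \<Longrightarrow> ext_d a U = 0"
  by (simp add: ext_d_def)

text \<open>Near a finite \<open>U\<close> the differential is the sum of
  \<open>dx_k \<and> \<partial>_k\<close>; the product rule for each partial derivative gives two
  sums, and in the second \<open>dx_k\<close> is moved past \<open>a\<close>, which produces the
  twist.\<close>

lemma ext_d_wedge: "ext_d (wedge a b) = wedge (ext_d a) b + wedge (twist a) (ext_d b)"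
proof
  fix U show "ext_d (wedge a b) U = (wedge (ext_d a) b + wedge (twist a) (ext_d b)) U"
  proof (cases "finite U")
    case True
    let ?d = "\<lambda>k. dterm {k} 1"
    have comm: "wedge (?d k) c = wedge (twist c) (?d k)" for k c
      using wedge_1form_commute[of "?d k" "twist c"] by simp
    have "ext_d (wedge a b) U = (\<Sum>k\<in>U. wedge (wedge (?d k) (pderiv_form k a)) b + wedge (wedge (?d k) a) (pderiv_form k b)) U"
      using True by (simp add: ext_d_wedge_sum[of U U] pderiv_form_wedge wedge_simps wedge_assoc form_apply)
    also have "\<dots> = wedge (\<Sum>k\<in>U. wedge (?d k) (pderiv_form k a)) b U + wedge (twist a) (\<Sum>k\<in>U. wedge (?d k) (pderiv_form k b)) U"
      by (simp add: comm[of _ a] wedge_assoc wedge_sum_left wedge_sum_right sum.distrib form_apply)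
    also have "wedge (\<Sum>k\<in>U. wedge (?d k) (pderiv_form k a)) b U = wedge (ext_d a) b U"
      by (rule wedge_local) (simp_all only: ext_d_wedge_sum[OF True])
    also have "wedge (twist a) (\<Sum>k\<in>U. wedge (?d k) (pderiv_form k b)) U = wedge (twist a) (ext_d b) U"
      by (rule wedge_local) (simp_all only: ext_d_wedge_sum[OF True])
    finally show ?thesis by (simp add: form_apply)
  qed (simp add: form_apply)
qed

lemma ext_d_simps:
  "ext_d (a + b) = ext_d a + ext_d b" "ext_d (a - b) = ext_d a - ext_d b" "ext_d 0 = 0" "ext_d (- a) = - ext_d a"
  by (auto simp: ext_d_def fun_eq_iff form_apply algebra_simps sum.distrib sum_subtractf sum_negf)

lemma ext_d_sum: "ext_d (\<Sum>x\<in>A. h x) = (\<Sum>x\<in>A. ext_d (h x))"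
  by (induction A rule: infinite_finite_induct) (simp_all add: ext_d_simps)

lemma dpoly_singleton [simp]: "dpoly g {k} = pderiv_mp k g"
  by (simp add: dpoly_def)

lemma ext_d_pmult: "ext_d (pmult p a) = wedge (dpoly p) a + pmult p (ext_d a)"
proof
  fix U show "ext_d (pmult p a) U = (wedge (dpoly p) a + pmult p (ext_d a)) U"
    by (cases "finite U")
       (auto simp: form_apply ext_d_def wedge_1form_left pderiv_mult algebra_simps sum.distrib sum_distrib_left)
qed

lemma dpoly_simps:
  "dpoly (p + q) = dpoly p + dpoly q" "dpoly (p - q) = dpoly p - dpoly q" "dpoly (- p) = - dpoly p"
  "dpoly (p * q) = pmult p (dpoly q) + pmult q (dpoly p)" "dpoly (Const c) = 0" "dpoly 0 = 0" "dpoly 1 = 0"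
  by (auto simp: dpoly_def fun_eq_iff form_apply pderiv_mult algebra_simps)

lemma dpoly_power: "dpoly (p ^ e) = pmult (of_nat e * p ^ (e - 1)) (dpoly p)"
  by (auto simp: dpoly_def fun_eq_iff form_apply pderiv_power)

lemma dpoly_Var: "dpoly (Var v) = dterm {v} 1"
  by (auto simp: dpoly_def fun_eq_iff form_apply dterm_def pderiv_Var card_1_singleton_iff)

lemma ext_d_cmul: "ext_d (cmul c a) = cmul c (ext_d a)"
  by (simp add: cmul_def ext_d_pmult dpoly_simps wedge_simps)

text \<open>Only two-element sets can carry a coefficient, and there the two mixed partial
  derivatives occur with opposite signs.\<close>

lemma ext_d_dpoly: "ext_d (dpoly g) = 0"
proof
  fix U show "ext_d (dpoly g) U = 0 U"
  proof (cases "\<exists>k l. k < l \<and> U = {k, l}")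
    case True
    then obtain k l where "k < l" and U: "U = {k, l}" by auto
    moreover from this have "{k, l} - {k} = {l}" "{k, l} - {l} = {k}" by auto
    ultimately show ?thesis
      by (simp add: form_apply ext_d_def sgn_sets_singletons Const_uminus pderiv_commute[of k l])
  next
    case False
    have "card (U - {k}) \<noteq> 1" if "k \<in> U" for k
    proof
      assume "card (U - {k}) = 1"
      then obtain l where "U - {k} = {l}" by (auto simp: card_1_singleton_iff)
      then have "U = {k, l}" "k \<noteq> l" using that by auto
      then show False using False by (metis insert_commute linorder_neqE_nat)
    qed
    then show ?thesis by (simp add: form_apply ext_d_def dpoly_def)
  qed
qed

lemma ext_d_dwedge: "ext_d (wedge (dpoly g) b) = wedge (dpoly g) (- ext_d b)"
  by (simp add: ext_d_wedge ext_d_dpoly twist_1form wedge_simps)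

lemma ext_d_dterm_one [simp]: "ext_d (dterm S 1) = 0"
  by (auto simp: ext_d_def dterm_def fun_eq_iff form_apply intro!: sum.neutral)

lemma ext_d_dterm: "ext_d (dterm S p) = wedge (dpoly p) (dterm S 1)"
  using ext_d_pmult[of p "dterm S 1"] by (simp add: pmult_simps)

section \<open>The submodule of relations\<close>

text \<open>The relations of \<^term>\<open>rel_forms\<close> without constraints on degree and variables; 
  \<open>rels_rel_forms\<close> shows that for homogeneous forms they can be restored.\<close>

definition rels :: "mpoly set \<Rightarrow> dform set" where
  "rels G = {\<eta>. \<exists>a b. \<eta> = (\<Sum>g\<in>G. pmult g (a g) + wedge (dpoly g) (b g))}"

lemma relsI: "\<eta> = (\<Sum>g\<in>G. pmult g (a g) + wedge (dpoly g) (b g)) \<Longrightarrow> \<eta> \<in> rels G"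
  by (auto simp: rels_def)

lemma rels_0 [simp]: "0 \<in> rels G"
  by (rule relsI[of _ "\<lambda>_. 0" "\<lambda>_. 0"]) (simp add: pmult_simps wedge_simps)

lemma rels_add: "\<eta> \<in> rels G \<Longrightarrow> \<theta> \<in> rels G \<Longrightarrow> \<eta> + \<theta> \<in> rels G"
proof -
  assume "\<eta> \<in> rels G" "\<theta> \<in> rels G"
  then obtain a b a' b' where "\<eta> = (\<Sum>g\<in>G. pmult g (a g) + wedge (dpoly g) (b g))"
    "\<theta> = (\<Sum>g\<in>G. pmult g (a' g) + wedge (dpoly g) (b' g))" by (auto simp: rels_def)
  then show ?thesis
    by (intro relsI[of _ "\<lambda>g. a g + a' g" "\<lambda>g. b g + b' g"])
       (simp add: pmult_simps wedge_simps sum.distrib algebra_simps)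
qed

lemma rels_pmult: "\<eta> \<in> rels G \<Longrightarrow> pmult p \<eta> \<in> rels G"
proof -
  assume "\<eta> \<in> rels G"
  then obtain a b where "\<eta> = (\<Sum>g\<in>G. pmult g (a g) + wedge (dpoly g) (b g))" by (auto simp: rels_def)
  then show ?thesis
    by (intro relsI[of _ "\<lambda>g. pmult p (a g)" "\<lambda>g. pmult p (b g)"])
       (simp add: pmult_simps pmult_sum mult.commute)
qed

lemma rels_cmul: "\<eta> \<in> rels G \<Longrightarrow> cmul c \<eta> \<in> rels G"
  by (simp add: cmul_def rels_pmult)

lemma rels_uminus: "\<eta> \<in> rels G \<Longrightarrow> - \<eta> \<in> rels G"
  using rels_cmul[of \<eta> G "-1"] by (simp add: cmul_simps)

lemma rels_diff: "\<eta> \<in> rels G \<Longrightarrow> \<theta> \<in> rels G \<Longrightarrow> \<eta> - \<theta> \<in> rels G"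
  using rels_add[of \<eta> G "- \<theta>"] rels_uminus by simp

lemma rels_sum: "(\<And>x. x \<in> A \<Longrightarrow> h x \<in> rels G) \<Longrightarrow> (\<Sum>x\<in>A. h x) \<in> rels G"
  by (induction A rule: infinite_finite_induct) (auto intro: rels_add)

lemma rels_wedge_right: "\<eta> \<in> rels G \<Longrightarrow> wedge \<eta> w \<in> rels G"
proof -
  assume "\<eta> \<in> rels G"
  then obtain a b where "\<eta> = (\<Sum>g\<in>G. pmult g (a g) + wedge (dpoly g) (b g))" by (auto simp: rels_def)
  then show ?thesis
    by (intro relsI[of _ "\<lambda>g. wedge (a g) w" "\<lambda>g. wedge (b g) w"])
       (simp add: wedge_sum_left wedge_assoc wedge_simps)
qed

lemma rels_wedge_left: "\<eta> \<in> rels G \<Longrightarrow> wedge w \<eta> \<in> rels G"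
proof -
  assume "\<eta> \<in> rels G"
  then obtain a b where "\<eta> = (\<Sum>g\<in>G. pmult g (a g) + wedge (dpoly g) (b g))" by (auto simp: rels_def)
  then show ?thesis
    by (intro relsI[of _ "\<lambda>g. wedge w (a g)" "\<lambda>g. wedge (twist w) (b g)"])
       (simp add: wedge_sum_right wedge_simps wedge_1form_commute[of "dpoly _" w] flip: wedge_assoc)
qed

text \<open>Differentiating \<open>g a\<close> produces \<open>dg \<and> a\<close>, which is again a
  relation: \<open>a\<close> moves into the second family, where it joins
  \<open>- ext_d (b g)\<close>.\<close>

lemma rels_ext_d: "\<eta> \<in> rels G \<Longrightarrow> ext_d \<eta> \<in> rels G"
proof -
  assume "\<eta> \<in> rels G"
  then obtain a b where "\<eta> = (\<Sum>g\<in>G. pmult g (a g) + wedge (dpoly g) (b g))" by (auto simp: rels_def)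
  then show ?thesis
    by (intro relsI[of _ "\<lambda>g. ext_d (a g)" "\<lambda>g. a g - ext_d (b g)"])
       (simp add: ext_d_sum ext_d_simps ext_d_pmult ext_d_dwedge wedge_simps algebra_simps)
qed

text \<open>Exactness without bounds on degree and variables; \<open>exact_forms_iff\<close> shows
  that for homogeneous forms nothing is gained by dropping them.\<close>

definition exacts :: "mpoly set \<Rightarrow> dform set" where
  "exacts G = {\<eta>. \<exists>\<theta>. \<eta> - ext_d \<theta> \<in> rels G}"

lemma exactsI: "\<eta> - ext_d \<theta> \<in> rels G \<Longrightarrow> \<eta> \<in> exacts G"
  by (auto simp: exacts_def)

lemma rels_exacts: "\<eta> \<in> rels G \<Longrightarrow> \<eta> \<in> exacts G"
  by (rule exactsI[of _ 0]) (simp add: ext_d_simps)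

lemma exacts_0 [simp]: "0 \<in> exacts G"
  by (simp add: rels_exacts)

lemma exacts_add: "\<eta> \<in> exacts G \<Longrightarrow> \<theta> \<in> exacts G \<Longrightarrow> \<eta> + \<theta> \<in> exacts G"
proof -
  assume "\<eta> \<in> exacts G" "\<theta> \<in> exacts G"
  then obtain a b where "\<eta> - ext_d a \<in> rels G" "\<theta> - ext_d b \<in> rels G" by (auto simp: exacts_def)
  from rels_add[OF this] show ?thesis
    by (intro exactsI[of _ "a + b"]) (simp add: ext_d_simps algebra_simps)
qed

lemma exacts_cmul: "\<eta> \<in> exacts G \<Longrightarrow> cmul c \<eta> \<in> exacts G"
proof -
  assume "\<eta> \<in> exacts G"
  then obtain a where "\<eta> - ext_d a \<in> rels G" by (auto simp: exacts_def)
  from rels_cmul[OF this, of c] show ?thesis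
    by (intro exactsI[of _ "cmul c a"]) (simp add: ext_d_cmul cmul_simps)
qed

lemma exacts_uminus: "\<eta> \<in> exacts G \<Longrightarrow> - \<eta> \<in> exacts G"
  using exacts_cmul[of \<eta> G "-1"] by (simp add: cmul_simps)

lemma exacts_diff: "\<eta> \<in> exacts G \<Longrightarrow> \<theta> \<in> exacts G \<Longrightarrow> \<eta> - \<theta> \<in> exacts G"
  using exacts_add[of \<eta> G "- \<theta>"] exacts_uminus by simp

lemma exacts_sum: "(\<And>x. x \<in> A \<Longrightarrow> h x \<in> exacts G) \<Longrightarrow> (\<Sum>x\<in>A. h x) \<in> exacts G"
  by (induction A rule: infinite_finite_induct) (auto intro: exacts_add)

section \<open>The ideal of the equations and the relations it causes\<close>

definition ideal :: "mpoly set \<Rightarrow> mpoly set" where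
  "ideal G = {p. \<exists>a. p = (\<Sum>g\<in>G. g * a g)}"

lemma ideal_0 [simp]: "0 \<in> ideal G"
  by (auto simp: ideal_def intro!: exI[of _ "\<lambda>_. 0"])

lemma ideal_add: "p \<in> ideal G \<Longrightarrow> q \<in> ideal G \<Longrightarrow> p + q \<in> ideal G"
proof -
  assume "p \<in> ideal G" "q \<in> ideal G"
  then obtain a b where "p = (\<Sum>g\<in>G. g * a g)" "q = (\<Sum>g\<in>G. g * b g)" by (auto simp: ideal_def)
  then have "p + q = (\<Sum>g\<in>G. g * (a g + b g))" by (simp add: algebra_simps sum.distrib)
  then show ?thesis by (auto simp: ideal_def)
qed

lemma ideal_mult: "p \<in> ideal G \<Longrightarrow> q * p \<in> ideal G"
proof -
  assume "p \<in> ideal G"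
  then obtain a where "p = (\<Sum>g\<in>G. g * a g)" by (auto simp: ideal_def)
  then have "q * p = (\<Sum>g\<in>G. g * (q * a g))" by (simp add: sum_distrib_left ac_simps)
  then show ?thesis by (auto simp: ideal_def)
qed

lemma ideal_mult2: "p \<in> ideal G \<Longrightarrow> p * q \<in> ideal G"
  using ideal_mult[of p G q] by (simp add: mult.commute)

lemma ideal_uminus: "p \<in> ideal G \<Longrightarrow> - p \<in> ideal G"
  using ideal_mult[of p G "-1"] by simp

lemma ideal_diff: "p \<in> ideal G \<Longrightarrow> q \<in> ideal G \<Longrightarrow> p - q \<in> ideal G"
  using ideal_add[of p G "- q"] ideal_uminus by simp

lemma ideal_gen: "finite G \<Longrightarrow> g \<in> G \<Longrightarrow> g \<in> ideal G"
  unfolding ideal_def by (auto simp: if_distrib cong: if_cong intro!: exI[of _ "\<lambda>h. if h = g then 1 else 0"])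

lemma ideal_sub_mult:
  assumes "p - p' \<in> ideal G" "q - q' \<in> ideal G" shows "p * q - p' * q' \<in> ideal G"
proof -
  have "p * q - p' * q' = q * (p - p') + p' * (q - q')" by (simp add: algebra_simps)
  then show ?thesis using assms by (auto intro: ideal_add ideal_mult)
qed

lemma ideal_sub_prod:
  "(\<And>x. x \<in> A \<Longrightarrow> h x - h' x \<in> ideal G) \<Longrightarrow> (\<Prod>x\<in>A. h x) - (\<Prod>x\<in>A. h' x) \<in> ideal G"
  by (induction A rule: infinite_finite_induct) (auto intro: ideal_sub_mult)

lemma wedge_one_right: "is_1form w \<Longrightarrow> wedge w one_form = w"
proof
  fix U assume w: "is_1form w"
  show "wedge w one_form U = w U"
  proof (cases "\<exists>k. U = {k}")
    case True then show ?thesis using w by (auto simp: wedge_1form_left one_form_def)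
  next
    case False
    then have "U - {k} \<noteq> {}" if "k \<in> U" for k using that by auto
    moreover have "w U = 0" using False w by (auto simp: is_1form_def)
    ultimately show ?thesis using w by (cases "finite U") (auto simp: wedge_1form_left one_form_def)
  qed
qed

lemma rels_ideal: "p \<in> ideal G \<Longrightarrow> pmult p \<theta> \<in> rels G"
proof -
  assume "p \<in> ideal G"
  then obtain a where "p = (\<Sum>g\<in>G. g * a g)" by (auto simp: ideal_def)
  then show ?thesis
    by (intro relsI[of _ "\<lambda>g. pmult (a g) \<theta>" "\<lambda>_. 0"]) (simp add: pmult_sum_left pmult_simps wedge_simps)
qed

lemma dpoly_sum: "dpoly (\<Sum>x\<in>A. h x) = (\<Sum>x\<in>A. dpoly (h x))"
  by (induction A rule: infinite_finite_induct) (simp_all add: dpoly_simps)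

text \<open>In \<open>d (g a) = g da + a dg\<close> the second term is of the shape
  \<open>dg \<and> b\<close> with \<open>b\<close> the form \<open>a\<close> of degree zero.\<close>

lemma rels_dpoly_ideal: "p \<in> ideal G \<Longrightarrow> dpoly p \<in> rels G"
proof -
  assume "p \<in> ideal G"
  then obtain a where "p = (\<Sum>g\<in>G. g * a g)" by (auto simp: ideal_def)
  then show ?thesis
    by (intro relsI[of _ "\<lambda>g. dpoly (a g)" "\<lambda>g. pmult (a g) one_form"])
       (simp add: dpoly_sum dpoly_simps wedge_one_right)
qed

lemma rels_dterm_ideal: "p - q \<in> ideal G \<Longrightarrow> dterm S p - dterm S q \<in> rels G"
  using rels_ideal[of "p - q" G "dterm S 1"] by (simp add: dterm_diff)

section \<open>Filtering monomials\<close>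

definition restr :: "((nat \<Rightarrow>\<^sub>0 nat) \<Rightarrow> bool) \<Rightarrow> mpoly \<Rightarrow> mpoly" where
  "restr R p = Poly_Mapping.mapp (\<lambda>m c. if R m then c else 0) p"

lemma lookup_restr: "lk (restr R p) m = (if R m then lk p m else 0)"
  by (auto simp: restr_def lookup_mapp when_def in_keys_iff)

lemma restr_add [simp]: "restr R (p + q) = restr R p + restr R q"
  by (rule poly_mapping_eqI) (simp add: lookup_restr lookup_add)

lemma restr_0 [simp]: "restr R 0 = 0"
  by (rule poly_mapping_eqI) (simp add: lookup_restr)

lemma restr_diff [simp]: "restr R (p - q) = restr R p - restr R q"
  by (rule poly_mapping_eqI) (simp add: lookup_restr lookup_minus)

lemma restr_sum: "restr R (\<Sum>x\<in>A. h x) = (\<Sum>x\<in>A. restr R (h x))"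
  by (induction A rule: infinite_finite_induct) simp_all

lemma restr_Const_mult [simp]: "restr R (Const c * p) = Const c * restr R p"
  by (rule poly_mapping_eqI) (simp add: lookup_restr)

lemma restr_single: "restr R (sg m c) = (if R m then sg m c else 0)"
  by (rule poly_mapping_eqI) (auto simp: lookup_restr lookup_single when_def)

text \<open>Truncation by a grading is linear over elements whose monomials all shift the grading by
  the same amount; \<open>R'\<close> is the predicate \<open>R\<close> before the shift.\<close>

lemma restr_mult:
  assumes "\<And>m0 m. m0 \<in> ky g \<Longrightarrow> R (m0 + m) = R' m"
  shows "restr R (g * p) = g * restr R' p"
proof -
  have "restr R (sg m0 c * p) = sg m0 c * restr R' p" if "m0 \<in> ky g" for m0 c
    using assms[OF that]
    by (induction p rule: mpoly_induct) (auto simp: mult_single restr_single algebra_simps)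
  then have "restr R ((\<Sum>m\<in>ky g. sg m (lk g m)) * p) = (\<Sum>m\<in>ky g. sg m (lk g m)) * restr R' p"
    by (simp add: sum_distrib_right restr_sum)
  then show ?thesis by (simp add: mpoly_sum_monomials)
qed

lemma restr_pderiv:
  assumes "\<And>m. R m = R' (m + sg k 1)"
  shows "restr R (pderiv_mp k p) = pderiv_mp k (restr R' p)"
  by (rule poly_mapping_eqI) (simp add: lookup_restr lookup_pderiv assms)

text \<open>A component of a grading is described by a predicate on pairs of a monomial and a set
  \<open>S\<close>, that is, on the monomial forms. Degree, admissible variables and weight are all
  of this kind.\<close>

type_synonym term_pred = "(nat \<Rightarrow>\<^sub>0 nat) \<Rightarrow> nat set \<Rightarrow> bool"

definition filt :: "term_pred \<Rightarrow> dform \<Rightarrow> dform" where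
  "filt Q \<eta> = (\<lambda>S. restr (\<lambda>m. Q m S) (\<eta> S))"

definition supp_in :: "term_pred \<Rightarrow> dform \<Rightarrow> bool" where
  "supp_in Q \<eta> \<longleftrightarrow> (\<forall>S. \<forall>m\<in>ky (\<eta> S). Q m S)"

definition mult_invariant :: "term_pred \<Rightarrow> mpoly \<Rightarrow> bool" where
  "mult_invariant Q g \<longleftrightarrow> (\<forall>m0\<in>ky g. \<forall>m S. Q (m0 + m) S = Q m S)"

text \<open>The differential turns the pair \<open>(m + sg k 1, S)\<close> into
  \<open>(m, insert k S)\<close>, moving one factor \<open>x_k\<close> into \<open>dx_k\<close>.
  \<open>Q\<close> selects the target and \<open>Q'\<close> the source.\<close>

definition d_compatible :: "term_pred \<Rightarrow> term_pred \<Rightarrow> bool" where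
  "d_compatible Q Q' \<longleftrightarrow> (\<forall>m S k. finite S \<longrightarrow> k \<notin> S \<longrightarrow> Q m (insert k S) = Q' (m + sg k 1) S)"

lemma filt_simps:
  "filt Q (a + b) = filt Q a + filt Q b" "filt Q (a - b) = filt Q a - filt Q b" "filt Q 0 = 0"
  "filt Q (cmul c a) = cmul c (filt Q a)"
  by (auto simp: filt_def fun_eq_iff form_apply cmul_def)

lemma filt_sum: "filt Q (\<Sum>x\<in>A. h x) = (\<Sum>x\<in>A. filt Q (h x))"
  by (induction A rule: infinite_finite_induct) (simp_all add: filt_simps)

lemma filt_supp_in: "supp_in Q \<eta> \<Longrightarrow> filt Q \<eta> = \<eta>"
  by (auto simp: filt_def fun_eq_iff supp_in_def lookup_restr intro!: poly_mapping_eqI) (metis in_keys_iff)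

lemma filt_supp_in_disj: "supp_in Q \<eta> \<Longrightarrow> (\<And>m S. Q m S \<Longrightarrow> \<not> Q' m S) \<Longrightarrow> filt Q' \<eta> = 0"
  by (auto simp: filt_def fun_eq_iff form_apply supp_in_def lookup_restr intro!: poly_mapping_eqI) (metis in_keys_iff)

lemma supp_in_filt: "supp_in Q (filt Q \<eta>)"
  by (auto simp: supp_in_def filt_def in_keys_iff lookup_restr split: if_splits)

lemma supp_in_mono: "supp_in Q \<eta> \<Longrightarrow> (\<And>m S. Q m S \<Longrightarrow> Q' m S) \<Longrightarrow> supp_in Q' \<eta>"
  by (auto simp: supp_in_def)

lemma filt_pmult: "mult_invariant Q g \<Longrightarrow> filt Q (pmult g a) = pmult g (filt Q a)"
  by (auto simp: filt_def fun_eq_iff mult_invariant_def intro!: restr_mult)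

text \<open>A monomial \<open>m0\<close> of \<open>pderiv_mp k g\<close> comes from
  \<open>m0 + sg k 1\<close> in \<open>g\<close>, and the factor lost by differentiation is restored
  by \<open>dx_k\<close>. So multiplication by \<open>dg\<close> moves components exactly as the
  differential does.\<close>

lemma filt_dwedge:
  assumes "mult_invariant Q' g" "d_compatible Q Q'"
  shows "filt Q (wedge (dpoly g) b) = wedge (dpoly g) (filt Q' b)"
proof
  fix U show "filt Q (wedge (dpoly g) b) U = wedge (dpoly g) (filt Q' b) U"
  proof (cases "finite U")
    case True
    have "restr (\<lambda>m. Q m U) (pderiv_mp k g * b (U - {k})) = pderiv_mp k g * restr (\<lambda>m. Q' m (U - {k})) (b (U - {k}))"
      if "k \<in> U" for k
    proof (rule restr_mult)
      fix m0 m assume "m0 \<in> ky (pderiv_mp k g)"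
      then have "m0 + sg k 1 \<in> ky g" by (auto simp: in_keys_iff lookup_pderiv)
      moreover have "Q (m0 + m) U = Q' (m0 + m + sg k 1) (U - {k})"
        using assms(2) that True insert_Diff[OF that] unfolding d_compatible_def
        by (metis Diff_iff finite_Diff insertI1)
      moreover have "m0 + m + sg k 1 = (m0 + sg k 1) + m" by (simp add: ac_simps)
      ultimately show "Q (m0 + m) U = Q' m (U - {k})" using assms(1) by (auto simp: mult_invariant_def)
    qed
    then show ?thesis using True
      by (simp add: filt_def wedge_1form_left restr_sum mult.assoc)
  qed (simp add: filt_def)
qed

lemma filt_ext_d:
  assumes "d_compatible Q Q'" shows "filt Q (ext_d \<eta>) = ext_d (filt Q' \<eta>)"
proof
  fix U show "filt Q (ext_d \<eta>) U = ext_d (filt Q' \<eta>) U"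
  proof (cases "finite U")
    case True
    have "restr (\<lambda>m. Q m U) (pderiv_mp k (\<eta> (U - {k}))) = pderiv_mp k (restr (\<lambda>m. Q' m (U - {k})) (\<eta> (U - {k})))"
      if "k \<in> U" for k
    proof (rule restr_pderiv)
      show "Q m U = Q' (m + sg k 1) (U - {k})" for m
        using assms that True insert_Diff[OF that] unfolding d_compatible_def
        by (metis Diff_iff finite_Diff insertI1)
    qed
    then show ?thesis using True by (simp add: filt_def ext_d_def restr_sum)
  qed (simp add: filt_def)
qed

text \<open>The generators have degree zero for the grading, so projecting a relation projects its
  coefficients: \<open>a\<close> by the target predicate, \<open>b\<close> by the source
  predicate.\<close>

lemma filt_rels_sum:
  assumes "\<And>g. g \<in> G \<Longrightarrow> mult_invariant Q g \<and> mult_invariant Q' g" "d_compatible Q Q'"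
  shows "filt Q (\<Sum>g\<in>G. pmult g (a g) + wedge (dpoly g) (b g))
       = (\<Sum>g\<in>G. pmult g (filt Q (a g)) + wedge (dpoly g) (filt Q' (b g)))"
  unfolding filt_sum by (rule sum.cong) (use assms in \<open>simp_all add: filt_simps filt_pmult filt_dwedge[of Q']\<close>)

lemma filt_rels:
  assumes "\<And>g. g \<in> G \<Longrightarrow> mult_invariant Q g \<and> mult_invariant Q' g" "d_compatible Q Q'" "\<eta> \<in> rels G"
  shows "filt Q \<eta> \<in> rels G"
proof -
  obtain a b where "\<eta> = (\<Sum>g\<in>G. pmult g (a g) + wedge (dpoly g) (b g))"
    using assms(3) by (auto simp: rels_def)
  then show ?thesis
    using filt_rels_sum[OF assms(1,2), of G a b] by (auto intro!: relsI)
qed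

lemma filt_exacts:
  assumes "\<And>g. g \<in> G \<Longrightarrow> mult_invariant Q g \<and> mult_invariant Q' g" "d_compatible Q Q'" "\<eta> \<in> exacts G"
  shows "filt Q \<eta> \<in> exacts G"
proof -
  obtain \<theta> where "\<eta> - ext_d \<theta> \<in> rels G" using assms(3) by (auto simp: exacts_def)
  from filt_rels[OF assms(1,2) this] show ?thesis
    by (intro exactsI[of _ "filt Q' \<theta>"]) (simp add: filt_simps filt_ext_d[OF assms(2)])
qed

definition formQ :: "nat set \<Rightarrow> nat \<Rightarrow> term_pred" where
  "formQ V j m S \<longleftrightarrow> S \<subseteq> V \<and> card S = j \<and> ky m \<subseteq> V"

text \<open>Degree \<open>j - 1\<close>, written with \<open>Suc\<close> so that no pair qualifies
  at \<open>j = 0\<close>; filtering then gives the zero form that \<open>rel_forms\<close> and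
  \<open>exact_forms\<close> demand in that case.\<close>

definition formQ' :: "nat set \<Rightarrow> nat \<Rightarrow> term_pred" where
  "formQ' V j m S \<longleftrightarrow> finite S \<and> S \<subseteq> V \<and> Suc (card S) = j \<and> ky m \<subseteq> V"

lemma is_form_supp_in: "is_form V j \<eta> \<longleftrightarrow> supp_in (formQ V j) \<eta>"
  unfolding is_form_def supp_in_def formQ_def poly_in_def
  by (metis all_not_in_conv keys_eq_empty keys_zero)

lemma mult_invariant_formQ: "poly_in V g \<Longrightarrow> mult_invariant (formQ V j) g \<and> mult_invariant (formQ' V j) g"
  by (auto simp: mult_invariant_def formQ_def formQ'_def poly_in_def keys_add_nat)

lemma d_compatible_formQ: "d_compatible (formQ V j) (formQ' V j)"
  by (auto simp: d_compatible_def formQ_def formQ'_def keys_add_nat)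

lemma supp_in_formQ': "supp_in (formQ' V j) b \<Longrightarrow> if j = 0 then b = 0 else is_form V (j - 1) b"
  by (force simp: is_form_supp_in supp_in_def formQ_def formQ'_def fun_eq_iff form_apply)

lemma rel_forms_rels: "\<eta> \<in> rel_forms V G j \<Longrightarrow> \<eta> \<in> rels G"
  by (auto simp: rel_forms_def rels_def)

text \<open>Projection onto forms of degree \<open>j\<close> in \<open>V\<close> fixes \<eta> and
  replaces the unrestricted coefficients of its decomposition by admissible ones.\<close>

lemma rels_rel_forms:
  assumes "\<And>g. g \<in> G \<Longrightarrow> poly_in V g" "is_form V j \<eta>" "\<eta> \<in> rels G"
  shows "\<eta> \<in> rel_forms V G j"
proof -
  from assms(3) obtain a b where \<eta>: "\<eta> = (\<Sum>g\<in>G. pmult g (a g) + wedge (dpoly g) (b g))"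
    by (auto simp: rels_def)
  let ?a = "\<lambda>g. filt (formQ V j) (a g)" and ?b = "\<lambda>g. filt (formQ' V j) (b g)"
  have "\<eta> = filt (formQ V j) \<eta>" using assms(2) by (simp add: is_form_supp_in filt_supp_in)
  also have "\<dots> = (\<Sum>g\<in>G. pmult g (?a g) + wedge (dpoly g) (?b g))"
    unfolding \<eta> by (rule filt_rels_sum) (use assms(1) mult_invariant_formQ d_compatible_formQ in auto)
  finally have "\<eta> = (\<Sum>g\<in>G. pmult g (?a g) + wedge (dpoly g) (?b g))" .
  moreover have "is_form V j (?a g)" for g by (simp add: is_form_supp_in supp_in_filt)
  moreover have "if j = 0 then ?b g = 0 else is_form V (j - 1) (?b g)" for g
    by (rule supp_in_formQ') (rule supp_in_filt)
  ultimately show ?thesis unfolding rel_forms_def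
    by (intro CollectI exI[of _ ?a] exI[of _ ?b] conjI) blast+
qed

section \<open>Supports of sums, products and wedge products; comparison with the original closed
  and exact forms\<close>

definition psupp_in :: "((nat \<Rightarrow>\<^sub>0 nat) \<Rightarrow> bool) \<Rightarrow> mpoly \<Rightarrow> bool" where
  "psupp_in R p \<longleftrightarrow> (\<forall>m\<in>ky p. R m)"

lemma psupp_in_0 [simp]: "psupp_in R 0" by (simp add: psupp_in_def)
lemma psupp_in_add: "psupp_in R p \<Longrightarrow> psupp_in R q \<Longrightarrow> psupp_in R (p + q)"
  using keys_add[of p q] by (auto simp: psupp_in_def)
lemma psupp_in_uminus [simp]: "psupp_in R (- p) = psupp_in R p"
  by (auto simp: psupp_in_def)
lemma psupp_in_diff: "psupp_in R p \<Longrightarrow> psupp_in R q \<Longrightarrow> psupp_in R (p - q)"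
  using psupp_in_add[of R p "- q"] by simp
lemma psupp_in_sum: "(\<And>x. x \<in> A \<Longrightarrow> psupp_in R (h x)) \<Longrightarrow> psupp_in R (\<Sum>x\<in>A. h x)"
  by (induction A rule: infinite_finite_induct) (auto intro: psupp_in_add)
lemma psupp_in_mult:
  assumes "psupp_in R p" "psupp_in R' q" "\<And>m m'. R m \<Longrightarrow> R' m' \<Longrightarrow> R'' (m + m')"
  shows "psupp_in R'' (p * q)"
  unfolding psupp_in_def
proof
  fix m assume "m \<in> ky (p * q)"
  then obtain a b where "a \<in> ky p" "b \<in> ky q" "m = a + b" using keys_mult[of p q] by auto
  with assms show "R'' m" by (auto simp: psupp_in_def)
qed
lemma psupp_in_Const_mult: "psupp_in R p \<Longrightarrow> psupp_in R (Const c * p)"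
  by (auto simp: psupp_in_def in_keys_iff)

lemma supp_in_psupp_in: "supp_in Q \<eta> \<longleftrightarrow> (\<forall>S. psupp_in (\<lambda>m. Q m S) (\<eta> S))"
  by (auto simp: supp_in_def psupp_in_def)

lemma supp_in_0 [simp]: "supp_in Q 0"
  by (simp add: supp_in_def form_apply)

lemma supp_in_add: "supp_in Q a \<Longrightarrow> supp_in Q b \<Longrightarrow> supp_in Q (a + b)"
  by (auto simp: supp_in_psupp_in form_apply intro: psupp_in_add)

lemma supp_in_diff: "supp_in Q a \<Longrightarrow> supp_in Q b \<Longrightarrow> supp_in Q (a - b)"
  by (auto simp: supp_in_psupp_in form_apply intro: psupp_in_diff)

lemma supp_in_sum: "(\<And>x. x \<in> A \<Longrightarrow> supp_in Q (h x)) \<Longrightarrow> supp_in Q (\<Sum>x\<in>A. h x)"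
  by (auto simp: supp_in_psupp_in form_apply intro: psupp_in_sum)

lemma supp_in_cmul: "supp_in Q a \<Longrightarrow> supp_in Q (cmul c a)"
  by (auto simp: supp_in_psupp_in cmul_apply intro: psupp_in_Const_mult)

lemma supp_in_dterm: "supp_in Q (dterm S p) \<longleftrightarrow> psupp_in (\<lambda>m. Q m S) p"
  by (auto simp: supp_in_psupp_in dterm_def)

lemma supp_in_wedge:
  assumes "supp_in Q a" "supp_in Q' b"
    "\<And>m m' S T. Q m S \<Longrightarrow> Q' m' T \<Longrightarrow> finite S \<Longrightarrow> finite T \<Longrightarrow> S \<inter> T = {} \<Longrightarrow> Q'' (m + m') (S \<union> T)"
  shows "supp_in Q'' (wedge a b)"
  unfolding supp_in_psupp_in
proof
  fix U
  show "psupp_in (\<lambda>m. Q'' m U) (wedge a b U)"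
  proof (cases "finite U")
    case True
    have "psupp_in (\<lambda>m. Q'' m U) (a S * b (U - S))" if "S \<subseteq> U" for S
    proof (rule psupp_in_mult)
      show "psupp_in (\<lambda>m. Q m S) (a S)" "psupp_in (\<lambda>m. Q' m (U - S)) (b (U - S))" using assms by (auto simp: supp_in_psupp_in)
      show "Q'' (m + m') U" if "Q m S" "Q' m' (U - S)" for m m'
      proof -
        have "finite S" "finite (U - S)" "S \<union> (U - S) = U"
          using True \<open>S \<subseteq> U\<close> finite_subset by auto
        then show ?thesis using assms(3)[of m S m' "U - S"] that by (simp add: Diff_disjoint)
      qed
    qed
    then show ?thesis using True by (auto simp: wedge_def mult.assoc intro!: psupp_in_sum psupp_in_Const_mult)
  qed simp
qed

lemma supp_in_ext_d:
  assumes "d_compatible Q Q'" "supp_in Q' a" shows "supp_in Q (ext_d a)"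
  using filt_ext_d[OF assms(1), of a] supp_in_filt[of Q "ext_d a"] by (simp add: filt_supp_in assms(2))

lemma is_form_ext_d: "finite V \<Longrightarrow> is_form V j \<eta> \<Longrightarrow> is_form V (Suc j) (ext_d \<eta>)"
  unfolding is_form_supp_in
  by (rule supp_in_ext_d[OF d_compatible_formQ], erule supp_in_mono) (auto simp: formQ_def formQ'_def finite_subset)

lemma closed_forms_iff:
  assumes "finite V" "\<And>g. g \<in> G \<Longrightarrow> poly_in V g"
  shows "\<eta> \<in> closed_forms V G j \<longleftrightarrow> is_form V j \<eta> \<and> ext_d \<eta> \<in> rels G"
  using assms rels_rel_forms[of G V "Suc j" "ext_d \<eta>"] rel_forms_rels is_form_ext_d
  by (auto simp: closed_forms_def)

text \<open>A primitive may be replaced by its component of degree \<open>j - 1\<close> in the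
  variables \<open>V\<close>: the projection commutes with the differential, preserves relations and
  fixes \<eta>.\<close>

lemma exact_forms_iff:
  assumes "finite V" "\<And>g. g \<in> G \<Longrightarrow> poly_in V g"
  shows "\<eta> \<in> exact_forms V G j \<longleftrightarrow> is_form V j \<eta> \<and> \<eta> \<in> exacts G"
proof
  assume "\<eta> \<in> exact_forms V G j"
  then show "is_form V j \<eta> \<and> \<eta> \<in> exacts G"
    using rel_forms_rels by (fastforce simp: exact_forms_def exacts_def)
next
  assume \<eta>: "is_form V j \<eta> \<and> \<eta> \<in> exacts G"
  then obtain \<theta> where \<theta>: "\<eta> - ext_d \<theta> \<in> rels G" by (auto simp: exacts_def)
  let ?\<theta> = "filt (formQ' V j) \<theta>"
  have h: "supp_in (formQ V j) \<eta>" using \<eta> by (simp add: is_form_supp_in)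
  have "filt (formQ V j) (\<eta> - ext_d \<theta>) \<in> rels G"
    by (rule filt_rels[of _ _ "formQ' V j"]) (use assms(2) mult_invariant_formQ d_compatible_formQ \<theta> in auto)
  then have r: "\<eta> - ext_d ?\<theta> \<in> rels G"
    by (simp add: filt_simps filt_ext_d[OF d_compatible_formQ] filt_supp_in[OF h])
  have "is_form V j (\<eta> - ext_d ?\<theta>)"
    unfolding is_form_supp_in by (intro supp_in_diff h supp_in_ext_d[OF d_compatible_formQ] supp_in_filt)
  then have "\<eta> - ext_d ?\<theta> \<in> rel_forms V G j"
    using r assms(2) by (intro rels_rel_forms)
  then show "\<eta> \<in> exact_forms V G j"
    using \<eta> supp_in_formQ'[of V j ?\<theta>, OF supp_in_filt] unfolding exact_forms_def by blast
qed

section \<open>Wedge products over sets and pullback\<close>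

definition wset :: "(nat \<Rightarrow> dform) \<Rightarrow> nat set \<Rightarrow> dform" where
  "wset w S = wedge_list (map w (sorted_list_of_set S))"

lemma wset_empty [simp]: "wset w {} = one_form"
  by (simp add: wset_def wedge_list_def)

lemma wset_insert_min:
  assumes "finite S" "\<And>s. s \<in> S \<Longrightarrow> b < s"
  shows "wset w (insert b S) = wedge (w b) (wset w S)"
proof -
  have "b \<notin> S" using assms(2) by blast
  then have "sorted_list_of_set (insert b S) = b # sorted_list_of_set S"
    using assms by (auto simp: sorted_list_of_set_insert_remove less_imp_le intro!: insort_is_Cons)
  then show ?thesis by (simp add: wset_def wedge_list_def)
qed

text \<open>Moving \<open>w v\<close> to its sorted place costs one sign for each smaller index, and
  if it meets itself the product is zero. The induction splits off the least index \<open>b\<close>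
  and compares it with \<open>v\<close>.\<close>

lemma wset_wedge:
  assumes "\<And>v. is_1form (w v)" "finite S"
  shows "wedge (w v) (wset w S) = (if v \<in> S then 0 else cmul (sgn_sets {v} S) (wset w (insert v S)))"
  using assms(2)
proof (induction S rule: finite_linorder_min_induct)
  case empty
  then show ?case using wset_insert_min[of "{}" v w] by (simp add: cmul_simps)
next
  case (insert b A)
  consider "v < b" | "v = b" | "b < v" by linarith
  then show ?case
  proof cases
    case 1
    then have "\<And>s. s \<in> insert b A \<Longrightarrow> v < s" using insert.hyps by auto
    moreover from this have "sgn_sets {v} (insert b A) = 1" by (intro sgn_sets_less) auto
    ultimately show ?thesis using wset_insert_min[of "insert b A" v w] insert.hyps
      by (auto simp: cmul_simps)
  next
    case 2
    then show ?thesis using insert.hyps assms(1)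
      by (simp add: wset_insert_min wedge_1form_self wedge_simps flip: wedge_assoc)
  next
    case 3
    \<comment> \<open>Here \<open>b < v\<close>, and the sign of exchanging the two one-forms is the
      contribution of the inversion \<open>(v, b)\<close> to
      \<open>sgn_sets {v} (insert b A)\<close>.\<close>
    have "wedge (w v) (wset w (insert b A)) = - wedge (w b) (wedge (w v) (wset w A))"
      using insert.hyps assms(1)
      by (simp add: wset_insert_min wedge_1form_anticommute[of "w v" "w b"] wedge_simps flip: wedge_assoc)
    also have "\<dots> = (if v \<in> A then 0 else - cmul (sgn_sets {v} A) (wedge (w b) (wset w (insert v A))))"
      by (simp add: insert.IH wedge_simps)
    also have "v \<notin> A \<Longrightarrow> wedge (w b) (wset w (insert v A)) = wset w (insert b (insert v A))"
      using insert.hyps 3 by (subst wset_insert_min) auto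
    moreover have "b \<notin> A" using insert.hyps by auto
    then have "sgn_sets {v} (insert b A) = - sgn_sets {v} A"
      using insert.hyps 3 by (subst sgn_sets_insert_right) (auto simp: sgn_sets_singletons)
    ultimately show ?thesis using 3 by (simp add: insert_commute cmul_simps)
  qed
qed

lemma wset_dterm:
  assumes "finite S"
  shows "wset (\<lambda>k. dterm {k} (p k)) S = dterm S (\<Prod>k\<in>S. p k)"
  using assms
proof (induction S rule: finite_linorder_min_induct)
  case (insert b A)
  then have "b \<notin> A" "sgn_sets {b} A = 1" by (auto intro: sgn_sets_less)
  then show ?case using insert by (simp add: wset_insert_min wedge_dterm)
qed (simp add: one_form_dterm)

lemma ext_d_wset_dpoly:
  assumes "finite S"
  shows "ext_d (wset (\<lambda>v. dpoly (\<phi> v)) S) = 0"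
  using assms
proof (induction S rule: finite_linorder_min_induct)
  case empty then show ?case by (simp add: one_form_dterm)
next
  case (insert b A)
  then show ?case by (simp add: wset_insert_min ext_d_dwedge wedge_simps)
qed

lemma pullback_wset:
  "pullback W \<phi> \<eta> = (\<Sum>S\<in>Pow W. pmult (subst_mp \<phi> (\<eta> S)) (wset (\<lambda>v. dpoly (\<phi> v)) S))"
  by (simp add: pullback_def wset_def)

lemma pullback_simps:
  "pullback W \<phi> (a + b) = pullback W \<phi> a + pullback W \<phi> b"
  "pullback W \<phi> (a - b) = pullback W \<phi> a - pullback W \<phi> b"
  "pullback W \<phi> 0 = 0"
  "pullback W \<phi> (pmult p a) = pmult (subst_mp \<phi> p) (pullback W \<phi> a)"
  "pullback W \<phi> (cmul c a) = cmul c (pullback W \<phi> a)"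
  by (simp_all add: pullback_wset form_apply pmult_simps sum.distrib sum_subtractf pmult_sum cmul_def)

lemma pullback_sum: "pullback W \<phi> (\<Sum>x\<in>A. h x) = (\<Sum>x\<in>A. pullback W \<phi> (h x))"
  by (induction A rule: infinite_finite_induct) (simp_all add: pullback_simps)

lemma pullback_dterm:
  "finite W \<Longrightarrow> S \<subseteq> W \<Longrightarrow> pullback W \<phi> (dterm S p) = pmult (subst_mp \<phi> p) (wset (\<lambda>v. dpoly (\<phi> v)) S)"
proof -
  assume "finite W" "S \<subseteq> W"
  moreover have "pullback W \<phi> (dterm S p) = (\<Sum>R\<in>Pow W. if R = S then pmult (subst_mp \<phi> p) (wset (\<lambda>v. dpoly (\<phi> v)) S) else 0)"
    unfolding pullback_wset by (intro sum.cong) (auto simp: dterm_def pmult_simps)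
  ultimately show ?thesis by simp
qed

text \<open>The forms \<open>dg \<and> b\<close> and \<open>ext_d \<eta>\<close> have coefficients
  of the same shape, a signed sum over the index removed from \<open>U\<close>. Their pullbacks are
  therefore computed once, for an arbitrary family \<open>a\<close>.\<close>

lemma pullback_lift:
  assumes W: "finite W" and y: "\<And>U. U \<subseteq> W \<Longrightarrow> y U = (\<Sum>k\<in>U. Const (sgn_sets {k} (U - {k})) * a k (U - {k}))"
  shows "pullback W \<phi> y = (\<Sum>S\<in>Pow W. \<Sum>v\<in>W. pmult (subst_mp \<phi> (a v S)) (wedge (dpoly (\<phi> v)) (wset (\<lambda>v. dpoly (\<phi> v)) S)))"
proof -
  let ?w = "\<lambda>v. dpoly (\<phi> v)"
  have fin: "finite S" if "S \<subseteq> W" for S using that W finite_subset by blast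
  let ?t = "\<lambda>S v. cmul (sgn_sets {v} S) (pmult (subst_mp \<phi> (a v S)) (wset ?w (insert v S)))"
  have "pullback W \<phi> y = (\<Sum>U\<in>Pow W. \<Sum>k\<in>U. ?t (U - {k}) k)"
    unfolding pullback_wset
    by (intro sum.cong) (auto simp: y subst_sum pmult_sum_left cmul_def pmult_simps insert_absorb)
  also have "\<dots> = (\<Sum>(U,k)\<in>Sigma (Pow W) (\<lambda>U. U). ?t (U - {k}) k)"
    using W fin by (subst sum.Sigma) auto
  \<comment> \<open>Removing \<open>k\<close> from \<open>U\<close> and inserting \<open>k\<close>
    into \<open>S\<close> are inverse to each other on pairs.\<close>
  also have "\<dots> = (\<Sum>(S,k)\<in>Sigma (Pow W) (\<lambda>S. W - S). ?t S k)"
    by (rule sum.reindex_bij_witness[where i = "\<lambda>(S,k). (insert k S, k)" and j = "\<lambda>(U,k). (U - {k}, k)"]) auto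
  also have "\<dots> = (\<Sum>S\<in>Pow W. \<Sum>k\<in>W-S. ?t S k)"
    using W by (subst sum.Sigma) auto
  also have "\<dots> = (\<Sum>S\<in>Pow W. \<Sum>v\<in>W. pmult (subst_mp \<phi> (a v S)) (wedge (?w v) (wset ?w S)))"
  proof (rule sum.cong[OF refl])
    fix S assume "S \<in> Pow W"
    then have "finite S" using fin by auto
    have "(\<Sum>v\<in>W. pmult (subst_mp \<phi> (a v S)) (wedge (?w v) (wset ?w S)))
        = (\<Sum>v\<in>W. if v \<in> S then 0 else ?t S v)"
      by (intro sum.cong refl) (simp add: wset_wedge[of ?w, OF _ \<open>finite S\<close>] pmult_simps cmul_def mult.commute)
    also have "\<dots> = (\<Sum>v\<in>W-S. ?t S v)"
      using W by (intro sum.mono_neutral_cong_right) auto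
    finally show "(\<Sum>k\<in>W-S. ?t S k) = (\<Sum>v\<in>W. pmult (subst_mp \<phi> (a v S)) (wedge (?w v) (wset ?w S)))" ..
  qed
  finally show ?thesis .
qed

lemma dpoly_subst:
  assumes "finite W" "poly_in W p"
  shows "dpoly (subst_mp \<phi> p) = (\<Sum>v\<in>W. pmult (subst_mp \<phi> (pderiv_mp v p)) (dpoly (\<phi> v)))"
  by (auto simp: fun_eq_iff form_apply dpoly_def pderiv_subst[OF assms])

lemma pullback_dwedge:
  assumes "finite W" "poly_in W g"
  shows "pullback W \<phi> (wedge (dpoly g) b) = wedge (dpoly (subst_mp \<phi> g)) (pullback W \<phi> b)"
proof -
  let ?w = "\<lambda>v. dpoly (\<phi> v)"
  have "pullback W \<phi> (wedge (dpoly g) b)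
      = (\<Sum>S\<in>Pow W. \<Sum>v\<in>W. pmult (subst_mp \<phi> (pderiv_mp v g * b S)) (wedge (?w v) (wset ?w S)))"
  proof (rule pullback_lift[OF assms(1)])
    fix U assume "U \<subseteq> W"
    then have "finite U" using assms(1) finite_subset by blast
    then show "wedge (dpoly g) b U = (\<Sum>k\<in>U. Const (sgn_sets {k} (U - {k})) * (pderiv_mp k g * b (U - {k})))"
      by (simp add: wedge_1form_left mult.assoc)
  qed
  also have "\<dots> = wedge (dpoly (subst_mp \<phi> g)) (pullback W \<phi> b)"
    unfolding dpoly_subst[OF assms] pullback_wset
    by (simp add: wedge_sum_left wedge_sum_right pmult_sum pmult_simps mult.commute)
  finally show ?thesis .
qed

lemma pullback_ext_d:
  assumes "finite W" "\<And>S. S \<subseteq> W \<Longrightarrow> poly_in W (\<eta> S)"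
  shows "pullback W \<phi> (ext_d \<eta>) = ext_d (pullback W \<phi> \<eta>)"
proof -
  let ?w = "\<lambda>v. dpoly (\<phi> v)"
  have fin: "finite S" if "S \<subseteq> W" for S using that assms(1) finite_subset by blast
  have "pullback W \<phi> (ext_d \<eta>)
      = (\<Sum>S\<in>Pow W. \<Sum>v\<in>W. pmult (subst_mp \<phi> (pderiv_mp v (\<eta> S))) (wedge (?w v) (wset ?w S)))"
    by (rule pullback_lift) (use assms fin in \<open>auto simp: ext_d_def\<close>)
  also have "\<dots> = (\<Sum>S\<in>Pow W. wedge (dpoly (subst_mp \<phi> (\<eta> S))) (wset ?w S))"
    using assms by (intro sum.cong) (auto simp: dpoly_subst wedge_sum_left)
  also have "\<dots> = ext_d (pullback W \<phi> \<eta>)"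
    unfolding pullback_wset ext_d_sum
    by (intro sum.cong) (auto simp: ext_d_pmult ext_d_wset_dpoly fin pmult_simps)
  finally show ?thesis .
qed

lemma pullback_rels:
  assumes "finite W" "\<And>g. g \<in> G \<Longrightarrow> poly_in W g" "\<And>g. g \<in> G \<Longrightarrow> subst_mp \<phi> g \<in> ideal H" "\<eta> \<in> rels G"
  shows "pullback W \<phi> \<eta> \<in> rels H"
proof -
  from assms(4) obtain a b where \<eta>: "\<eta> = (\<Sum>g\<in>G. pmult g (a g) + wedge (dpoly g) (b g))"
    by (auto simp: rels_def)
  show ?thesis unfolding \<eta> pullback_sum
  proof (rule rels_sum)
    fix g assume "g \<in> G"
    then show "pullback W \<phi> (pmult g (a g) + wedge (dpoly g) (b g)) \<in> rels H"
      using assms(1-3) by (simp add: pullback_simps pullback_dwedge rels_add rels_ideal rels_wedge_right rels_dpoly_ideal)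
  qed
qed

declare pmult_apply [simp del]

section \<open>Integer powers of a unit modulo the relations\<close>

definition upow :: "mpoly \<Rightarrow> mpoly \<Rightarrow> int \<Rightarrow> mpoly" where
  "upow u w m = (if 0 \<le> m then u ^ nat m else w ^ nat (- m))"

lemma upow_0 [simp]: "upow u w 0 = 1" and upow_1 [simp]: "upow u w 1 = u" and upow_m1 [simp]: "upow u w (- 1) = w"
  by (simp_all add: upow_def)

lemma upow_mult_u:
  assumes "u * w - 1 \<in> ideal G" shows "u * upow u w m - upow u w (m + 1) \<in> ideal G"
proof (cases "0 \<le> m")
  case True
  then have "u * upow u w m - upow u w (m + 1) = 0" by (simp add: upow_def nat_add_distrib)
  then show ?thesis by simp
next
  case False
  define k where "k = nat (- m - 1)"
  have m: "m = - int k - 1" using False by (simp add: k_def)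
  \<comment> \<open>Only a negative exponent uses the relation: with \<open>m = - k - 1\<close> one
    factor of \<open>w ^ (k + 1)\<close> cancels against \<open>u\<close>.\<close>
  have "u * upow u w m - upow u w (m + 1) = w ^ k * (u * w - 1)"
    by (cases "k = 0") (simp_all add: m upow_def nat_add_distrib algebra_simps)
  then show ?thesis using assms by (simp add: ideal_mult)
qed

lemma upow_mult_w:
  assumes "u * w - 1 \<in> ideal G" shows "w * upow u w m - upow u w (m - 1) \<in> ideal G"
proof (cases "m \<le> 0")
  case True
  then have "nat (1 - m) = Suc (nat (- m))" by simp
  then have "w * upow u w m - upow u w (m - 1) = 0" using True by (cases "m = 0") (simp_all add: upow_def)
  then show ?thesis by simp
next
  case False
  define k where "k = nat (m - 1)"
  have m: "m = int k + 1" using False by (simp add: k_def)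
  have "w * upow u w m - upow u w (m - 1) = u ^ k * (u * w - 1)"
    by (simp add: m upow_def nat_add_distrib algebra_simps)
  then show ?thesis using assms by (simp add: ideal_mult)
qed

text \<open>Differentiate \<open>u w = 1\<close> and multiply by \<open>w\<close>: this gives
  \<open>w^2 du + u w dw\<close>, where \<open>u w\<close> may be replaced by
  \<open>1\<close>.\<close>

lemma dpoly_inverse:
  assumes "u * w - 1 \<in> ideal G" shows "dpoly w + pmult (w * w) (dpoly u) \<in> rels G"
proof -
  have "pmult w (dpoly (u * w - 1)) - pmult (u * w - 1) (dpoly w) \<in> rels G"
    using assms by (intro rels_diff rels_pmult rels_dpoly_ideal rels_ideal)
  moreover have "pmult w (dpoly (u * w - 1)) - pmult (u * w - 1) (dpoly w) = dpoly w + pmult (w * w) (dpoly u)"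
    by (simp add: dpoly_simps pmult_simps algebra_simps)
  ultimately show ?thesis by simp
qed

text \<open>For \<open>m = - k - 1\<close> the power is \<open>w ^ Suc k\<close>, and
  \<open>dw = - w^2 du\<close> turns its differential into one with coefficient
  \<open>- (k + 1) = m\<close> and exponent \<open>- (k + 2) = m - 1\<close>.\<close>

lemma dpoly_upow:
  assumes "u * w - 1 \<in> ideal G"
  shows "dpoly (upow u w m) - pmult (Const (of_int m) * upow u w (m - 1)) (dpoly u) \<in> rels G"
proof (cases "0 \<le> m")
  case True
  then obtain k where m: "m = int k" using nonneg_int_cases by blast
  have "of_nat k * u ^ (k - 1) = Const (of_int m) * upow u w (m - 1)"
    by (cases k) (simp_all add: m upow_def Const_add Const_of_nat)
  then have "dpoly (upow u w m) - pmult (Const (of_int m) * upow u w (m - 1)) (dpoly u) = 0"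
    using m by (simp add: upow_def dpoly_power)
  then show ?thesis by simp
next
  case False
  define k where "k = nat (- m - 1)"
  have m: "m = - int k - 1" using False by (simp add: k_def)
  have e: "nat (1 + int k) = Suc k" "nat (int k + 2) = Suc (Suc k)" by simp_all
  have "pmult (of_nat (Suc k) * w ^ k) (dpoly w + pmult (w * w) (dpoly u)) \<in> rels G"
    by (intro rels_pmult dpoly_inverse assms)
  moreover have "upow u w m = w ^ Suc k" "upow u w (m - 1) = w ^ (k + 2)" by (simp_all add: upow_def m e)
  moreover have "Const (of_int m) = - of_nat (Suc k)"
    by (simp add: m Const_diff Const_uminus Const_of_nat)
  moreover have "dpoly (w ^ Suc k) = pmult (of_nat (Suc k) * w ^ k) (dpoly w)"
    unfolding dpoly_power by simp
  moreover have "of_nat (Suc k) * w ^ k * (w * w) = of_nat (Suc k) * w ^ (k + 2)"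
    by (simp add: power_add power2_eq_square)
  ultimately show ?thesis
    by (simp only: pmult_simps) (simp add: pmult_simps del: of_nat_Suc power_Suc)
qed

section \<open>Linear spans modulo the ideal\<close>

text \<open>Complex linear combinations of \<open>X\<close>. The ideal sits in the base case so that
  congruent polynomials are interchangeable (\<open>lspan_cong\<close>).\<close>

inductive_set lspan :: "mpoly set \<Rightarrow> mpoly set \<Rightarrow> mpoly set" for G X where
  base: "p \<in> ideal G \<Longrightarrow> p \<in> lspan G X"
| step: "p \<in> lspan G X \<Longrightarrow> x \<in> X \<Longrightarrow> p + Const c * x \<in> lspan G X"

lemma lspan_mem: "x \<in> X \<Longrightarrow> x \<in> lspan G X"
  using lspan.step[of 0 G X x 1] by (simp add: lspan.base)

lemma lspan_0 [simp]: "0 \<in> lspan G X"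
  by (simp add: lspan.base)

lemma lspan_add: "p \<in> lspan G X \<Longrightarrow> q \<in> lspan G X \<Longrightarrow> p + q \<in> lspan G X"
proof (induction p rule: lspan.induct)
  case (base p)
  from base(2,1) show ?case
  proof (induction q rule: lspan.induct)
    case (base q) then show ?case by (intro lspan.base ideal_add)
  next
    case (step q x c) then show ?case by (metis add.assoc lspan.step)
  qed
next
  case (step p x c)
  then show ?case using lspan.step[of "p + q" G X x c] by (simp add: ac_simps)
qed

lemma lspan_mult:
  assumes "p \<in> lspan G X" "\<And>x. x \<in> X \<Longrightarrow> q * x \<in> lspan G Y" shows "q * p \<in> lspan G Y"
  using assms(1)
proof (induction p rule: lspan.induct)
  case (base p) then show ?case by (intro lspan.base ideal_mult)
next
  case (step p x c)
  have "Const c * r \<in> lspan G Y" if "r \<in> lspan G Y" for r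
    using that
  proof (induction r rule: lspan.induct)
    case (base r) then show ?case by (intro lspan.base ideal_mult)
  next
    case (step r x c')
    then show ?case using lspan.step[of "Const c * r" G Y x "c * c'"] by (simp add: algebra_simps Const_mult)
  qed
  from this[OF assms(2)[OF step(2)]] step show ?case by (simp add: algebra_simps lspan_add)
qed

lemma lspan_cmult: "p \<in> lspan G X \<Longrightarrow> Const c * p \<in> lspan G X"
  using lspan_mult[of p G X "Const c" X] lspan.step[of 0 G X _ c] by simp

lemma lspan_uminus: "p \<in> lspan G X \<Longrightarrow> - p \<in> lspan G X"
  using lspan_cmult[of p G X "-1"] by (simp add: Const_uminus)

lemma lspan_diff: "p \<in> lspan G X \<Longrightarrow> q \<in> lspan G X \<Longrightarrow> p - q \<in> lspan G X"
  using lspan_add[of p G X "- q"] lspan_uminus by simp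

lemma lspan_trans: "p \<in> lspan G X \<Longrightarrow> (\<And>x. x \<in> X \<Longrightarrow> x \<in> lspan G Y) \<Longrightarrow> p \<in> lspan G Y"
  using lspan_mult[of p G X 1 Y] by simp

lemma lspan_cong: "p - q \<in> ideal G \<Longrightarrow> q \<in> lspan G X \<Longrightarrow> p \<in> lspan G X"
  using lspan_add[of "p - q" G X q] lspan.base by simp

section \<open>A Koszul model of the de Rham complex\<close>

lemma dpoly_prod:
  "finite A \<Longrightarrow> dpoly (\<Prod>x\<in>A. h x) = (\<Sum>x\<in>A. pmult (\<Prod>y\<in>A - {x}. h y) (dpoly (h x)))"
proof (induction A rule: finite_induct)
  case (insert a A)
  have "(\<Sum>x\<in>A. pmult (\<Prod>y\<in>insert a A - {x}. h y) (dpoly (h x))) =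
     (\<Sum>x\<in>A. pmult (h a) (pmult (\<Prod>y\<in>A - {x}. h y) (dpoly (h x))))"
  proof (rule sum.cong[OF refl])
    fix x assume "x \<in> A"
    then have "insert a A - {x} = insert a (A - {x})" "a \<notin> A - {x}" using insert by auto
    then show "pmult (\<Prod>y\<in>insert a A - {x}. h y) (dpoly (h x)) = pmult (h a) (pmult (\<Prod>y\<in>A - {x}. h y) (dpoly (h x)))"
      using insert by (simp add: pmult_simps)
  qed
  moreover have "insert a A - {a} = A" using insert by auto
  ultimately show ?case using insert by (simp add: dpoly_simps pmult_sum)
qed (simp add: dpoly_simps)

text \<open>One variable contributes functions \<open>f l \<rho>\<close> and one-form coefficients \<open>g l \<rho>\<close>, chosen so that the
  differential sends \<open>f l (Some m)\<close> to \<open>g l (Some m)\<close> and kills \<open>f l None\<close>. Each index \<open>r\<close>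
  then spans a Koszul complex, acyclic as soon as some \<open>r l\<close> differs from \<open>None\<close>.\<close>

locale log_model =
  fixes G :: "mpoly set" and L I :: "nat set" and v :: "nat \<Rightarrow> nat"
    and f g :: "nat \<Rightarrow> int option \<Rightarrow> mpoly"
  assumes finL: "finite L" and IL: "I \<subseteq> L" and v: "strict_mono v"
    and df: "\<And>l m. l \<in> L \<Longrightarrow> dpoly (f l (Some m)) - dterm {v l} (g l (Some m)) \<in> rels G"
    and df0: "\<And>l. l \<in> L \<Longrightarrow> dpoly (f l None) = 0"
    and dg0: "\<And>l. l \<in> L \<Longrightarrow> ext_d (dterm {v l} (g l None)) \<in> rels G"
    and f0: "\<And>l. l \<in> I \<Longrightarrow> f l None = 0"
begin

definition F :: "nat \<Rightarrow> bool \<Rightarrow> int option \<Rightarrow> mpoly" where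
  "F l \<sigma> \<rho> = (if \<sigma> then g l \<rho> else f l \<rho>)"

definition basis :: "(nat \<Rightarrow> int option) \<Rightarrow> nat set \<Rightarrow> dform" where
  "basis r S = dterm (v ` S) (\<Prod>l\<in>L. F l (l \<in> S) (r l))"

definition B :: "(nat \<Rightarrow> int option) set \<Rightarrow> ((nat \<Rightarrow> int option) \<Rightarrow> nat set \<Rightarrow> complex) \<Rightarrow> dform" where
  "B X c = (\<Sum>r\<in>X. \<Sum>S\<in>Pow L. cmul (c r S) (basis r S))"

text \<open>In both instances, for \<open>l \<notin> I\<close> the function at \<open>Some 0\<close>
  is \<open>u^0 = 1\<close>, the same as at \<open>None\<close>, and its derivative is zero. The
  index \<open>Some 0\<close> is therefore removed there to leave a basis.\<close>

definition ok :: "nat \<Rightarrow> int option \<Rightarrow> bool" where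
  "ok l \<rho> \<longleftrightarrow> (l \<in> I \<or> \<rho> \<noteq> Some 0)"

definition R :: "(nat \<Rightarrow> int option) set" where
  "R = {r. (\<forall>l. l \<notin> L \<longrightarrow> r l = None) \<and> (\<forall>l\<in>L. ok l (r l))}"

text \<open>For \<open>l \<in> I\<close> there is no function with index \<open>None\<close>, only a
  one-form; a basis form that would use the function is zero.\<close>

definition allowed :: "(nat \<Rightarrow> int option) \<Rightarrow> nat set \<Rightarrow> bool" where
  "allowed r S \<longleftrightarrow> (\<forall>l\<in>I. r l = None \<longrightarrow> l \<in> S)"

abbreviation N :: "nat \<Rightarrow> int option" where "N \<equiv> \<lambda>_. None"

lemma R_None: "r \<in> R \<Longrightarrow> l \<notin> L \<Longrightarrow> r l = None"
  by (simp add: R_def)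

lemma N_R: "N \<in> R" by (simp add: R_def ok_def)

lemma dg: "l \<in> L \<Longrightarrow> ext_d (dterm {v l} (g l \<rho>)) \<in> rels G"
proof (cases \<rho>)
  case (Some m)
  assume l: "l \<in> L"
  from rels_uminus[OF rels_ext_d[OF df[OF l, of m]]] Some show ?thesis
    by (simp add: ext_d_simps ext_d_dpoly)
qed (simp add: dg0)

lemma prod_F: "S \<subseteq> L \<Longrightarrow> (\<Prod>l\<in>L. F l (l \<in> S) (r l)) = (\<Prod>l\<in>L - S. f l (r l)) * (\<Prod>l\<in>S. g l (r l))"
proof -
  assume S: "S \<subseteq> L"
  have "(\<Prod>l\<in>L. F l (l \<in> S) (r l)) = (\<Prod>l\<in>L - S. F l (l \<in> S) (r l)) * (\<Prod>l\<in>S. F l (l \<in> S) (r l))"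
    using prod.subset_diff[OF S finL] .
  then show ?thesis by (simp add: F_def)
qed

lemma dterm_insert_min:
  assumes "finite A" "\<And>a. a \<in> A \<Longrightarrow> b < a"
  shows "dterm (v ` insert b A) (p * q) = wedge (dterm {v b} p) (dterm (v ` A) q)"
proof -
  have "sgn_sets {v b} (v ` A) = 1" using assms v by (intro sgn_sets_less) (auto simp: strict_mono_less)
  moreover have "v b \<notin> v ` A" using assms(2)[of b] v by (auto simp: strict_mono_eq)
  ultimately show ?thesis using assms by (simp add: wedge_dterm)
qed

lemma g_closed: "finite S \<Longrightarrow> S \<subseteq> L \<Longrightarrow> ext_d (dterm (v ` S) (\<Prod>l\<in>S. g l (r l))) \<in> rels G"
proof (induction S rule: finite_linorder_min_induct)
  case (insert b A)
  have "b \<notin> A" using insert by auto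
  then have "ext_d (dterm (v ` insert b A) (\<Prod>l\<in>insert b A. g l (r l)))
     = ext_d (wedge (dterm {v b} (g b (r b))) (dterm (v ` A) (\<Prod>l\<in>A. g l (r l))))"
    using insert dterm_insert_min[of A b "g b (r b)"] by simp
  also have "\<dots> \<in> rels G"
    using insert by (simp add: ext_d_wedge rels_add rels_wedge_right rels_wedge_left dg)
  finally show ?case .
qed simp

text \<open>The product of the \<open>g\<close> is closed modulo the relations, so only the function
  factors are differentiated. Each turns from \<open>f\<close> into \<open>g\<close> and adds its
  index to \<open>S\<close>; those with index \<open>None\<close> have zero differential.\<close>

lemma d_basis:
  assumes S: "S \<subseteq> L"
  shows "ext_d (basis r S) - (\<Sum>l\<in>{l\<in>L - S. r l \<noteq> None}. cmul (sgn_sets {l} S) (basis r (insert l S))) \<in> rels G"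
proof -
  have fS: "finite S" using S finL finite_subset by blast
  define q where "q = dterm (v ` S) (\<Prod>l\<in>S. g l (r l))"
  define A where "A = L - S"
  have fA: "finite A" by (simp add: A_def finL)
  have basis: "basis r S = pmult (\<Prod>l\<in>A. f l (r l)) q" by (simp add: basis_def prod_F S q_def A_def)
  have 1: "ext_d (basis r S) - wedge (dpoly (\<Prod>l\<in>A. f l (r l))) q \<in> rels G"
    unfolding basis ext_d_pmult using rels_pmult[OF g_closed[OF fS S]] by (simp add: q_def)
  let ?s = "\<Sum>l\<in>{l\<in>A. r l \<noteq> None}. pmult (\<Prod>k\<in>A-{l}. f k (r k)) (dterm {v l} (g l (r l)))"
  have "dpoly (\<Prod>l\<in>A. f l (r l)) = (\<Sum>l\<in>{l\<in>A. r l \<noteq> None}. pmult (\<Prod>k\<in>A-{l}. f k (r k)) (dpoly (f l (r l))))"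
    unfolding dpoly_prod[OF fA] using fA df0
    by (intro sum.mono_neutral_right) (auto simp: A_def pmult_simps)
  then have "dpoly (\<Prod>l\<in>A. f l (r l)) - ?s
     = (\<Sum>l\<in>{l\<in>A. r l \<noteq> None}. pmult (\<Prod>k\<in>A-{l}. f k (r k)) (dpoly (f l (r l)) - dterm {v l} (g l (r l))))"
    by (simp add: sum_subtractf pmult_simps)
  also have "\<dots> \<in> rels G" using df by (intro rels_sum rels_pmult) (auto simp: A_def)
  finally have 2: "wedge (dpoly (\<Prod>l\<in>A. f l (r l))) q - wedge ?s q \<in> rels G"
    using rels_wedge_right by (simp flip: wedge_simps)
  have "wedge ?s q = (\<Sum>l\<in>{l\<in>A. r l \<noteq> None}. cmul (sgn_sets {l} S) (basis r (insert l S)))"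
    unfolding wedge_sum_left
  proof (rule sum.cong[OF refl])
    fix l assume "l \<in> {l\<in>A. r l \<noteq> None}"
    then have l: "l \<in> L" "l \<notin> S" by (auto simp: A_def)
    have "v l \<notin> v ` S" using l v by (auto simp: strict_mono_eq)
    moreover have "sgn_sets {v l} (v ` S) = sgn_sets {l} S" using sgn_sets_image[OF v, of "{l}" S] by simp
    moreover have "A - {l} = L - insert l S" by (auto simp: A_def)
    ultimately show "wedge (pmult (\<Prod>k\<in>A-{l}. f k (r k)) (dterm {v l} (g l (r l)))) q = cmul (sgn_sets {l} S) (basis r (insert l S))"
      using l S fS by (simp add: q_def wedge_dterm basis_def prod_F[of "insert l S"] ac_simps del: insert_iff)
  qed
  with rels_add[OF 1 2] show ?thesis by (simp add: A_def)
qed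

lemma basis_not_allowed: "\<not> allowed r S \<Longrightarrow> basis r S = 0"
proof -
  assume "\<not> allowed r S"
  then obtain l where "l \<in> I" "r l = None" "l \<notin> S" by (auto simp: allowed_def)
  then have "\<exists>l\<in>L. F l (l \<in> S) (r l) = 0" using IL f0 by (auto simp: F_def intro!: bexI[of _ l])
  then have "(\<Prod>l\<in>L. F l (l \<in> S) (r l)) = 0" using finL by (meson prod_zero)
  then show ?thesis by (simp add: basis_def)
qed

text \<open>For fixed \<open>r\<close> this is exterior multiplication by the sum of the generators
  \<open>e_l\<close> with \<open>r l \<noteq> None\<close>, written in coordinates. It vanishes at
  \<open>r = N\<close>.\<close>

definition koszul_d :: "((nat \<Rightarrow> int option) \<Rightarrow> nat set \<Rightarrow> complex) \<Rightarrow> (nat \<Rightarrow> int option) \<Rightarrow> nat set \<Rightarrow> complex" where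
  "koszul_d c r W = (\<Sum>l\<in>{l\<in>W. r l \<noteq> None}. sgn_sets {l} (W - {l}) * c r (W - {l}))"

lemma d_B: "ext_d (B X c) - B X (koszul_d c) \<in> rels G"
proof -
  have fin: "finite S" if "S \<subseteq> L" for S using that finL finite_subset by blast
  let ?D = "\<lambda>r S. \<Sum>l\<in>{l\<in>L - S. r l \<noteq> None}. cmul (sgn_sets {l} S) (basis r (insert l S))"
  have "ext_d (B X c) - (\<Sum>r\<in>X. \<Sum>S\<in>Pow L. cmul (c r S) (?D r S))
      = (\<Sum>r\<in>X. \<Sum>S\<in>Pow L. cmul (c r S) (ext_d (basis r S) - ?D r S))"
    by (simp add: B_def ext_d_sum ext_d_cmul cmul_simps sum_subtractf)
  also have "\<dots> \<in> rels G" by (intro rels_sum rels_cmul d_basis) auto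
  also have "(\<Sum>r\<in>X. \<Sum>S\<in>Pow L. cmul (c r S) (?D r S)) = B X (koszul_d c)"
    unfolding B_def
  proof (rule sum.cong[OF refl])
    fix r
    let ?t = "\<lambda>S l. cmul (c r S * sgn_sets {l} S) (basis r (insert l S))"
    have "(\<Sum>S\<in>Pow L. cmul (c r S) (?D r S)) = (\<Sum>S\<in>Pow L. \<Sum>l\<in>{l\<in>L - S. r l \<noteq> None}. ?t S l)"
      by (simp add: cmul_sum cmul_simps)
    also have "\<dots> = (\<Sum>(S,l)\<in>Sigma (Pow L) (\<lambda>S. {l\<in>L - S. r l \<noteq> None}). ?t S l)"
      using finL by (subst sum.Sigma) auto
    also have "\<dots> = (\<Sum>(W,l)\<in>Sigma (Pow L) (\<lambda>W. {l\<in>W. r l \<noteq> None}). ?t (W - {l}) l)"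
      by (rule sum.reindex_bij_witness[where j = "\<lambda>(S,k). (insert k S, k)" and i = "\<lambda>(U,k). (U - {k}, k)"]) auto
    also have "\<dots> = (\<Sum>W\<in>Pow L. \<Sum>l\<in>{l\<in>W. r l \<noteq> None}. ?t (W - {l}) l)"
      using finL fin by (subst sum.Sigma) auto
    also have "\<dots> = (\<Sum>W\<in>Pow L. cmul (koszul_d c r W) (basis r W))"
    proof (rule sum.cong[OF refl])
      fix W
      have cs: "cmul (\<Sum>x\<in>A. h x) a = (\<Sum>x\<in>A. cmul (h x) a)" for A :: "nat set" and h a
        by (induction A rule: infinite_finite_induct) (simp_all add: cmul_simps)
      show "(\<Sum>l\<in>{l\<in>W. r l \<noteq> None}. ?t (W - {l}) l) = cmul (koszul_d c r W) (basis r W)"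
        unfolding koszul_d_def cs by (intro sum.cong) (auto simp: insert_absorb mult.commute)
    qed
    finally show "(\<Sum>S\<in>Pow L. cmul (c r S) (?D r S)) = (\<Sum>W\<in>Pow L. cmul (koszul_d c r W) (basis r W))" .
  qed
  finally show ?thesis .
qed

lemma B_diff: "B X (\<lambda>r S. c r S - c' r S) = B X c - B X c'"
  by (simp add: B_def cmul_simps sum_subtractf)

lemma B_cong: "(\<And>r S. r \<in> X \<Longrightarrow> S \<subseteq> L \<Longrightarrow> allowed r S \<Longrightarrow> c r S = c' r S) \<Longrightarrow> B X c = B X c'"
proof -
  assume *: "\<And>r S. r \<in> X \<Longrightarrow> S \<subseteq> L \<Longrightarrow> allowed r S \<Longrightarrow> c r S = c' r S"
  have "cmul (c r S) (basis r S) = cmul (c' r S) (basis r S)" if "r \<in> X" "S \<subseteq> L" for r S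
    using *[OF that] basis_not_allowed[of r S] by (cases "allowed r S") (auto simp: cmul_simps)
  then show ?thesis unfolding B_def by (intro sum.cong) auto
qed

text \<open>Kept as a predicate, since it is established by different means for the variety and for
  the torus. Only allowed pairs are tested, as the other basis forms are zero.\<close>

definition indep :: bool where
  "indep \<longleftrightarrow> (\<forall>X c. finite X \<longrightarrow> X \<subseteq> R \<longrightarrow> B X c \<in> rels G \<longrightarrow>
     (\<forall>r\<in>X. \<forall>S. S \<subseteq> L \<longrightarrow> allowed r S \<longrightarrow> c r S = 0))"

lemma indepD: "indep \<Longrightarrow> finite X \<Longrightarrow> X \<subseteq> R \<Longrightarrow> B X c \<in> rels G \<Longrightarrow> r \<in> X \<Longrightarrow> S \<subseteq> L \<Longrightarrow> allowed r S \<Longrightarrow> c r S = 0"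
  unfolding indep_def by blast

text \<open>\<open>h\<close> is the contraction of \<open>c\<close> with \<open>e_l\<close>.
  Contraction is a contracting homotopy: its two compositions with \<open>koszul_d\<close> add up to
  the identity, and one of them vanishes because \<open>c\<close> is closed.\<close>

lemma koszul_homotopy:
  assumes W: "W \<subseteq> L" and l: "r l \<noteq> None" "l \<in> L" and closed: "\<And>W. W \<subseteq> L \<Longrightarrow> koszul_d c r W = 0"
    and h: "\<And>S. h r S = (if l \<in> S then 0 else sgn_sets {l} S * c r (insert l S))"
  shows "koszul_d h r W = c r W"
proof -
  have fW: "finite W" using W finL finite_subset by blast
  show ?thesis
  proof (cases "l \<in> W")
    case True
    \<comment> \<open>\<open>h\<close> vanishes on sets containing \<open>l\<close>, so only the
      removal of \<open>l\<close> itself contributes, and the two equal signs cancel.\<close>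
    have "koszul_d h r W = (\<Sum>k\<in>{k\<in>W. r k \<noteq> None}. if k = l then c r W else 0)"
      unfolding koszul_d_def
    proof (rule sum.cong[OF refl])
      fix k assume "k \<in> {k\<in>W. r k \<noteq> None}"
      then show "sgn_sets {k} (W - {k}) * h r (W - {k}) = (if k = l then c r W else 0)"
        using True by (auto simp: h insert_absorb simp flip: mult.assoc)
    qed
    then show ?thesis using True l fW by simp
  next
    case False
    \<comment> \<open>Closedness at the larger set isolates \<open>c r W\<close> as the term in
      which \<open>l\<close> is removed.\<close>
    have "0 = koszul_d c r (insert l W)" using closed W l by simp
    also have "\<dots> = sgn_sets {l} W * c r W +
       (\<Sum>k\<in>{k\<in>W. r k \<noteq> None}. sgn_sets {k} (insert l W - {k}) * c r (insert l W - {k}))"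
    proof -
      have "{k\<in>insert l W. r k \<noteq> None} = insert l {k\<in>W. r k \<noteq> None}" using l by auto
      moreover have "insert l W - {l} = W" using False by auto
      ultimately show ?thesis using False fW by (simp add: koszul_d_def)
    qed
    finally have "0 = sgn_sets {l} W * (sgn_sets {l} W * c r W +
       (\<Sum>k\<in>{k\<in>W. r k \<noteq> None}. sgn_sets {k} (insert l W - {k}) * c r (insert l W - {k})))" by simp
    also have "\<dots> = c r W - koszul_d h r W"
    proof -
      have "sgn_sets {l} W * (sgn_sets {k} (insert l W - {k}) * c r (insert l W - {k})) = - (sgn_sets {k} (W - {k}) * h r (W - {k}))"
        if "k \<in> {k\<in>W. r k \<noteq> None}" for k
      proof -
        have k: "k \<in> W" "k \<noteq> l" using that False by auto
        then have e: "insert l W - {k} = insert l (W - {k})" by auto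
        have s1: "sgn_sets {l} W = sgn_sets {l} {k} * sgn_sets {l} (W - {k})"
          using sgn_sets_insert_right[of "W - {k}" "{l}" k] fW k by (simp add: insert_absorb)
        have s2: "sgn_sets {k} (insert l (W - {k})) = sgn_sets {k} {l} * sgn_sets {k} (W - {k})"
          using sgn_sets_insert_right[of "W - {k}" "{k}" l] fW k False by simp
        \<comment> \<open>Exchanging \<open>k\<close> and \<open>l\<close> supplies the minus sign
          by which the remaining terms become \<open>koszul_d h\<close>.\<close>
        have s3: "sgn_sets {l} {k} * sgn_sets {k} {l} = -1" using k by (auto simp: sgn_sets_singletons)
        have "sgn_sets {l} W * sgn_sets {k} (insert l (W - {k})) = - (sgn_sets {k} (W - {k}) * sgn_sets {l} (W - {k}))"
        proof -
          have "sgn_sets {l} W * sgn_sets {k} (insert l (W - {k}))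
             = (sgn_sets {l} {k} * sgn_sets {k} {l}) * (sgn_sets {k} (W - {k}) * sgn_sets {l} (W - {k}))"
            by (simp only: s1 s2 ac_simps)
          then show ?thesis by (simp only: s3) simp
        qed
        then show ?thesis using False by (simp add: e h flip: mult.assoc)
      qed
      then show ?thesis by (simp add: distrib_left sum_distrib_left koszul_d_def sum_negf flip: mult.assoc)
    qed
    finally show ?thesis by simp
  qed
qed

text \<open>By independence, closedness modulo relations says that the coefficient family is Koszul
  closed. The homotopy then gives a primitive of the part at every \<open>r \<noteq> N\<close>, and
  what is left are the forms at \<open>N\<close>.\<close>

lemma closed_span:
  assumes ind: indep and X: "finite X" "X \<subseteq> R" and \<eta>: "\<eta> - B X c \<in> rels G" and closed: "ext_d \<eta> \<in> rels G"
  shows "\<exists>c0. \<eta> - (\<Sum>S\<in>{S. I \<subseteq> S \<and> S \<subseteq> L}. cmul (c0 S) (basis N S)) \<in> exacts G"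
proof -
  \<comment> \<open>Independence says nothing about coefficients at pairs that are not allowed.
    Setting them to zero keeps the form and makes the Koszul equation hold at all sets.\<close>
  define c' where "c' r S = (if allowed r S then c r S else 0)" for r S
  have Bc: "B X c = B X c'" by (rule B_cong) (simp add: c'_def)
  have "ext_d \<eta> - ext_d (\<eta> - B X c') - (ext_d (B X c') - B X (koszul_d c')) \<in> rels G"
    using rels_diff[OF rels_diff[OF closed rels_ext_d[OF \<eta>]] d_B[of X c']] by (simp only: Bc)
  then have "B X (koszul_d c') \<in> rels G" by (simp add: ext_d_simps)
  then have koszul_d_al: "koszul_d c' r W = 0" if "r \<in> X" "W \<subseteq> L" "allowed r W" for r W
    using indepD[OF ind X] that by blast
  have dc0: "koszul_d c' r W = 0" if "r \<in> X" "W \<subseteq> L" for r W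
  proof (cases "allowed r W")
    case False
    then have "\<not> allowed r (W - {k})" for k by (auto simp: allowed_def)
    then show ?thesis by (auto simp: koszul_d_def c'_def intro!: sum.neutral)
  qed (use koszul_d_al that in auto)
  \<comment> \<open>Any index with \<open>r l \<noteq> None\<close> can serve for the contraction,
    and the choice may depend on \<open>r\<close> because the differential never mixes different
    \<open>r\<close>.\<close>
  define h where "h r S = (if r = N then 0 else let l = (SOME l. r l \<noteq> None) in
      (if l \<in> S then 0 else sgn_sets {l} S * c' r (insert l S)))" for r S
  have dh: "koszul_d h r W = (if r = N then 0 else c' r W)" if r: "r \<in> X" and W: "W \<subseteq> L" for r W
  proof (cases "r = N")
    case False
    define l where "l = (SOME l. r l \<noteq> None)"
    have l: "r l \<noteq> None" unfolding l_def by (rule someI_ex) (use False in auto)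
    moreover have "r \<in> R" using r X by auto
    then have "l \<in> L" using l R_None[of r l] by metis
    moreover have "h r S = (if l \<in> S then 0 else sgn_sets {l} S * c' r (insert l S))" for S
      using False by (simp only: h_def Let_def l_def if_False)
    ultimately show ?thesis using koszul_homotopy[OF W, of r l c' h] dc0[OF r] False by simp
  qed (simp add: koszul_d_def)
  define c0 where "c0 S = (if N \<in> X then c' N S else 0)" for S
  let ?E = "\<Sum>S\<in>{S. I \<subseteq> S \<and> S \<subseteq> L}. cmul (c0 S) (basis N S)"
  have "B X c' - B X (koszul_d h) = B X (\<lambda>r S. if r = N then c' r S else 0)"
    unfolding B_diff[symmetric] using dh by (intro B_cong) auto
  also have "\<dots> = (\<Sum>r\<in>X. if r = N then \<Sum>S\<in>Pow L. cmul (c' N S) (basis N S) else 0)"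
    unfolding B_def by (intro sum.cong) (auto simp: cmul_simps)
  also have "\<dots> = (\<Sum>S\<in>Pow L. cmul (c0 S) (basis N S))"
    using X(1) by (simp add: c0_def cmul_simps)
  also have "\<dots> = ?E"
    using finL by (intro sum.mono_neutral_right) (auto simp: c0_def c'_def allowed_def cmul_simps)
  finally have e: "B X c' - B X (koszul_d h) = ?E" .
  have "(\<eta> - B X c') - (ext_d (B X h) - B X (koszul_d h)) \<in> rels G"
    using rels_diff[OF \<eta> d_B[of X h]] by (simp only: Bc)
  then have "(\<eta> - ?E) - ext_d (B X h) \<in> rels G" by (simp add: algebra_simps flip: e)
  then have "\<eta> - ?E \<in> exacts G" by (rule exactsI)
  then show ?thesis by blast
qed

text \<open>The differential of a spanned form has no component at \<open>N\<close>, where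
  \<open>koszul_d\<close> is zero, while the given combination lives only at \<open>N\<close>.
  Independence compares the two.\<close>

lemma E_indep:
  assumes ind: indep and X: "finite X" "X \<subseteq> R" and \<theta>: "\<theta> - B X c \<in> rels G"
    and A: "\<And>S. S \<in> A \<Longrightarrow> I \<subseteq> S \<and> S \<subseteq> L" and e: "(\<Sum>S\<in>A. cmul (c0 S) (basis N S)) - ext_d \<theta> \<in> rels G"
    and S: "S \<in> A"
  shows "c0 S = 0"
proof -
  have AP: "A \<subseteq> Pow L" using A by auto
  define c1 where "c1 r S = (if r = N \<and> S \<in> A then c0 S else 0)" for r S
  define c2 where "c2 r S = (if r \<in> X then koszul_d c r S else 0)" for r S
  \<comment> \<open>The index \<open>N\<close> is adjoined so that both coefficient families live on
    one finite set.\<close>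
  let ?X = "insert N X"
  have "B ?X c1 = (\<Sum>r\<in>?X. if r = N then \<Sum>S\<in>Pow L. cmul (c1 N S) (basis N S) else 0)"
    unfolding B_def by (intro sum.cong) (auto simp: c1_def cmul_simps)
  also have "\<dots> = (\<Sum>S\<in>Pow L. cmul (c1 N S) (basis N S))" using X by simp
  also have "\<dots> = (\<Sum>S\<in>A. cmul (c0 S) (basis N S))"
    using finL AP by (intro sum.mono_neutral_cong_right) (auto simp: c1_def cmul_simps)
  finally have 1: "B ?X c1 = (\<Sum>S\<in>A. cmul (c0 S) (basis N S))" .
  have "B ?X c2 = B X c2"
    unfolding B_def using X by (intro sum.mono_neutral_right) (auto simp: c2_def cmul_simps)
  also have "\<dots> = B X (koszul_d c)" by (rule B_cong) (simp add: c2_def)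
  finally have 2: "B ?X c2 = B X (koszul_d c)" .
  have "((\<Sum>S\<in>A. cmul (c0 S) (basis N S)) - ext_d \<theta>) + ext_d (\<theta> - B X c) + (ext_d (B X c) - B X (koszul_d c)) \<in> rels G"
    using e rels_ext_d[OF \<theta>] d_B by (intro rels_add)
  then have "B ?X (\<lambda>r S. c1 r S - c2 r S) \<in> rels G"
    by (simp add: B_diff 1 2 ext_d_simps)
  moreover have "finite ?X" "?X \<subseteq> R" "N \<in> ?X" "S \<subseteq> L" "allowed N S"
    using X N_R A[OF S] by (auto simp: allowed_def)
  ultimately have "c1 N S - c2 N S = 0"
    using indepD[OF ind, of ?X "\<lambda>r S. c1 r S - c2 r S" N S] by blast
  moreover have "koszul_d c N S = 0" by (simp add: koszul_d_def)
  ultimately show ?thesis using S by (simp add: c1_def c2_def split: if_splits)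
qed

lemma E_closed: "S \<subseteq> L \<Longrightarrow> ext_d (basis N S) \<in> rels G"
  using d_basis[of S N] by simp

subsection \<open>Spanning\<close>

definition spanned :: "dform set" where
  "spanned = {\<eta>. \<exists>X c. finite X \<and> X \<subseteq> R \<and> \<eta> - B X c \<in> rels G}"

lemma rels_spanned: "\<eta> \<in> rels G \<Longrightarrow> \<eta> \<in> spanned"
  by (auto simp: spanned_def B_def intro!: exI[of _ "{}"])

lemma spanned_add: "a \<in> spanned \<Longrightarrow> b \<in> spanned \<Longrightarrow> a + b \<in> spanned"
proof -
  assume "a \<in> spanned" "b \<in> spanned"
  then obtain X c Y e where 1: "finite X" "X \<subseteq> R" "a - B X c \<in> rels G" "finite Y" "Y \<subseteq> R" "b - B Y e \<in> rels G"
    by (auto simp: spanned_def)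
  let ?c = "\<lambda>r S. (if r \<in> X then c r S else 0) + (if r \<in> Y then e r S else 0)"
  have ext: "(\<Sum>r\<in>X \<union> Y. \<Sum>S\<in>Pow L. cmul (if r \<in> X' then c r S else 0) (basis r S)) = B X' c" if "X' \<subseteq> X \<union> Y" for X' c
    unfolding B_def using 1 that finL
    by (intro sum.mono_neutral_cong_right) (auto simp: cmul_simps intro!: sum.neutral sum.cong)
  have "B (X \<union> Y) ?c = B X c + B Y e"
    unfolding B_def[of "X \<union> Y"] cmul_simps sum.distrib by (simp add: ext)
  then have "a + b - B (X \<union> Y) ?c \<in> rels G" using rels_add[OF 1(3,6)] by (simp add: algebra_simps)
  then show ?thesis using 1 unfolding spanned_def by (intro CollectI exI[of _ "X \<union> Y"] exI[of _ ?c]) auto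
qed

lemma basis_spanned: "r \<in> R \<Longrightarrow> S \<subseteq> L \<Longrightarrow> cmul a (basis r S) \<in> spanned"
proof -
  assume *: "r \<in> R" "S \<subseteq> L"
  have "B {r} (\<lambda>r T. if T = S then a else 0) = (\<Sum>T\<in>Pow L. if T = S then cmul a (basis r S) else 0)"
    unfolding B_def by (auto intro!: sum.cong simp: cmul_simps)
  then have "B {r} (\<lambda>r T. if T = S then a else 0) = cmul a (basis r S)" using * finL by simp
  then show ?thesis unfolding spanned_def using *
    by (intro CollectI exI[of _ "{r}"] exI[of _ "\<lambda>r T. if T = S then a else 0"]) simp
qed

lemma spanned_sum: "(\<And>x. x \<in> A \<Longrightarrow> h x \<in> spanned) \<Longrightarrow> (\<Sum>x\<in>A. h x) \<in> spanned"
  by (induction A rule: infinite_finite_induct) (auto intro: spanned_add rels_spanned)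

text \<open>An expansion exists only modulo relations, so an operator that is additive and respects
  relations may be tested on basis forms.\<close>

lemma spanned_lin:
  assumes add: "\<And>a b. T (a + b) = T a + T b"
    and rel: "\<And>a. a \<in> rels G \<Longrightarrow> T a \<in> rels G"
    and basis: "\<And>r S c. r \<in> R \<Longrightarrow> S \<subseteq> L \<Longrightarrow> T (cmul c (basis r S)) \<in> spanned"
    and z: "z \<in> spanned"
  shows "T z \<in> spanned"
proof -
  have T0: "T 0 = 0" using add[of 0 0] by simp
  have Tsum': "T (\<Sum>x\<in>A. h x) = (\<Sum>x\<in>A. T (h x))" for A :: "nat set set" and h
    by (induction A rule: infinite_finite_induct) (simp_all add: T0 add)
  have Tsum'': "T (\<Sum>x\<in>A. h x) = (\<Sum>x\<in>A. T (h x))" for A :: "(nat \<Rightarrow> int option) set" and h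
    by (induction A rule: infinite_finite_induct) (simp_all add: T0 add)
  obtain X c where *: "finite X" "X \<subseteq> R" "z - B X c \<in> rels G" using z by (auto simp: spanned_def)
  have "T z = T (z - B X c) + T (B X c)" by (simp flip: add)
  moreover have "T (B X c) \<in> spanned" unfolding B_def Tsum'' Tsum' using * by (intro spanned_sum basis) auto
  ultimately show ?thesis using * by (auto intro: spanned_add rels_spanned rel)
qed

lemma spanned_cmul: "z \<in> spanned \<Longrightarrow> cmul a z \<in> spanned"
  by (rule spanned_lin[of "cmul a"]) (auto simp: cmul_simps rels_cmul basis_spanned)

definition fspan :: "nat \<Rightarrow> bool \<Rightarrow> mpoly set" where
  "fspan l \<sigma> = lspan G {F l \<sigma> \<rho> |\<rho>. ok l \<rho>}"

text \<open>Multilinear expansion, one factor at a time: \<open>A\<close> holds the factors that are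
  still arbitrary. When it is empty, the indices of the factors assemble into one
  \<open>r\<close>.\<close>

lemma tensor_spanned:
  assumes S: "S \<subseteq> L" and p: "\<And>l. l \<in> L \<Longrightarrow> p l \<in> fspan l (l \<in> S)"
  shows "dterm (v ` S) (\<Prod>l\<in>L. p l) \<in> spanned"
proof -
  have "dterm (v ` S) (\<Prod>l\<in>L. p l) \<in> spanned"
    if "finite A" "A \<subseteq> L" "\<And>l. l \<in> A \<Longrightarrow> p l \<in> fspan l (l \<in> S)"
      "\<And>l. l \<in> L - A \<Longrightarrow> \<exists>\<rho>. ok l \<rho> \<and> p l = F l (l \<in> S) \<rho>" for A p
    using that
  proof (induction A arbitrary: p rule: finite_induct)
    case empty
    then obtain r where r: "\<And>l. l \<in> L \<Longrightarrow> ok l (r l) \<and> p l = F l (l \<in> S) (r l)" by (metis Diff_empty)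
    let ?r = "\<lambda>l. if l \<in> L then r l else None"
    have "?r \<in> R" using r by (simp add: R_def)
    moreover have "basis ?r S = dterm (v ` S) (\<Prod>l\<in>L. p l)"
      unfolding basis_def using r by (intro arg_cong[where f = "dterm (v ` S)"] prod.cong) auto
    ultimately show ?case using basis_spanned[of ?r S 1] S by (simp add: cmul_simps)
  next
    case (insert a A)
    have a: "a \<in> L" using insert by simp
    let ?P = "\<Prod>l\<in>L - {a}. p l"
    have "dterm (v ` S) (q * ?P) \<in> spanned" if "q \<in> fspan a (a \<in> S)" for q
      using that unfolding fspan_def
    proof (induction q rule: lspan.induct)
      case (base q)
      then have "q * ?P \<in> ideal G" by (rule ideal_mult2)
      then show ?case using rels_dterm_ideal[of "q * ?P" 0 G] by (simp add: rels_spanned)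
    next
      case (step q x c)
      have "dterm (v ` S) (\<Prod>l\<in>L. (p(a := x)) l) \<in> spanned"
      proof (rule insert.IH)
        show "A \<subseteq> L" using insert by simp
        show "(p(a := x)) l \<in> fspan l (l \<in> S)" if "l \<in> A" for l
          using insert that by auto
        show "\<exists>\<rho>. ok l \<rho> \<and> (p(a := x)) l = F l (l \<in> S) \<rho>" if "l \<in> L - A" for l
          using insert.prems(3)[of l] step(2) that by auto
      qed
      moreover have "(\<Prod>l\<in>L. (p(a := x)) l) = x * ?P"
        using a finL by (subst prod.remove[of L a]) (auto intro!: arg_cong2[where f = "(*)"] prod.cong)
      ultimately have "cmul c (dterm (v ` S) (x * ?P)) \<in> spanned" by (simp add: spanned_cmul del: cmul_dterm)
      from spanned_add[OF step(3) this] show ?case by (simp add: algebra_simps dterm_add)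
    qed
    from this[of "p a"] show ?case using a finL insert.prems(2) by (simp add: prod.remove[of L a])
  qed
  from this[OF finL order_refl p] show ?thesis by simp
qed

lemma F_fspan: "ok l \<rho> \<Longrightarrow> F l \<sigma> \<rho> \<in> fspan l \<sigma>"
  unfolding fspan_def by (rule lspan_mem) auto

lemma spanned_pmult:
  assumes l: "l \<in> L" and q: "\<And>\<sigma> x. x \<in> fspan l \<sigma> \<Longrightarrow> q * x \<in> fspan l \<sigma>" and z: "z \<in> spanned"
  shows "pmult q z \<in> spanned"
proof (rule spanned_lin[of "pmult q", OF _ _ _ z])
  fix r S c assume r: "r \<in> R" and S: "S \<subseteq> L"
  let ?p = "\<lambda>k. if k = l then q * F k (k \<in> S) (r k) else F k (k \<in> S) (r k)"
  have "dterm (v ` S) (\<Prod>k\<in>L. ?p k) \<in> spanned"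
    by (rule tensor_spanned[OF S]) (use r in \<open>auto simp: R_def intro!: F_fspan q\<close>)
  also have "(\<Prod>k\<in>L. ?p k) = q * (\<Prod>k\<in>L. F k (k \<in> S) (r k))"
    using l finL by (simp add: prod.remove[of L l] mult.assoc)
  finally have "cmul c (pmult q (basis r S)) \<in> spanned" by (intro spanned_cmul) (simp add: basis_def)
  then show "pmult q (cmul c (basis r S)) \<in> spanned" by (simp add: cmul_def pmult_simps mult.commute)
qed (auto simp: pmult_simps rels_pmult)

text \<open>If \<open>l \<in> S\<close> the product is zero. Otherwise the factor at
  \<open>l\<close> changes from a function to a one-form coefficient, so \<open>q\<close> has to map
  \<open>fspan l False\<close> into \<open>fspan l True\<close>.\<close>

lemma spanned_wedge:
  assumes l: "l \<in> L" and q: "\<And>x. x \<in> fspan l False \<Longrightarrow> q * x \<in> fspan l True" and z: "z \<in> spanned"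
  shows "wedge (dterm {v l} q) z \<in> spanned"
proof (rule spanned_lin[of "wedge (dterm {v l} q)", OF _ _ _ z])
  fix r S c assume r: "r \<in> R" and S: "S \<subseteq> L"
  have "wedge (dterm {v l} q) (basis r S) \<in> spanned"
  proof (cases "l \<in> S")
    case True
    then show ?thesis by (simp add: basis_def wedge_dterm_meet rels_spanned)
  next
    case False
    let ?p = "\<lambda>k. if k = l then q * F k False (r k) else F k (k \<in> S) (r k)"
    have "dterm (v ` insert l S) (\<Prod>k\<in>L. ?p k) \<in> spanned"
      by (rule tensor_spanned) (use r S l in \<open>auto simp: R_def intro!: F_fspan q\<close>)
    also have "(\<Prod>k\<in>L. ?p k) = q * (\<Prod>k\<in>L. F k (k \<in> S) (r k))"
      using l finL False by (simp add: prod.remove[of L l] mult.assoc)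
    finally have "cmul (sgn_sets {v l} (v ` S)) (dterm (v ` insert l S) (q * (\<Prod>k\<in>L. F k (k \<in> S) (r k)))) \<in> spanned"
      by (rule spanned_cmul)
    moreover have "v l \<notin> v ` S" using False v by (auto simp: strict_mono_eq)
    moreover have "finite S" using S finL finite_subset by blast
    ultimately show ?thesis by (simp add: basis_def wedge_dterm mult.assoc)
  qed
  then show "wedge (dterm {v l} q) (cmul c (basis r S)) \<in> spanned" by (simp add: spanned_cmul)
qed (auto simp: wedge_simps rels_wedge_left)

end

section \<open>One-variable building blocks\<close>

definition ufun :: "mpoly \<Rightarrow> mpoly \<Rightarrow> int option \<Rightarrow> mpoly" where
  "ufun u w \<rho> = (case \<rho> of None \<Rightarrow> 1 | Some m \<Rightarrow> upow u w m)"

text \<open>\<open>P\<close> stands for the derivative of \<open>u\<close>. The index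
  \<open>None\<close> gives the logarithmic derivative \<open>P / u\<close>, which is the derivative
  of no Laurent polynomial in \<open>u\<close>.\<close>

definition udiff :: "mpoly \<Rightarrow> mpoly \<Rightarrow> mpoly \<Rightarrow> int option \<Rightarrow> mpoly" where
  "udiff u w P \<rho> = (case \<rho> of None \<Rightarrow> P * w | Some m \<Rightarrow> Const (of_int m) * upow u w (m - 1) * P)"

definition tfun :: "mpoly \<Rightarrow> mpoly \<Rightarrow> nat \<Rightarrow> nat \<Rightarrow> int option \<Rightarrow> mpoly" where
  "tfun u w k e \<rho> = (case \<rho> of None \<Rightarrow> 0 | Some m \<Rightarrow> Var k ^ e * upow u w m)"

text \<open>The derivative of \<open>x^e u^m\<close> for \<open>u = x^N - 1\<close>: the factor
  \<open>x^e x^(N-1)\<close> from the chain rule is rewritten as \<open>x^(e-1) (u + 1)\<close>. The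
  index \<open>None\<close> is the representative of the cokernel.\<close>

definition tdiff :: "mpoly \<Rightarrow> mpoly \<Rightarrow> nat \<Rightarrow> nat \<Rightarrow> nat \<Rightarrow> int option \<Rightarrow> mpoly" where
  "tdiff u w k N e \<rho> = (case \<rho> of None \<Rightarrow> Var k ^ (e - 1) * w
     | Some m \<Rightarrow> Var k ^ (e - 1) * (Const (of_int (int e + m * int N)) * upow u w m
                                     + Const (of_int (m * int N)) * upow u w (m - 1)))"

text \<open>Modulo relations \<open>dw = - w^2 du\<close>, and both \<open>du\<close> and
  \<open>dq\<close> are multiples of \<open>dx_k\<close>; hence so is the differential of
  \<open>q w\<close>, and its product with \<open>dx_k\<close> vanishes.\<close>

lemma log_closed:
  assumes "u * w - 1 \<in> ideal G" "dpoly u = dterm {k} P" "dpoly q = dterm {k} q'"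
  shows "ext_d (dterm {k} (q * w)) \<in> rels G"
proof -
  have "wedge (pmult q (dpoly w + pmult (w * w) (dpoly u))) (dterm {k} 1) \<in> rels G"
    by (intro rels_wedge_right rels_pmult dpoly_inverse assms)
  moreover have "wedge (pmult q (dpoly w + pmult (w * w) (dpoly u))) (dterm {k} 1) = ext_d (dterm {k} (q * w))"
    by (simp add: ext_d_dterm dpoly_simps assms pmult_simps wedge_simps wedge_dterm_meet)
  ultimately show ?thesis by simp
qed

lemma dpoly_Var_power: "dpoly (Var k ^ e) = dterm {k} (of_nat e * Var k ^ (e - 1))"
  by (simp add: dpoly_power dpoly_Var)

lemma ufun_d:
  assumes "u * w - 1 \<in> ideal G" "dpoly u = dterm {k} P"
  shows "dpoly (ufun u w (Some m)) - dterm {k} (udiff u w P (Some m)) \<in> rels G"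
  using dpoly_upow[OF assms(1), of m] by (simp add: ufun_def udiff_def assms(2))

lemma tfun_d:
  assumes uw: "u * w - 1 \<in> ideal G" and u: "u = Var k ^ N - 1" and e: "0 < e" "0 < N"
  shows "dpoly (tfun u w k e (Some m)) - dterm {k} (tdiff u w k N e (Some m)) \<in> rels G"
proof -
  let ?U = "upow u w"
  define P where "P = of_nat N * Var k ^ (N - 1)"
  have du: "dpoly u = dterm {k} P" by (simp add: u dpoly_simps dpoly_Var_power P_def)
  have 0: "pmult (Var k ^ e) (dpoly (?U m) - pmult (Const (of_int m) * ?U (m - 1)) (dpoly u)) \<in> rels G"
    by (intro rels_pmult dpoly_upow uw)
  \<comment> \<open>One factor \<open>x\<close> is moved from \<open>x^e\<close> to
    \<open>x^(N-1)\<close>, which needs \<open>e > 0\<close>, and then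
    \<open>x^N = u + 1\<close>.\<close>
  have eP: "Var k ^ e * P = of_nat N * Var k ^ (e - 1) * (u + 1)"
  proof -
    have "Var k ^ e = Var k * Var k ^ (e - 1)" "Var k ^ N = Var k * Var k ^ (N - 1)"
      using e by (simp_all add: power_eq_if[of _ e] power_eq_if[of _ N])
    then show ?thesis by (simp add: u P_def)
  qed
  have "Var k ^ e * (Const (of_int m) * ?U (m - 1) * P) = Const (of_int m) * ?U (m - 1) * (Var k ^ e * P)"
    by (simp add: ac_simps)
  also note eP
  finally have "Var k ^ e * (Const (of_int m) * ?U (m - 1) * P) = Const (of_int m) * of_nat N * Var k ^ (e - 1) * (u * ?U (m - 1) + ?U (m - 1))"
    by (simp add: algebra_simps)
  then have 1: "pmult (Var k ^ e) (dpoly (?U m)) - dterm {k} (Const (of_int m) * of_nat N * Var k ^ (e - 1) * (u * ?U (m - 1) + ?U (m - 1))) \<in> rels G"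
    using 0 by (simp only: pmult_simps du pmult_dterm)
  \<comment> \<open>Raising the exponent by one is a congruence modulo the ideal only, so it is
    carried out inside \<open>dterm\<close>.\<close>
  have "u * ?U (m - 1) - ?U m \<in> ideal G" using upow_mult_u[OF uw, of "m - 1"] by simp
  then have "Const (of_int m) * of_nat N * Var k ^ (e - 1) * (u * ?U (m - 1) - ?U m) \<in> ideal G"
    by (rule ideal_mult)
  then have "dterm {k} (Const (of_int m) * of_nat N * Var k ^ (e - 1) * (u * ?U (m - 1) + ?U (m - 1)))
     - dterm {k} (Const (of_int m) * of_nat N * Var k ^ (e - 1) * (?U m + ?U (m - 1))) \<in> rels G"
    by (intro rels_dterm_ideal) (simp add: algebra_simps)
  from rels_add[OF 1 this]
  have 2: "pmult (Var k ^ e) (dpoly (?U m)) - dterm {k} (Const (of_int m) * of_nat N * Var k ^ (e - 1) * (?U m + ?U (m - 1))) \<in> rels G"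
    by simp
  have "tdiff u w k N e (Some m) = Const (of_int m) * of_nat N * Var k ^ (e - 1) * (?U m + ?U (m - 1)) + ?U m * (of_nat e * Var k ^ (e - 1))"
    by (simp add: tdiff_def Const_add Const_mult Const_of_nat algebra_simps)
  then show ?thesis using 2
    by (simp add: tfun_def dpoly_simps dpoly_Var_power dterm_add algebra_simps)
qed

definition uspan :: "mpoly \<Rightarrow> mpoly \<Rightarrow> mpoly \<Rightarrow> mpoly set" where
  "uspan u w X = {X * upow u w m | m. True}"

lemma uspan_mem: "X * upow u w m \<in> lspan G (uspan u w X)"
  by (rule lspan_mem) (auto simp: uspan_def)

lemma uspan_mem0: "X \<in> lspan G (uspan u w X)" using uspan_mem[of X u w 0] by simp

lemma uspan_u:
  assumes uw: "u * w - 1 \<in> ideal G" and x: "x \<in> lspan G (uspan u w X)"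
  shows "u * x \<in> lspan G (uspan u w X)" "w * x \<in> lspan G (uspan u w X)"
proof -
  show "u * x \<in> lspan G (uspan u w X)"
  proof (rule lspan_mult[OF x])
    fix y assume "y \<in> uspan u w X"
    then obtain m where y: "y = X * upow u w m" by (auto simp: uspan_def)
    show "u * y \<in> lspan G (uspan u w X)"
      by (rule lspan_cong[OF _ uspan_mem[of _ _ _ "m + 1"]])
         (use ideal_mult[OF upow_mult_u[OF uw, of m], of X] in \<open>simp add: y algebra_simps\<close>)
  qed
  show "w * x \<in> lspan G (uspan u w X)"
  proof (rule lspan_mult[OF x])
    fix y assume "y \<in> uspan u w X"
    then obtain m where y: "y = X * upow u w m" by (auto simp: uspan_def)
    show "w * y \<in> lspan G (uspan u w X)"
      by (rule lspan_cong[OF _ uspan_mem[of _ _ _ "m - 1"]])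
         (use ideal_mult[OF upow_mult_w[OF uw, of m], of X] in \<open>simp add: y algebra_simps\<close>)
  qed
qed

lemma lspan_eqI:
  assumes "\<And>x. x \<in> X \<Longrightarrow> x \<in> lspan G Y" "\<And>y. y \<in> Y \<Longrightarrow> y \<in> lspan G X"
  shows "lspan G X = lspan G Y"
  using assms lspan_trans by blast

lemma lspan_scale: "Const c * x \<in> lspan G X \<Longrightarrow> c \<noteq> 0 \<Longrightarrow> x \<in> lspan G X"
  using lspan_cmult[of "Const c * x" G X "1 / c"] by (simp add: mult.assoc[symmetric] Const_mult[symmetric])

lemma ufun_span: "lspan G {ufun u w \<rho> |\<rho>. \<rho> \<noteq> Some 0} = lspan G (uspan u w 1)"
proof (rule lspan_eqI)
  fix x assume "x \<in> {ufun u w \<rho> |\<rho>. \<rho> \<noteq> Some 0}"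
  then show "x \<in> lspan G (uspan u w 1)"
    using uspan_mem0[of 1 G u w] uspan_mem[of 1 u w _ G] by (auto simp: ufun_def split: option.splits)
next
  fix x assume "x \<in> uspan u w 1"
  then obtain m where m: "x = upow u w m" by (auto simp: uspan_def)
  then have "x = ufun u w (if m = 0 then None else Some m)" by (simp add: ufun_def)
  then show "x \<in> lspan G {ufun u w \<rho> |\<rho>. \<rho> \<noteq> Some 0}" by (intro lspan_mem) (auto split: if_splits)
qed

text \<open>\<open>P u^m\<close> is the derivative of \<open>u^(m+1)\<close> divided by
  \<open>m + 1\<close>, except at \<open>m = -1\<close>, where the logarithmic coefficient takes its
  place.\<close>

lemma udiff_span: "lspan G {udiff u w P \<rho> |\<rho>. \<rho> \<noteq> Some 0} = lspan G (uspan u w P)"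
proof (rule lspan_eqI)
  fix x assume "x \<in> {udiff u w P \<rho> |\<rho>. \<rho> \<noteq> Some 0}"
  then obtain \<rho> where x: "x = udiff u w P \<rho>" by auto
  show "x \<in> lspan G (uspan u w P)"
  proof (cases \<rho>)
    case None then show ?thesis using uspan_mem[of P u w "-1" G] by (simp add: x udiff_def)
  next
    case (Some m) then show ?thesis using lspan_cmult[OF uspan_mem[of P u w "m - 1" G], of "of_int m"]
      by (simp add: x udiff_def ac_simps)
  qed
next
  fix x assume "x \<in> uspan u w P"
  then obtain m where m: "x = P * upow u w m" by (auto simp: uspan_def)
  show "x \<in> lspan G {udiff u w P \<rho> |\<rho>. \<rho> \<noteq> Some 0}"
  proof (cases "m = - 1")
    case True
    then have "x = udiff u w P None" by (simp add: m udiff_def)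
    then show ?thesis by (intro lspan_mem) auto
  next
    case False
    have "udiff u w P (Some (m + 1)) \<in> lspan G {udiff u w P \<rho> |\<rho>. \<rho> \<noteq> Some 0}"
      using False by (intro lspan_mem) auto
    moreover have e: "udiff u w P (Some (m + 1)) = Const (of_int (m + 1)) * x" by (simp add: udiff_def m ac_simps)
    moreover have "m + 1 \<noteq> 0" using False by linarith
    then have "of_int (m + 1) \<noteq> (0::complex)" by (simp only: of_int_eq_0_iff not_False_eq_True)
    ultimately show ?thesis using lspan_scale[of "of_int (m + 1)" x G] unfolding e by blast
  qed
qed

lemma tfun_span: "lspan G {tfun u w k e \<rho> |\<rho>. True} = lspan G (uspan u w (Var k ^ e))"
proof (rule lspan_eqI)
  fix x assume "x \<in> {tfun u w k e \<rho> |\<rho>. True}"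
  then show "x \<in> lspan G (uspan u w (Var k ^ e))"
    using uspan_mem by (auto simp: tfun_def split: option.splits)
next
  fix x assume "x \<in> uspan u w (Var k ^ e)"
  then obtain m where m: "x = Var k ^ e * upow u w m" by (auto simp: uspan_def)
  then have "x = tfun u w k e (Some m)" by (simp add: tfun_def)
  then show "x \<in> lspan G {tfun u w k e \<rho> |\<rho>. True}" by (intro lspan_mem) auto
qed

text \<open>Otherwise \<open>N\<close> would divide \<open>e\<close>. This is what makes the
  differential injective on a nontrivial character.\<close>

lemma twist_nonzero:
  assumes "0 < e" "e < N" shows "int e + m * int N \<noteq> 0"
proof
  assume "int e + m * int N = 0"
  then have "int N dvd int e" by (metis add_eq_0_iff dvd_minus_iff dvd_triv_right)
  then show False using assms nat_dvd_not_less by auto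
qed

text \<open>Each derivative relates \<open>u^m\<close> and \<open>u^(m-1)\<close>. At
  \<open>m = 0\<close> the lower term drops out, which starts the ascent, and
  \<open>e + mN \<noteq> 0\<close> continues it. The descent starts from \<open>u^(-1)\<close>,
  supplied by \<open>None\<close>, and continues because \<open>mN \<noteq> 0\<close>.\<close>

lemma tdiff_span:
  assumes e: "0 < e" "e < N"
  shows "lspan G {tdiff u w k N e \<rho> |\<rho>. True} = lspan G (uspan u w (Var k ^ (e - 1)))"
proof (rule lspan_eqI)
  fix x assume "x \<in> {tdiff u w k N e \<rho> |\<rho>. True}"
  then obtain \<rho> where x: "x = tdiff u w k N e \<rho>" by auto
  let ?X = "Var k ^ (e - 1)"
  show "x \<in> lspan G (uspan u w ?X)"
  proof (cases \<rho>)
    case None then show ?thesis using uspan_mem[of ?X u w "-1" G] by (simp add: x tdiff_def)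
  next
    case (Some m)
    have "Const (of_int (int e + m * int N)) * (?X * upow u w m) + Const (of_int (m * int N)) * (?X * upow u w (m - 1)) \<in> lspan G (uspan u w ?X)"
      by (intro lspan_add lspan_cmult uspan_mem)
    then show ?thesis by (simp add: x Some tdiff_def algebra_simps)
  qed
next
  let ?X = "Var k ^ (e - 1)" and ?Y = "lspan G {tdiff u w k N e \<rho> |\<rho>. True}"
  have tdiff: "tdiff u w k N e \<rho> \<in> ?Y" for \<rho> by (intro lspan_mem) auto
  have rec: "Const (of_int (int e + m * int N)) * (?X * upow u w m) + Const (of_int (m * int N)) * (?X * upow u w (m - 1)) \<in> ?Y" for m
    using tdiff[of "Some m"] by (simp add: tdiff_def algebra_simps)
  have up: "?X * upow u w m \<in> ?Y" if "?X * upow u w (m - 1) \<in> ?Y \<or> m = 0" for m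
  proof -
    have "Const (of_int (m * int N)) * (?X * upow u w (m - 1)) \<in> ?Y"
      using that by (auto intro: lspan_cmult)
    from lspan_diff[OF rec[of m] this] have "Const (of_int (int e + m * int N)) * (?X * upow u w m) \<in> ?Y" by simp
    then show ?thesis using lspan_scale twist_nonzero[OF e, of m] by (metis of_int_eq_0_iff)
  qed
  have down: "?X * upow u w (m - 1) \<in> ?Y" if "?X * upow u w m \<in> ?Y" "m \<noteq> 0" for m
  proof -
    have "Const (of_int (int e + m * int N)) * (?X * upow u w m) \<in> ?Y"
      using that by (auto intro: lspan_cmult)
    from lspan_diff[OF rec[of m] this] have "Const (of_int (m * int N)) * (?X * upow u w (m - 1)) \<in> ?Y" by simp
    moreover have "of_int (m * int N) \<noteq> (0::complex)" using that e by simp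
    ultimately show ?thesis using lspan_scale by blast
  qed
  have pos: "?X * upow u w (int m) \<in> ?Y" for m
  proof (induction m)
    case 0 show ?case using up[of 0] by simp
  next
    case (Suc m) then show ?case using up[of "int (Suc m)"] by simp
  qed
  have neg: "?X * upow u w (- int m - 1) \<in> ?Y" for m
  proof (induction m)
    case 0 show ?case using tdiff[of None] by (simp add: tdiff_def)
  next
    case (Suc m) then show ?case using down[of "- int m - 1"] by (simp add: algebra_simps)
  qed
  fix x assume "x \<in> uspan u w ?X"
  then obtain m where m: "x = ?X * upow u w m" by (auto simp: uspan_def)
  show "x \<in> ?Y"
  proof (cases "0 \<le> m")
    case True then show ?thesis using pos[of "nat m"] by (simp add: m)
  next
    case False then show ?thesis using neg[of "nat (- m - 1)"] by (simp add: m)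
  qed
qed

section \<open>The model of the variety\<close>

lemma dform_eq_sum_dterm:
  assumes "finite W" "\<And>S. \<not> S \<subseteq> W \<Longrightarrow> \<eta> S = 0"
  shows "\<eta> = (\<Sum>S\<in>Pow W. dterm S (\<eta> S))"
proof
  fix U
  have "(\<Sum>S\<in>Pow W. dterm S (\<eta> S)) U = (\<Sum>S\<in>Pow W. if S = U then \<eta> U else 0)"
    unfolding form_apply by (intro sum.cong) (auto simp: dterm_def)
  then show "\<eta> U = (\<Sum>S\<in>Pow W. dterm S (\<eta> S)) U" using assms by auto
qed


locale usetup =
  fixes d :: nat and n :: "nat \<Rightarrow> nat" and \<alpha> :: complex and i :: "nat \<Rightarrow> nat" and k0 :: nat
  assumes d: "1 \<le> d" and n: "\<And>k. k \<le> d \<Longrightarrow> 1 \<le> n k" and \<alpha>: "\<alpha> \<noteq> 0"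
    and iQ: "i \<in> Qset d n" and k0: "k0 \<le> d" "i k0 = 0"
begin

definition L where "L = {..d} - {k0}"
abbreviation I where "I \<equiv> Iset d i"
abbreviation G where "G \<equiv> {Ueq d n \<alpha>}"
definition u where "u k = Var k ^ n k - 1"
abbreviation w where "w \<equiv> uinv d n \<alpha>"
definition P where "P k = of_nat (n k) * Var k ^ (n k - 1)"
definition f where "f l = (if l \<in> I then tfun (u l) (w l) l (i l) else ufun (u l) (w l))"
definition g where "g l = (if l \<in> I then tdiff (u l) (w l) l (n l) (i l) else udiff (u l) (w l) (P l))"
text \<open>The generator over Laurent polynomials in \<open>u l\<close>: functions and one-form
  coefficients of the prescribed weight in \<open>x_l\<close> are its multiples, see
  \<open>fspan_eq\<close>.\<close>

definition X where "X l \<sigma> = (if l \<in> I then (if \<sigma> then Var l ^ (i l - 1) else Var l ^ i l) else if \<sigma> then P l else 1)"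

lemma I_sub: "I \<subseteq> L" using k0 by (auto simp: Iset_def L_def)

lemma I_bounds: "l \<in> I \<Longrightarrow> 0 < i l \<and> i l < n l \<and> l \<le> d"
  using iQ by (auto simp: Iset_def Qset_def)

lemma not_I: "l \<le> d \<Longrightarrow> l \<notin> I \<Longrightarrow> i l = 0" by (auto simp: Iset_def)

text \<open>All factors \<open>1 - x_k^n_k\<close> multiply to
  \<open>Ueq d n \<alpha> + Const \<alpha>\<close>. The minus sign in \<open>uinv\<close> makes up
  for \<open>u l\<close> being the negative of such a factor.\<close>

lemma uw_eq: "l \<le> d \<Longrightarrow> u l * w l = 1 + Ueq d n \<alpha> * Const (1 / \<alpha>)"
proof -
  assume l: "l \<le> d"
  have "(\<Prod>k\<le>d. 1 - Var k ^ n k) = (1 - Var l ^ n l) * (\<Prod>k\<in>{..d} - {l}. 1 - Var k ^ n k)"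
    using l by (intro prod.remove) auto
  then have "u l * w l = (\<Prod>k\<le>d. 1 - Var k ^ n k) * Const (1 / \<alpha>)"
    unfolding u_def uinv_def by (simp only:) (simp add: algebra_simps)
  also have "\<dots> = 1 + Ueq d n \<alpha> * Const (1 / \<alpha>)"
  proof -
    have "Const \<alpha> * Const (1 / \<alpha>) = 1" using \<alpha> by (simp flip: Const_mult)
    then show ?thesis by (simp add: Ueq_def algebra_simps)
  qed
  finally show ?thesis .
qed

lemma G_ideal: "Ueq d n \<alpha> \<in> ideal G" by (rule ideal_gen) auto

lemma uw: "l \<le> d \<Longrightarrow> u l * w l - 1 \<in> ideal G"
  by (simp add: uw_eq ideal_mult2 G_ideal)

lemma du: "dpoly (u k) = dterm {k} (P k)"
  by (simp add: u_def dpoly_simps dpoly_Var_power P_def)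

lemma dP: "dpoly (P k) = dterm {k} (of_nat (n k) * (of_nat (n k - 1) * Var k ^ (n k - 1 - 1)))"
  unfolding P_def Const_of_nat[symmetric]
  by (simp only: dpoly_simps dpoly_Var_power) (simp add: pmult_simps Const_of_nat del: of_nat_diff)

sublocale log_model G L I "\<lambda>l. l" f g
proof
  show "finite L" by (simp add: L_def)
  show "I \<subseteq> L" by (rule I_sub)
  show "strict_mono (\<lambda>l::nat. l)" by (simp add: strict_mono_def)
  fix l
  show "l \<in> I \<Longrightarrow> f l None = 0" by (simp add: f_def tfun_def)
  assume "l \<in> L"
  then have l: "l \<le> d" by (auto simp: L_def)
  show "dpoly (f l None) = 0" by (simp add: f_def tfun_def ufun_def dpoly_simps)
  show "ext_d (dterm {l} (g l None)) \<in> rels G"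
    using log_closed[OF uw[OF l] du dpoly_Var_power, of "i l - 1"] log_closed[OF uw[OF l] du dP]
    by (simp add: g_def tdiff_def udiff_def)
  show "dpoly (f l (Some m)) - dterm {l} (g l (Some m)) \<in> rels G" for m
    using ufun_d[OF uw[OF l] du, of m] tfun_d[OF uw[OF l] u_def, of "i l" m] I_bounds[of l]
    by (auto simp: f_def g_def)
qed

lemma fspan_eq: "l \<in> L \<Longrightarrow> fspan l \<sigma> = lspan G (uspan (u l) (w l) (X l \<sigma>))"
proof -
  assume "l \<in> L"
  have "{F l \<sigma> \<rho> |\<rho>. ok l \<rho>} = (if l \<in> I then if \<sigma> then {tdiff (u l) (w l) l (n l) (i l) \<rho> |\<rho>. True} else {tfun (u l) (w l) l (i l) \<rho> |\<rho>. True}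
       else if \<sigma> then {udiff (u l) (w l) (P l) \<rho> |\<rho>. \<rho> \<noteq> Some 0} else {ufun (u l) (w l) \<rho> |\<rho>. \<rho> \<noteq> Some 0})"
    by (auto simp: F_def f_def g_def ok_def)
  then show ?thesis using I_bounds[of l] tdiff_span[of "i l" "n l" G "u l" "w l" l]
    by (cases "l \<in> I"; cases \<sigma>) (simp_all only: fspan_def X_def tfun_span ufun_span udiff_span if_True if_False)
qed

lemma L_le: "l \<in> L \<Longrightarrow> l \<le> d" by (simp add: L_def)

lemma spanned_u: "l \<in> L \<Longrightarrow> z \<in> spanned \<Longrightarrow> pmult (u l) z \<in> spanned"
  by (rule spanned_pmult) (use uspan_u(1)[OF uw] L_le fspan_eq in auto)

lemma spanned_w: "l \<in> L \<Longrightarrow> z \<in> spanned \<Longrightarrow> pmult (w l) z \<in> spanned"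
  by (rule spanned_pmult) (use uspan_u(2)[OF uw] L_le fspan_eq in auto)

lemma spanned_cong: "p - q \<in> ideal G \<Longrightarrow> pmult q z \<in> spanned \<Longrightarrow> pmult p z \<in> spanned"
  using spanned_add[OF rels_spanned[OF rels_ideal[of "p - q" G z]], of "pmult q z"] by (simp add: pmult_simps)

lemma spanned_y: "l \<in> L \<Longrightarrow> z \<in> spanned \<Longrightarrow> pmult (Var l ^ n l) z \<in> spanned"
  using spanned_add[OF spanned_u, of l z z] by (simp add: u_def pmult_simps)

text \<open>The equation gives \<open>1 - x_k0^n_k0\<close> as \<alpha> divided by the other factors
  \<open>1 - x_l^n_l\<close>, and \<open>- w l\<close> is the inverse of such a factor. This
  eliminates \<open>x_k0^n_k0\<close>.\<close>

lemma k0_eq: "Var k0 ^ n k0 - (1 - Const \<alpha> * (\<Prod>l\<in>L. - w l)) \<in> ideal G"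
proof -
  have "(\<Prod>k\<le>d. 1 - Var k ^ n k) = (1 - Var k0 ^ n k0) * (\<Prod>k\<in>L. 1 - Var k ^ n k)"
    unfolding L_def using k0 by (intro prod.remove) auto
  then have e: "(1 - Var k0 ^ n k0) * (\<Prod>k\<in>L. 1 - Var k ^ n k) = Ueq d n \<alpha> + Const \<alpha>"
    by (simp add: Ueq_def)
  have "(\<Prod>l\<in>L. u l * w l) - (\<Prod>l\<in>L. 1) \<in> ideal G"
    by (rule ideal_sub_prod) (auto simp: L_def intro: uw)
  then have "(1 - Var k0 ^ n k0) * ((\<Prod>l\<in>L. u l * w l) - 1) \<in> ideal G" by (simp add: ideal_mult)
  moreover have "(\<Prod>l\<in>L. u l * w l) = (\<Prod>l\<in>L. 1 - Var l ^ n l) * (\<Prod>l\<in>L. - w l)"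
    unfolding prod.distrib[symmetric] by (intro prod.cong) (auto simp: u_def algebra_simps)
  ultimately have "(1 - Var k0 ^ n k0) * ((\<Prod>l\<in>L. 1 - Var l ^ n l) * (\<Prod>l\<in>L. - w l) - 1) \<in> ideal G"
    by (simp only:)
  then have "(Ueq d n \<alpha> + Const \<alpha>) * (\<Prod>l\<in>L. - w l) - (1 - Var k0 ^ n k0) \<in> ideal G"
    by (simp only: right_diff_distrib mult.assoc[symmetric] e mult_1_right)
  from ideal_diff[OF this ideal_mult2[OF G_ideal, of "\<Prod>l\<in>L. - w l"]]
  show ?thesis by (simp add: algebra_simps)
qed

lemma spanned_y0: "z \<in> spanned \<Longrightarrow> pmult (Var k0 ^ n k0) z \<in> spanned"
proof (rule spanned_cong[OF k0_eq])
  assume z: "z \<in> spanned"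
  have "pmult (\<Prod>l\<in>A. - w l) z \<in> spanned" if "finite A" "A \<subseteq> L" for A
    using that
  proof (induction A)
    case (insert a A)
    then have "cmul (- 1) (pmult (w a) (pmult (\<Prod>l\<in>A. - w l) z)) \<in> spanned" by (intro spanned_cmul spanned_w) auto
    then show ?case using insert by (simp add: pmult_simps cmul_simps)
  qed (use z in \<open>simp add: pmult_simps\<close>)
  from this[OF finL order_refl]
  have "z + cmul (- \<alpha>) (pmult (\<Prod>l\<in>L. - w l) z) \<in> spanned" using z by (intro spanned_add spanned_cmul)
  then show "pmult (1 - Const \<alpha> * (\<Prod>l\<in>L. - w l)) z \<in> spanned"
    by (simp add: pmult_simps cmul_def Const_uminus)
qed

lemma spanned_yk: "k \<le> d \<Longrightarrow> z \<in> spanned \<Longrightarrow> pmult (Var k ^ n k) z \<in> spanned"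
  using spanned_y[of k] spanned_y0 by (cases "k = k0") (auto simp: L_def)

text \<open>For \<open>l \<in> I\<close>, \<open>x^(n-1) x^i = x^(i-1) (u + 1)\<close>. For
  \<open>l \<notin> I\<close>, \<open>x^(n-1)\<close> is \<open>P l\<close> divided by
  \<open>n l\<close>. In both cases the product is a multiple of the one-form generator.\<close>

lemma spanned_dx: "l \<in> L \<Longrightarrow> z \<in> spanned \<Longrightarrow> wedge (dterm {l} (Var l ^ (n l - 1))) z \<in> spanned"
proof (rule spanned_wedge)
  fix x assume l: "l \<in> L" and "x \<in> fspan l False"
  then have x: "x \<in> lspan G (uspan (u l) (w l) (X l False))" by (simp add: fspan_eq)
  have ld: "l \<le> d" using l by (auto simp: L_def)
  show "Var l ^ (n l - 1) * x \<in> fspan l True"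
    unfolding fspan_eq[OF l]
  proof (rule lspan_mult[OF x])
    fix y assume "y \<in> uspan (u l) (w l) (X l False)"
    then obtain m where y: "y = X l False * upow (u l) (w l) m" by (auto simp: uspan_def)
    show "Var l ^ (n l - 1) * y \<in> lspan G (uspan (u l) (w l) (X l True))"
    proof (cases "l \<in> I")
      case True
      then have b: "0 < i l" "i l < n l" using I_bounds by auto
      have "Var l ^ i l = Var l * Var l ^ (i l - 1)" "Var l ^ n l = Var l * Var l ^ (n l - 1)"
        using b by (simp_all add: power_eq_if[of _ "i l"] power_eq_if[of _ "n l"])
      then have "Var l ^ (n l - 1) * y = u l * (X l True * upow (u l) (w l) m) + X l True * upow (u l) (w l) m"
        using True by (simp add: y X_def u_def algebra_simps)
      then show ?thesis using uspan_u(1)[OF uw[OF ld] uspan_mem] by (auto intro: lspan_add uspan_mem)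
    next
      case False
      have "Const (of_nat (n l)) * (Var l ^ (n l - 1) * y) = X l True * upow (u l) (w l) m"
        using False by (simp add: y X_def P_def Const_of_nat)
      then have "Const (of_nat (n l)) * (Var l ^ (n l - 1) * y) \<in> lspan G (uspan (u l) (w l) (X l True))"
        using uspan_mem by metis
      then show ?thesis using lspan_scale n[OF ld] by (metis of_nat_0_eq_iff not_one_le_zero)
    qed
  qed
qed auto

text \<open>The logarithmic derivative of the product, as an identity of polynomials:
  \<open>Const \<alpha> * w k\<close> is minus the product of the other factors, and this sign
  cancels the one in \<open>d (1 - x_k^n_k)\<close>.\<close>

lemma dpoly_Ueq: "dpoly (Ueq d n \<alpha>) = cmul \<alpha> (\<Sum>k\<le>d. dterm {k} (w k * P k))"
proof -
  have "dpoly (Ueq d n \<alpha>) = (\<Sum>k\<le>d. pmult (\<Prod>l\<in>{..d} - {k}. 1 - Var l ^ n l) (dpoly (1 - Var k ^ n k)))"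
    by (simp add: Ueq_def dpoly_simps dpoly_prod)
  also have "\<dots> = (\<Sum>k\<le>d. cmul \<alpha> (dterm {k} (w k * P k)))"
  proof (rule sum.cong[OF refl])
    fix k
    have "Const \<alpha> * Const (1 / \<alpha>) = 1" using \<alpha> by (simp flip: Const_mult)
    then have "Const \<alpha> * w k = - (\<Prod>l\<in>{..d} - {k}. 1 - Var l ^ n l)"
      by (simp add: uinv_def algebra_simps)
    moreover have "dpoly (1 - Var k ^ n k) = dterm {k} (- P k)"
      by (simp add: dpoly_simps dpoly_Var_power P_def dterm_uminus)
    ultimately show "pmult (\<Prod>l\<in>{..d} - {k}. 1 - Var l ^ n l) (dpoly (1 - Var k ^ n k)) = cmul \<alpha> (dterm {k} (w k * P k))"
      by (simp add: mult.assoc[symmetric])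
  qed
  finally show ?thesis by (simp add: cmul_sum)
qed

lemma sum_log_rels: "(\<Sum>k\<le>d. dterm {k} (w k * P k)) \<in> rels G"
proof -
  have "cmul (1 / \<alpha>) (dpoly (Ueq d n \<alpha>)) \<in> rels G"
    by (intro rels_cmul rels_dpoly_ideal G_ideal)
  then show ?thesis using \<alpha> by (simp add: dpoly_Ueq cmul_simps)
qed

text \<open>The logarithmic differentials of the \<open>u k\<close> add up to zero modulo relations.
  Multiplication by \<open>u k0\<close> turns the one at \<open>k0\<close> into
  \<open>du_k0\<close>, expressed through those at \<open>l \<in> L\<close>; division by
  \<open>n k0\<close> removes the constant.\<close>

lemma spanned_dx0: "z \<in> spanned \<Longrightarrow> wedge (dterm {k0} (Var k0 ^ (n k0 - 1))) z \<in> spanned"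
proof -
  assume z: "z \<in> spanned"
  let ?s = "\<Sum>l\<in>L. pmult (u k0 * w l) (dterm {l} (P l))"
  have "pmult (u k0) (\<Sum>k\<le>d. dterm {k} (w k * P k)) - pmult (u k0 * w k0 - 1) (dterm {k0} (P k0)) \<in> rels G"
    using uw k0 by (intro rels_diff rels_pmult sum_log_rels rels_ideal) auto
  moreover have e: "(\<Sum>k\<le>d. dterm {k} (w k * P k)) = dterm {k0} (w k0 * P k0) + (\<Sum>l\<in>L. dterm {l} (w l * P l))"
    unfolding L_def using k0 by (intro sum.remove) auto
  have "pmult (u k0) (\<Sum>k\<le>d. dterm {k} (w k * P k)) - pmult (u k0 * w k0 - 1) (dterm {k0} (P k0)) = dterm {k0} (P k0) + ?s"
    unfolding e by (simp add: pmult_simps pmult_sum dterm_diff mult.assoc left_diff_distrib)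
  ultimately have "dterm {k0} (P k0) + ?s \<in> rels G" by simp
  then have 1: "wedge (dterm {k0} (P k0) + ?s) z \<in> spanned" by (intro rels_spanned rels_wedge_right)
  have "wedge (dterm {l} (P l)) z \<in> spanned" if "l \<in> L" for l
    using spanned_cmul[OF spanned_dx[OF that z], of "of_nat (n l)"]
    by (simp add: P_def Const_of_nat flip: wedge_cmul)
  then have "pmult (u k0 * w l) (wedge (dterm {l} (P l)) z) \<in> spanned" if "l \<in> L" for l
  proof -
    have *: "pmult (w l) (wedge (dterm {l} (P l)) z) \<in> spanned" using that \<open>\<And>l. l \<in> L \<Longrightarrow> wedge (dterm {l} (P l)) z \<in> spanned\<close> by (intro spanned_w)
    from spanned_add[OF spanned_y0[OF *] spanned_cmul[OF *, of "-1"]] show ?thesis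
      by (simp add: u_def pmult_simps cmul_simps algebra_simps)
  qed
  then have "wedge ?s z \<in> spanned" unfolding wedge_sum_left wedge_pmult by (rule spanned_sum)
  from spanned_add[OF 1 spanned_cmul[OF this, of "-1"]] have "wedge (dterm {k0} (P k0)) z \<in> spanned"
    by (simp add: wedge_simps cmul_simps)
  from spanned_cmul[OF this, of "1 / of_nat (n k0)"]
  have "wedge (cmul (1 / of_nat (n k0)) (dterm {k0} (P k0))) z \<in> spanned" by (simp only: wedge_cmul)
  moreover have "cmul (1 / of_nat (n k0)) (dterm {k0} (P k0)) = dterm {k0} (Var k0 ^ (n k0 - 1))"
    using n[OF k0(1)] by (simp add: P_def mult.assoc[symmetric] flip: Const_of_nat Const_mult)
  ultimately show ?thesis by simp
qed

lemma spanned_dxk: "k \<le> d \<Longrightarrow> z \<in> spanned \<Longrightarrow> wedge (dterm {k} (Var k ^ (n k - 1))) z \<in> spanned"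
  using spanned_dx[of k] spanned_dx0 by (cases "k = k0") (auto simp: L_def)

text \<open>The least exponents for which the monomial together with
  \<open>dx_(A \<union> J)\<close> has weight \<open>i\<close>. For \<open>k \<in> A\<close>,
  outside \<open>I\<close>, the block \<open>x^(n-1) dx\<close> has weight zero.\<close>

definition base_exp where
  "base_exp A J k = (if k \<in> I then (if k \<in> J then i k - 1 else i k) else if k \<in> A then n k - 1 else 0)"

text \<open>The differentials outside \<open>I\<close> are attached one at a time as
  \<open>x_a^(n_a - 1) dx_a\<close>. Since \<open>A\<close> may contain \<open>k0\<close>, the
  elimination of \<open>dx_k0\<close> enters here.\<close>

lemma base_spanned:
  assumes "finite A" "A \<subseteq> {..d} - I" "J \<subseteq> I"
  shows "dterm (A \<union> J) (\<Prod>k\<le>d. Var k ^ base_exp A J k) \<in> spanned"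
  using assms(1,2)
proof (induction A rule: finite_induct)
  case empty
  have J: "J \<subseteq> L" using assms(3) I_sub by auto
  have "dterm ((\<lambda>l. l) ` J) (\<Prod>l\<in>L. X l (l \<in> J)) \<in> spanned"
    by (rule tensor_spanned[OF J]) (simp add: fspan_eq uspan_mem0)
  moreover have "(\<Prod>k\<le>d. Var k ^ base_exp {} J k) = Var k0 ^ base_exp {} J k0 * (\<Prod>k\<in>L. Var k ^ base_exp {} J k)"
    unfolding L_def using k0 by (intro prod.remove) auto
  moreover have "(\<Prod>k\<in>L. Var k ^ base_exp {} J k) = (\<Prod>l\<in>L. X l (l \<in> J))"
    using assms(3) by (intro prod.cong) (auto simp: base_exp_def X_def)
  moreover have "base_exp {} J k0 = 0" using k0 by (simp add: base_exp_def Iset_def)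
  ultimately show ?case by simp
next
  case (insert a A)
  have a: "a \<le> d" "a \<notin> I" "a \<notin> A \<union> J" using insert assms(3) by auto
  have fin: "finite (A \<union> J)" using insert assms(3) finL I_sub by (meson finite_UnI finite_subset)
  let ?s = "sgn_sets {a} (A \<union> J)"
  have "cmul ?s (wedge (dterm {a} (Var a ^ (n a - 1))) (dterm (A \<union> J) (\<Prod>k\<le>d. Var k ^ base_exp A J k))) \<in> spanned"
    using insert a by (intro spanned_cmul spanned_dxk) auto
  moreover have "Const ?s * Const ?s = 1" by (simp flip: Const_mult)
  moreover have "(\<Prod>k\<le>d. Var k ^ base_exp (insert a A) J k) = Var a ^ (n a - 1) * (\<Prod>k\<le>d. Var k ^ base_exp A J k)"
  proof -
    have "(\<Prod>k\<le>d. Var k ^ base_exp (insert a A) J k) = Var a ^ base_exp (insert a A) J a * (\<Prod>k\<in>{..d} - {a}. Var k ^ base_exp (insert a A) J k)"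
      using a by (intro prod.remove) auto
    moreover have "(\<Prod>k\<le>d. Var k ^ base_exp A J k) = Var a ^ base_exp A J a * (\<Prod>k\<in>{..d} - {a}. Var k ^ base_exp A J k)"
      using a by (intro prod.remove) auto
    moreover have "(\<Prod>k\<in>{..d} - {a}. Var k ^ base_exp (insert a A) J k) = (\<Prod>k\<in>{..d} - {a}. Var k ^ base_exp A J k)"
      by (intro prod.cong) (auto simp: base_exp_def)
    ultimately show ?thesis using a by (simp add: base_exp_def)
  qed
  ultimately show ?case using a fin by (simp add: wedge_dterm mult.assoc[symmetric])
qed

definition gradedP :: "(nat \<Rightarrow> nat) \<Rightarrow> term_pred" where
  "gradedP a m S \<longleftrightarrow> S \<subseteq> {..d} \<and> ky m \<subseteq> {..d} \<and> (\<forall>k\<le>d. (lk m k + of_bool (k \<in> S)) mod n k = a k mod n k)"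

text \<open>The weight determines the exponents modulo \<open>n k\<close>, so the monomial is the
  least one times powers of the \<open>x_k^n_k\<close>, under which spanned forms are
  stable.\<close>

lemma gradedP_spanned:
  assumes "gradedP i m S" shows "dterm S (sg m 1) \<in> spanned"
proof -
  define A where "A = S - I"
  define J where "J = S \<inter> I"
  have S: "S \<subseteq> {..d}" and m: "ky m \<subseteq> {..d}" and gr: "\<And>k. k \<le> d \<Longrightarrow> (lk m k + of_bool (k \<in> S)) mod n k = i k mod n k"
    using assms by (auto simp: gradedP_def)
  have AJ: "A \<union> J = S" "finite A" "A \<subseteq> {..d} - I" "J \<subseteq> I"
    using S finite_subset[OF S] by (auto simp: A_def J_def)
  have "\<exists>q. lk m k = n k * q + base_exp A J k" if k: "k \<le> d" for k
  proof -
    have ik: "i k mod n k = i k" using iQ k by (auto simp: Qset_def)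
    have nk: "n k \<ge> 1" using n k by auto
    define t where "t = (lk m k + of_bool (k \<in> S)) div n k"
    have t: "lk m k + of_bool (k \<in> S) = n k * t + i k"
      using gr[OF k] ik by (metis t_def div_mult_mod_eq mult.commute)
    show ?thesis
    proof (cases "k \<in> I")
      case True
      then have "0 < i k" using I_bounds by auto
      then show ?thesis using t True by (intro exI[of _ t]) (auto simp: base_exp_def J_def of_bool_def)
    next
      case False
      then have i0: "i k = 0" using k not_I by auto
      show ?thesis
      proof (cases "k \<in> S")
        case True
        \<comment> \<open>With \<open>i k = 0\<close> and \<open>k \<in> S\<close> the number
          \<open>lk m k + 1\<close> is a positive multiple of \<open>n k\<close>; giving up one
          block leaves the remainder \<open>n k - 1\<close> of \<open>base_exp\<close>.\<close>
        then have "t \<noteq> 0" using t i0 by (cases "t = 0") auto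
        then obtain t' where "t = Suc t'" by (cases t) auto
        then show ?thesis using t True False i0 nk by (intro exI[of _ t']) (auto simp: base_exp_def A_def)
      next
        case False2: False
        then show ?thesis using t i0 False by (intro exI[of _ t]) (auto simp: base_exp_def A_def)
      qed
    qed
  qed
  then obtain q where q: "\<And>k. k \<le> d \<Longrightarrow> lk m k = n k * q k + base_exp A J k" by metis
  have pw: "pmult ((Var k ^ n k) ^ e) z \<in> spanned" if "k \<le> d" "z \<in> spanned" for k e z
    using that
  proof (induction e)
    case (Suc e) then show ?case using spanned_yk[of k "pmult ((Var k ^ n k) ^ e) z"] by (simp add: pmult_simps)
  qed (simp add: pmult_simps)
  have pr: "pmult (\<Prod>k\<in>B. (Var k ^ n k) ^ q k) z \<in> spanned" if "finite B" "B \<subseteq> {..d}" "z \<in> spanned" for B z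
    using that
  proof (induction B)
    case (insert a B)
    then show ?case using pw[of a "pmult (\<Prod>k\<in>B. (Var k ^ n k) ^ q k) z" "q a"] by (simp add: pmult_simps)
  qed (simp add: pmult_simps)
  have "sg m 1 = (\<Prod>k\<le>d. Var k ^ lk m k)" by (rule monomial_eq_prod_Var) (use m in auto)
  also have "\<dots> = (\<Prod>k\<le>d. (Var k ^ n k) ^ q k * Var k ^ base_exp A J k)"
    by (intro prod.cong) (auto simp: q power_add power_mult)
  finally have "sg m 1 = (\<Prod>k\<le>d. (Var k ^ n k) ^ q k) * (\<Prod>k\<le>d. Var k ^ base_exp A J k)"
    by (simp add: prod.distrib)
  then have "dterm S (sg m 1) = pmult (\<Prod>k\<le>d. (Var k ^ n k) ^ q k) (dterm (A \<union> J) (\<Prod>k\<le>d. Var k ^ base_exp A J k))"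
    by (simp add: AJ)
  also have "\<dots> \<in> spanned" by (intro pr base_spanned AJ) auto
  finally show ?thesis .
qed

lemma graded_spanned:
  assumes "supp_in (gradedP i) \<eta>" shows "\<eta> \<in> spanned"
proof -
  have "\<eta> S = 0" if "\<not> S \<subseteq> {..d}" for S
  proof -
    have "ky (\<eta> S) = {}" using assms that unfolding supp_in_def gradedP_def by blast
    then show ?thesis by simp
  qed
  then have "\<eta> = (\<Sum>S\<in>Pow {..d}. dterm S (\<eta> S))" by (intro dform_eq_sum_dterm) auto
  also have "\<dots> = (\<Sum>S\<in>Pow {..d}. \<Sum>m\<in>ky (\<eta> S). cmul (lk (\<eta> S) m) (dterm S (sg m 1)))"
    by (simp add: dterm_sum[symmetric] sg_eq_Const_mult[symmetric] mpoly_sum_monomials)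
  also have "\<dots> \<in> spanned" using assms by (intro spanned_sum spanned_cmul gradedP_spanned) (auto simp: supp_in_def)
  finally show ?thesis .
qed

end

section \<open>Linear independence of Laurent monomials\<close>

text \<open>Multiplication by \<open>u^K\<close>, where \<open>K\<close> bounds the exponents in
  modulus, yields a polynomial of degree at most \<open>2K\<close> with infinitely many
  roots.\<close>

lemma laurent_indep:
  fixes c :: "int \<Rightarrow> complex"
  assumes M: "finite M" and U: "infinite U" "0 \<notin> U"
    and z: "\<And>u. u \<in> U \<Longrightarrow> (\<Sum>m\<in>M. c m * u powi m) = 0" and m0: "m0 \<in> M"
  shows "c m0 = 0"
proof -
  obtain K :: nat where K: "\<And>m. m \<in> M \<Longrightarrow> \<bar>m\<bar> \<le> int K"
  proof -
    have "finite (abs ` M)" using M by simp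
    from bdd_above_finite[OF this] obtain b where "\<And>m. m \<in> M \<Longrightarrow> \<bar>m\<bar> \<le> b"
      unfolding bdd_above_def by blast
    then show thesis using that[of "nat b"] by fastforce
  qed
  define a where "a j = (if int j - int K \<in> M then c (int j - int K) else 0)" for j
  have "(\<Sum>j\<le>2*K. a j * u ^ j) = 0" if u: "u \<in> U" for u
  proof -
    have u0: "u \<noteq> 0" using u U by auto
    have "(\<Sum>j\<le>2*K. a j * u ^ j) = (\<Sum>m\<in>M. c m * u ^ nat (m + int K))"
    proof (rule sum.mono_neutral_cong_right[THEN trans])
      show "finite {..2*K}" "(\<lambda>m. nat (m + int K)) ` M \<subseteq> {..2*K}" using K by force+
      show "\<forall>j\<in>{..2*K} - (\<lambda>m. nat (m + int K)) ` M. a j * u ^ j = 0"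
        by (force simp: a_def image_iff)
      show "\<And>j. j \<in> (\<lambda>m. nat (m + int K)) ` M \<Longrightarrow> a j * u ^ j = a j * u ^ j" by simp
      have pos: "0 \<le> m + int K" if "m \<in> M" for m using K[OF that] by linarith
      then have "inj_on (\<lambda>m. nat (m + int K)) M" by (intro inj_onI) (metis add_right_cancel eq_nat_nat_iff)
      then show "(\<Sum>j\<in>(\<lambda>m. nat (m + int K)) ` M. a j * u ^ j) = (\<Sum>m\<in>M. c m * u ^ nat (m + int K))"
        using pos by (subst sum.reindex) (auto simp: a_def intro!: sum.cong)
    qed
    also have "\<dots> = (\<Sum>m\<in>M. c m * (u powi m * u ^ K))"
    proof (rule sum.cong[OF refl])
      fix m assume "m \<in> M"
      then have "0 \<le> m + int K" using K[of m] by linarith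
      then have "u ^ nat (m + int K) = u powi (m + int K)" by (simp add: power_int_def)
      also have "\<dots> = u powi m * u ^ K" using u0 by (simp add: power_int_add)
      finally show "c m * u ^ nat (m + int K) = c m * (u powi m * u ^ K)" by simp
    qed
    also have "\<dots> = (\<Sum>m\<in>M. c m * u powi m) * u ^ K" by (simp add: sum_distrib_right mult.assoc)
    finally show ?thesis using z[OF u] by simp
  qed
  then have "U \<subseteq> {u. (\<Sum>j\<le>2*K. a j * u ^ j) = 0}" by auto
  then have "infinite {u. (\<Sum>j\<le>2*K. a j * u ^ j) = 0}" using U(1) finite_subset by blast
  then have "\<forall>j\<le>2*K. a j = 0" using polyfun_finite_roots[of a "2*K"] by blast
  moreover have "nat (m0 + int K) \<le> 2*K" "int (nat (m0 + int K)) - int K = m0" using K[OF m0] by linarith+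
  ultimately show ?thesis using m0 by (metis a_def)
qed

definition indep_fam :: "('b \<Rightarrow> 'a \<Rightarrow> complex) \<Rightarrow> 'b set \<Rightarrow> 'a set \<Rightarrow> bool" where
  "indep_fam \<phi> O' A \<longleftrightarrow> (\<forall>M c. finite M \<longrightarrow> M \<subseteq> O' \<longrightarrow> (\<forall>t\<in>A. (\<Sum>\<rho>\<in>M. c \<rho> * \<phi> \<rho> t) = 0) \<longrightarrow> (\<forall>\<rho>\<in>M. c \<rho> = 0))"

lemma indep_fam_scaled:
  assumes "infinite U" "0 \<notin> U" "\<And>\<rho>. \<rho> \<in> O' \<Longrightarrow> \<kappa> \<rho> \<noteq> 0" "inj_on \<mu> O'"
  shows "indep_fam (\<lambda>\<rho> u. \<kappa> \<rho> * u powi \<mu> \<rho>) O' U"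
  unfolding indep_fam_def
proof (intro allI impI ballI)
  fix M c \<rho> assume M: "finite M" "M \<subseteq> O'" and z: "\<forall>u\<in>U. (\<Sum>\<rho>\<in>M. c \<rho> * (\<kappa> \<rho> * u powi \<mu> \<rho>)) = 0" and \<rho>: "\<rho> \<in> M"
  have inj: "inj_on \<mu> M" using assms(4) M(2) inj_on_subset by blast
  define c' where "c' m = c (the_inv_into M \<mu> m) * \<kappa> (the_inv_into M \<mu> m)" for m
  have c': "c' (\<mu> \<rho>) = c \<rho> * \<kappa> \<rho>" if "\<rho> \<in> M" for \<rho> by (simp add: c'_def the_inv_into_f_f[OF inj that])
  have "(\<Sum>m\<in>\<mu> ` M. c' m * u powi m) = 0" if "u \<in> U" for u
    using z that by (simp add: sum.reindex[OF inj] c' mult.assoc)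
  then have "c' (\<mu> \<rho>) = 0" using laurent_indep[of "\<mu> ` M" U c'] M assms \<rho> by blast
  then show "c \<rho> = 0" using c'[OF \<rho>] assms(3) \<rho> M by auto
qed

text \<open>Transport along the substitution \<open>u = h t\<close>, with a common factor that has
  no zero; applied to \<open>h t = t^n - 1\<close> and monomial factors.\<close>

lemma indep_fam_comp:
  assumes "indep_fam \<psi> O' (h ` A)" "\<And>t. t \<in> A \<Longrightarrow> y t \<noteq> 0"
  shows "indep_fam (\<lambda>\<rho> t. y t * \<psi> \<rho> (h t)) O' A"
  unfolding indep_fam_def
proof (intro allI impI)
  fix M c assume M: "finite M" "M \<subseteq> O'" and z: "\<forall>t\<in>A. (\<Sum>\<rho>\<in>M. c \<rho> * (y t * \<psi> \<rho> (h t))) = 0"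
  have "(\<Sum>\<rho>\<in>M. c \<rho> * \<psi> \<rho> (h t)) = 0" if "t \<in> A" for t
  proof -
    have "y t * (\<Sum>\<rho>\<in>M. c \<rho> * \<psi> \<rho> (h t)) = 0" using z that by (simp add: sum_distrib_left ac_simps)
    then show ?thesis using assms(2)[OF that] by simp
  qed
  then have "\<forall>s\<in>h ` A. (\<Sum>\<rho>\<in>M. c \<rho> * \<psi> \<rho> s) = 0" by blast
  then show "\<forall>\<rho>\<in>M. c \<rho> = 0" using assms(1) M unfolding indep_fam_def by blast
qed

definition ufun_val :: "int option \<Rightarrow> complex \<Rightarrow> complex" where
  "ufun_val \<rho> u = (case \<rho> of None \<Rightarrow> 1 | Some m \<Rightarrow> u powi m)"

definition udiff_val :: "int option \<Rightarrow> complex \<Rightarrow> complex" where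
  "udiff_val \<rho> u = (case \<rho> of None \<Rightarrow> u powi (- 1) | Some m \<Rightarrow> of_int m * u powi (m - 1))"

definition tdiff_val :: "nat \<Rightarrow> nat \<Rightarrow> int option \<Rightarrow> complex \<Rightarrow> complex" where
  "tdiff_val N e \<rho> u = (case \<rho> of None \<Rightarrow> u powi (- 1) | Some m \<Rightarrow> of_int (int e + m * int N) * u powi m + of_int (m * int N) * u powi (m - 1))"

lemma indep_ufun_val:
  assumes "infinite U" "0 \<notin> U" shows "indep_fam ufun_val {\<rho>. \<rho> \<noteq> Some 0} U" "indep_fam ufun_val {\<rho>. \<rho> \<noteq> None} U"
proof -
  let ?\<mu> = "\<lambda>\<rho>. case \<rho> of None \<Rightarrow> 0 | Some m \<Rightarrow> m"
  have e: "ufun_val = (\<lambda>\<rho> u. 1 * u powi ?\<mu> \<rho>)" by (auto simp: ufun_val_def fun_eq_iff split: option.splits)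
  show "indep_fam ufun_val {\<rho>. \<rho> \<noteq> Some 0} U" unfolding e
    by (rule indep_fam_scaled) (use assms in \<open>auto simp: inj_on_def split: option.splits\<close>)
  show "indep_fam ufun_val {\<rho>. \<rho> \<noteq> None} U" unfolding e
    by (rule indep_fam_scaled) (use assms in \<open>auto simp: inj_on_def split: option.splits\<close>)
qed

lemma indep_udiff_val:
  assumes "infinite U" "0 \<notin> U" shows "indep_fam udiff_val {\<rho>. \<rho> \<noteq> Some 0} U"
proof -
  let ?\<mu> = "\<lambda>\<rho>. case \<rho> of None \<Rightarrow> - 1 | Some m \<Rightarrow> m - 1"
  let ?\<kappa> = "\<lambda>\<rho>. case \<rho> of None \<Rightarrow> 1 | Some m \<Rightarrow> of_int m"
  have e: "udiff_val = (\<lambda>\<rho> u. ?\<kappa> \<rho> * u powi ?\<mu> \<rho>)" by (auto simp: udiff_val_def fun_eq_iff split: option.splits)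
  show ?thesis unfolding e
    by (rule indep_fam_scaled) (use assms in \<open>auto simp: inj_on_def split: option.splits\<close>)
qed

text \<open>The coefficients of \<open>u^k\<close> give a two-term recursion for \<open>ct\<close>.
  From the upper end it runs down to \<open>0\<close>, as \<open>e + kN \<noteq> 0\<close>; from the
  lower end it runs up to \<open>-1\<close>, as \<open>(k+1)N \<noteq> 0\<close> there. In the
  equation at \<open>k = -1\<close> the value \<open>ct 0\<close> has coefficient zero, and the
  coefficient of \<open>None\<close> remains.\<close>

lemma indep_tdiff_val:
  assumes U: "infinite U" "0 \<notin> U" and e: "0 < e" "e < N" shows "indep_fam (tdiff_val N e) UNIV U"
  unfolding indep_fam_def
proof (intro allI impI)
  fix M c assume M: "finite M" and z: "\<forall>u\<in>U. (\<Sum>\<rho>\<in>M. c \<rho> * tdiff_val N e \<rho> u) = 0"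
  define cN where "cN = (if None \<in> M then c None else 0)"
  define ct where "ct m = (if Some m \<in> M then c (Some m) else 0)" for m
  have "{m. Some m \<in> M} \<subseteq> the ` M" by force
  then have "finite {m. Some m \<in> M}" using M finite_surj by blast
  then have "finite (abs ` {m. Some m \<in> M})" by simp
  from bdd_above_finite[OF this] obtain B0 where B0: "\<And>m. Some m \<in> M \<Longrightarrow> \<bar>m\<bar> \<le> B0"
    unfolding bdd_above_def by blast
  \<comment> \<open>The margin puts \<open>-1\<close> inside \<open>{-B..B}\<close> and makes
    \<open>ct\<close> vanish at both ends, so a sum shifted by one can be taken over the same
    interval.\<close>
  define B where "B = \<bar>B0\<bar> + 2"
  have B: "ct m = 0" if "\<bar>m\<bar> \<ge> B" for m using B0[of m] that by (auto simp: ct_def B_def)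
  have B2: "B \<ge> 2" by (simp add: B_def)
  \<comment> \<open>The total coefficient of \<open>u^k\<close>: the first term of
    \<open>Some k\<close>, the second term of \<open>Some (k + 1)\<close>, and \<open>None\<close>
    at \<open>k = -1\<close>.\<close>
  define E where "E k = (if k = - 1 then cN else 0) + of_int (int e + k * int N) * ct k + of_int ((k + 1) * int N) * ct (k + 1)" for k
  have sums: "(\<Sum>k\<in>{-B..B}. E k * u powi k) = (\<Sum>\<rho>\<in>M. c \<rho> * tdiff_val N e \<rho> u)" for u
  proof -
    have "(\<Sum>k\<in>{-B..B}. E k * u powi k) = (\<Sum>k\<in>{-B..B}. if k = - 1 then cN * u powi (-1) else 0)
        + (\<Sum>k\<in>{-B..B}. of_int (int e + k * int N) * ct k * u powi k)
        + (\<Sum>k\<in>{-B..B}. of_int ((k + 1) * int N) * ct (k + 1) * u powi k)"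
      unfolding sum.distrib[symmetric] by (intro sum.cong) (auto simp: E_def algebra_simps)
    also have "(\<Sum>k\<in>{-B..B}. of_int ((k + 1) * int N) * ct (k + 1) * u powi k)
        = (\<Sum>m\<in>{-B+1..B+1}. of_int (m * int N) * ct m * u powi (m - 1))"
      by (rule sum.reindex_bij_witness[where i = "\<lambda>m. m - 1" and j = "\<lambda>k. k + 1"]) auto
    also have "\<dots> = (\<Sum>m\<in>{-B..B}. of_int (m * int N) * ct m * u powi (m - 1))"
      by (rule sum.mono_neutral_cong) (use B in auto)
    also have "(\<Sum>k\<in>{-B..B}. if k = - 1 then cN * u powi (-1) else 0) = cN * u powi (-1)"
      using B2 by simp
    also have "cN * u powi (-1) + (\<Sum>k\<in>{-B..B}. of_int (int e + k * int N) * ct k * u powi k)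
        + (\<Sum>m\<in>{-B..B}. of_int (m * int N) * ct m * u powi (m - 1))
        = cN * tdiff_val N e None u + (\<Sum>m\<in>{-B..B}. ct m * tdiff_val N e (Some m) u)"
      by (simp add: tdiff_val_def algebra_simps sum.distrib)
    also have "\<dots> = (\<Sum>\<rho>\<in>M. c \<rho> * tdiff_val N e \<rho> u)"
    proof -
      have "(\<Sum>\<rho>\<in>M. c \<rho> * tdiff_val N e \<rho> u) = (\<Sum>\<rho>\<in>M \<inter> {None}. c \<rho> * tdiff_val N e \<rho> u) + (\<Sum>\<rho>\<in>M \<inter> - {None}. c \<rho> * tdiff_val N e \<rho> u)"
        using M by (simp add: sum.Int_Diff[of M _ "{None}"] Diff_eq)
      moreover have "(\<Sum>\<rho>\<in>M \<inter> {None}. c \<rho> * tdiff_val N e \<rho> u) = cN * tdiff_val N e None u" by (auto simp: cN_def)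
      moreover have "(\<Sum>\<rho>\<in>M \<inter> - {None}. c \<rho> * tdiff_val N e \<rho> u) = (\<Sum>\<rho>\<in>Some ` {-B..B}. (if \<rho> \<in> M then c \<rho> else 0) * tdiff_val N e \<rho> u)"
      proof (rule sum.mono_neutral_cong_left)
        show "M \<inter> - {None} \<subseteq> Some ` {-B..B}"
        proof
          fix \<rho> assume "\<rho> \<in> M \<inter> - {None}"
          then obtain m where "\<rho> = Some m" "Some m \<in> M" by auto
          moreover from this have "m \<in> {-B..B}" using B0[of m] by (auto simp: B_def)
          ultimately show "\<rho> \<in> Some ` {-B..B}" by blast
        qed
      qed auto
      moreover have "\<dots> = (\<Sum>m\<in>{-B..B}. ct m * tdiff_val N e (Some m) u)"
        by (subst sum.reindex) (auto simp: ct_def)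
      ultimately show ?thesis by simp
    qed
    finally show ?thesis .
  qed
  have E0: "E k = 0" for k
  proof (cases "k \<in> {-B..B}")
    case True
    then show ?thesis using laurent_indep[of "{-B..B}" U E k] U z sums by simp
  next
    case False
    then have "ct k = 0" "ct (k + 1) = 0" "k \<noteq> - 1" using B[of k] B[of "k + 1"] B2 by auto
    then show ?thesis by (simp add: E_def)
  qed
  have rec: "of_int (int e + k * int N) * ct k + of_int ((k + 1) * int N) * ct (k + 1) = 0" if "k \<noteq> - 1" for k
    using E0[of k] that by (simp add: E_def)
  have pos: "0 \<le> m \<longrightarrow> ct m = 0" if "m \<le> B" for m
    using that
  proof (induction m rule: int_le_induct)
    case base then show ?case using B by auto
  next
    case (step k)
    show ?case
    proof
      assume k: "0 \<le> k - 1"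
      then have "of_int (int e + (k - 1) * int N) * ct (k - 1) = 0" using rec[of "k - 1"] step by simp
      then show "ct (k - 1) = 0" using twist_nonzero[OF e, of "k - 1"] by (simp only: mult_eq_0_iff of_int_eq_0_iff) blast
    qed
  qed
  have neg: "m \<le> - 1 \<longrightarrow> ct m = 0" if "- B \<le> m" for m
    using that
  proof (induction m rule: int_ge_induct)
    case base then show ?case using B by auto
  next
    case (step k)
    show ?case
    proof
      assume k: "k + 1 \<le> - 1"
      then have "of_int ((k + 1) * int N) * ct (k + 1) = 0" using rec[of k] step by simp
      moreover have "(k + 1) * int N \<noteq> 0" using k e by auto
      ultimately show "ct (k + 1) = 0" by (simp only: mult_eq_0_iff of_int_eq_0_iff) blast
    qed
  qed
  have ct0: "ct m = 0" for m
    using pos[of m] neg[of m] B[of m] by linarith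
  moreover have "cN = 0" using E0[of "- 1"] ct0 by (simp add: E_def)
  ultimately show "\<forall>\<rho>\<in>M. c \<rho> = 0"
  proof (intro ballI)
    fix \<rho> assume "\<rho> \<in> M"
    then show "c \<rho> = 0" using ct0 \<open>cN = 0\<close> by (cases \<rho>) (metis cN_def, metis ct_def)
  qed
qed

text \<open>With the other coordinates fixed, the sum is a combination of functions of the
  coordinate \<open>a\<close>. Independence there makes each coefficient vanish, and the coefficient
  at \<open>r0 a\<close> is a sum of the same kind with one coordinate fewer.\<close>

lemma tensor_indep:
  fixes \<phi> :: "nat \<Rightarrow> 'b \<Rightarrow> 'a \<Rightarrow> complex"
  assumes "finite L" "\<And>l. l \<in> L \<Longrightarrow> indep_fam (\<phi> l) (O' l) (A l)"
    "finite X" "\<And>r l. r \<in> X \<Longrightarrow> l \<in> L \<Longrightarrow> r l \<in> O' l"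
    "\<And>r r'. r \<in> X \<Longrightarrow> r' \<in> X \<Longrightarrow> (\<And>l. l \<in> L \<Longrightarrow> r l = r' l) \<Longrightarrow> r = r'"
    "\<And>t. (\<And>l. l \<in> L \<Longrightarrow> t l \<in> A l) \<Longrightarrow> (\<Sum>r\<in>X. c r * (\<Prod>l\<in>L. \<phi> l (r l) (t l))) = 0"
    "r0 \<in> X"
  shows "c r0 = 0"
  using assms
proof (induction L arbitrary: X r0 rule: finite_induct)
  case empty
  then have "X = {r0}" by blast
  then show ?case using empty.prems(5)[of undefined] by simp
next
  case (insert a L)
  \<comment> \<open>Indices that agree with \<open>r0\<close> at \<open>a\<close> are still
    separated by their values on the smaller set.\<close>
  define Y where "Y = {r \<in> X. r a = r0 a}"
  show ?case
  proof (rule insert.IH[of Y])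
    show "indep_fam (\<phi> l) (O' l) (A l)" if "l \<in> L" for l using insert.prems(1) that by simp
    show "finite Y" using insert.prems(2) by (simp add: Y_def)
    show "r l \<in> O' l" if "r \<in> Y" "l \<in> L" for r l using insert.prems(3) that by (simp add: Y_def)
    show "r = r'" if "r \<in> Y" "r' \<in> Y" "\<And>l. l \<in> L \<Longrightarrow> r l = r' l" for r r'
    proof (rule insert.prems(4))
      show "r \<in> X" "r' \<in> X" using that by (auto simp: Y_def)
      show "r l = r' l" if "l \<in> insert a L" for l
        using that \<open>r \<in> Y\<close> \<open>r' \<in> Y\<close> \<open>\<And>l. l \<in> L \<Longrightarrow> r l = r' l\<close> by (auto simp: Y_def)
    qed
    show "r0 \<in> Y" using insert.prems(6) by (simp add: Y_def)
    fix t assume t: "\<And>l. l \<in> L \<Longrightarrow> t l \<in> A l"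
    define e where "e \<rho> = (\<Sum>r\<in>{r \<in> X. r a = \<rho>}. c r * (\<Prod>l\<in>L. \<phi> l (r l) (t l)))" for \<rho>
    have "(\<Sum>\<rho>\<in>(\<lambda>r. r a) ` X. e \<rho> * \<phi> a \<rho> s) = 0" if s: "s \<in> A a" for s
    proof -
      have "0 = (\<Sum>r\<in>X. c r * (\<Prod>l\<in>insert a L. \<phi> l (r l) ((t(a := s)) l)))"
        using t s by (intro insert.prems(5)[symmetric]) auto
      also have "\<dots> = (\<Sum>r\<in>X. c r * (\<Prod>l\<in>L. \<phi> l (r l) (t l)) * \<phi> a (r a) s)"
      proof (rule sum.cong[OF refl])
        fix r
        have "(\<Prod>l\<in>L. \<phi> l (r l) ((t(a := s)) l)) = (\<Prod>l\<in>L. \<phi> l (r l) (t l))"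
          using insert.hyps by (intro prod.cong) auto
        then show "c r * (\<Prod>l\<in>insert a L. \<phi> l (r l) ((t(a := s)) l)) = c r * (\<Prod>l\<in>L. \<phi> l (r l) (t l)) * \<phi> a (r a) s"
          using insert.hyps by simp
      qed
      also have "\<dots> = (\<Sum>\<rho>\<in>(\<lambda>r. r a) ` X. \<Sum>r\<in>{r \<in> X. r a = \<rho>}. c r * (\<Prod>l\<in>L. \<phi> l (r l) (t l)) * \<phi> a (r a) s)"
        using insert.prems(2) by (intro sum.image_gen)
      also have "\<dots> = (\<Sum>\<rho>\<in>(\<lambda>r. r a) ` X. e \<rho> * \<phi> a \<rho> s)"
        by (intro sum.cong) (auto simp: e_def sum_distrib_right)
      finally show ?thesis by simp
    qed
    moreover have "indep_fam (\<phi> a) (O' a) (A a)" using insert.prems(1) by simp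
    moreover have "finite ((\<lambda>r. r a) ` X)" "(\<lambda>r. r a) ` X \<subseteq> O' a" "r0 a \<in> (\<lambda>r. r a) ` X"
      using insert.prems by auto
    ultimately have "e (r0 a) = 0" unfolding indep_fam_def by blast
    then show "(\<Sum>r\<in>Y. c r * (\<Prod>l\<in>L. \<phi> l (r l) (t l))) = 0" by (simp add: e_def Y_def)
  qed
qed

section \<open>Independence on the variety by evaluation at points\<close>

context usetup
begin

text \<open>From \<open>2 + cmod \<alpha>\<close> on, \<open>t^e - 1\<close> has modulus at least
  \<open>1 + cmod \<alpha>\<close>. Thus every \<open>u l\<close> is nonzero and a nonempty product
  of them exceeds \<alpha>, whatever \<open>x_k0\<close> will be.\<close>

definition A where "A = complex_of_real ` {2 + cmod \<alpha>..}"

lemma A_nz: "t \<in> A \<Longrightarrow> t \<noteq> 0"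
proof -
  assume "t \<in> A"
  then obtain s where "t = complex_of_real s" "s \<ge> 2 + cmod \<alpha>" by (auto simp: A_def)
  moreover from this have "s > 0" using norm_ge_zero[of \<alpha>] by linarith
  ultimately show ?thesis by simp
qed

lemma A_norm: "t \<in> A \<Longrightarrow> 1 \<le> e \<Longrightarrow> cmod (t ^ e - 1) \<ge> 1 + cmod \<alpha>"
proof -
  assume "t \<in> A" "1 \<le> e"
  then obtain s where s: "t = complex_of_real s" "s \<ge> 2 + cmod \<alpha>" by (auto simp: A_def)
  then have "s \<ge> 1" using norm_ge_zero[of \<alpha>] by linarith
  then have "s ^ 1 \<le> s ^ e" using \<open>1 \<le> e\<close> by (intro power_increasing) auto
  then have "s ^ e - 1 \<ge> 1 + cmod \<alpha>" using s by simp
  moreover have "t ^ e - 1 = complex_of_real (s ^ e - 1)" by (simp add: s)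
  ultimately show ?thesis using norm_ge_zero[of \<alpha>] by (metis abs_ge_self norm_of_real order_trans)
qed

lemma infinite_uA: "l \<le> d \<Longrightarrow> infinite ((\<lambda>t. t ^ n l - 1) ` A)"
proof -
  assume "l \<le> d"
  then have nl: "n l > 0" using n by force
  have inj: "inj_on (\<lambda>t. t ^ n l - 1) A"
  proof (rule inj_onI)
    fix s t assume st: "s \<in> A" "t \<in> A" "s ^ n l - 1 = t ^ n l - 1"
    then obtain a b where ab: "s = complex_of_real a" "t = complex_of_real b" "a \<ge> 2 + cmod \<alpha>" "b \<ge> 2 + cmod \<alpha>"
      by (auto simp: A_def)
    then have "a ^ n l = b ^ n l" using st by (simp flip: of_real_power)
    moreover have "0 \<le> a" "0 \<le> b" using ab norm_ge_zero[of \<alpha>] by linarith+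
    ultimately show "s = t" using ab nl power_eq_iff_eq_base by blast
  qed
  have "infinite A" unfolding A_def
    by (subst finite_image_iff) (auto simp: inj_on_def infinite_Ici)
  then show ?thesis using finite_imageD[OF _ inj] by blast
qed

lemma zero_uA: "l \<le> d \<Longrightarrow> 0 \<notin> (\<lambda>t. t ^ n l - 1) ` A"
proof
  assume l: "l \<le> d" and "0 \<in> (\<lambda>t. t ^ n l - 1) ` A"
  then obtain t where "t \<in> A" "t ^ n l - 1 = 0" by auto
  then show False using A_norm[of t "n l"] n[OF l] norm_ge_zero[of \<alpha>] by simp
qed

text \<open>\<open>F\<close> at a point of the variety, as a function of the single coordinate
  \<open>t = x_l\<close> (\<open>evp_F\<close>): the inverse \<open>w l\<close>, a polynomial in the
  other coordinates, becomes \<open>1 / (t^n - 1)\<close>.\<close>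

definition \<phi> where
  "\<phi> l \<sigma> \<rho> t = (if l \<in> I then (if \<sigma> then t ^ (i l - 1) * tdiff_val (n l) (i l) \<rho> (t ^ n l - 1)
        else if \<rho> = None then 0 else t ^ i l * ufun_val \<rho> (t ^ n l - 1))
      else if \<sigma> then of_nat (n l) * t ^ (n l - 1) * udiff_val \<rho> (t ^ n l - 1) else ufun_val \<rho> (t ^ n l - 1))"

text \<open>For \<open>l \<in> I\<close> the function at \<open>None\<close> is zero, so it must
  leave the family before independence can hold; as a one-form index \<open>None\<close>
  stays.\<close>

definition ok_idx where "ok_idx l \<sigma> = {\<rho>. ok l \<rho> \<and> (l \<in> I \<and> \<not> \<sigma> \<longrightarrow> \<rho> \<noteq> None)}"

lemma indep_fam_cong: "(\<And>\<rho> t. \<rho> \<in> O' \<Longrightarrow> t \<in> B' \<Longrightarrow> p \<rho> t = q \<rho> t) \<Longrightarrow> indep_fam p O' B' = indep_fam q O' B'"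
proof -
  assume *: "\<And>\<rho> t. \<rho> \<in> O' \<Longrightarrow> t \<in> B' \<Longrightarrow> p \<rho> t = q \<rho> t"
  have "(\<Sum>\<rho>\<in>M. c \<rho> * p \<rho> t) = (\<Sum>\<rho>\<in>M. c \<rho> * q \<rho> t)" if "M \<subseteq> O'" "t \<in> B'" for M c t
    using * that by (intro sum.cong) auto
  then have "(\<forall>t\<in>B'. (\<Sum>\<rho>\<in>M. c \<rho> * p \<rho> t) = 0) = (\<forall>t\<in>B'. (\<Sum>\<rho>\<in>M. c \<rho> * q \<rho> t) = 0)" if "M \<subseteq> O'" for M c
    using that by simp
  then show ?thesis unfolding indep_fam_def by meson
qed

lemma indep_\<phi>: "l \<in> L \<Longrightarrow> indep_fam (\<phi> l \<sigma>) (ok_idx l \<sigma>) A"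
proof -
  assume "l \<in> L"
  then have l: "l \<le> d" by (rule L_le)
  note U = infinite_uA[OF l] zero_uA[OF l]
  have nl: "n l > 0" using n[OF l] by simp
  show ?thesis
  proof (cases "l \<in> I")
    case True
    show ?thesis
    proof (cases \<sigma>)
      case t: True
      have "indep_fam (\<lambda>\<rho> t. t ^ (i l - 1) * tdiff_val (n l) (i l) \<rho> (t ^ n l - 1)) UNIV A"
        by (rule indep_fam_comp[OF indep_tdiff_val[OF U]]) (use I_bounds[OF True] A_nz in auto)
      moreover have "ok_idx l \<sigma> = UNIV" using True t by (auto simp: ok_idx_def ok_def)
      ultimately show ?thesis using True t by (simp add: \<phi>_def[abs_def])
    next
      case f: False
      have "indep_fam (\<lambda>\<rho> t. t ^ i l * ufun_val \<rho> (t ^ n l - 1)) {\<rho>. \<rho> \<noteq> None} A"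
        by (rule indep_fam_comp[OF indep_ufun_val(2)[OF U]]) (use A_nz in auto)
      moreover have "ok_idx l \<sigma> = {\<rho>. \<rho> \<noteq> None}" using True f by (auto simp: ok_idx_def ok_def)
      ultimately show ?thesis using True f
        by (subst indep_fam_cong[where q = "\<lambda>\<rho> t. t ^ i l * ufun_val \<rho> (t ^ n l - 1)"]) (auto simp: \<phi>_def)
    qed
  next
    case False
    then have ok_idx: "ok_idx l \<sigma> = {\<rho>. \<rho> \<noteq> Some 0}" by (auto simp: ok_idx_def ok_def)
    show ?thesis
    proof (cases \<sigma>)
      case t: True
      have "indep_fam (\<lambda>\<rho> t. of_nat (n l) * t ^ (n l - 1) * udiff_val \<rho> (t ^ n l - 1)) {\<rho>. \<rho> \<noteq> Some 0} A"
        by (rule indep_fam_comp[OF indep_udiff_val[OF U]]) (use nl A_nz in auto)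
      then show ?thesis using False t ok_idx by (simp add: \<phi>_def[abs_def])
    next
      case f: False
      have "indep_fam (\<lambda>\<rho> t. 1 * ufun_val \<rho> (t ^ n l - 1)) {\<rho>. \<rho> \<noteq> Some 0} A"
        by (rule indep_fam_comp[OF indep_ufun_val(1)[OF U]]) auto
      then show ?thesis using False f ok_idx by (simp add: \<phi>_def[abs_def])
    qed
  qed
qed

lemma evp_u: "evp x (u l) = x l ^ n l - 1"
  by (simp add: u_def)

lemma evp_uw:
  assumes "evp x (Ueq d n \<alpha>) = 0" "l \<le> d"
  shows "evp x (u l) * evp x (w l) = 1"
  using arg_cong[OF uw_eq[OF assms(2)], of "evp x"] assms(1) by simp

lemma evp_upow:
  assumes "evp x (Ueq d n \<alpha>) = 0" "l \<le> d"
  shows "evp x (upow (u l) (w l) m) = (x l ^ n l - 1) powi m"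
proof -
  have "evp x (w l) = inverse (x l ^ n l - 1)"
    using evp_uw[OF assms] by (metis evp_u inverse_unique)
  then show ?thesis by (simp add: upow_def power_int_def evp_u)
qed

lemma evp_F:
  assumes "evp x (Ueq d n \<alpha>) = 0" "l \<le> d"
  shows "evp x (F l \<sigma> \<rho>) = \<phi> l \<sigma> \<rho> (x l)"
proof -
  note up = evp_upow[OF assms]
  have w: "evp x (w l) = (x l ^ n l - 1) powi (- 1)" using up[of "- 1"] by simp
  have of_nat: "evp x (of_nat k) = of_nat k" for k using evp_Const[of x "of_nat k"] by (simp add: Const_of_nat)
  show ?thesis
    by (cases \<rho>) (auto simp: F_def f_def g_def tfun_def tdiff_def ufun_def udiff_def \<phi>_def ufun_val_def udiff_val_def tdiff_val_def up w P_def of_nat)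
qed

text \<open>Once the other coordinates are given, the equation reads
  \<open>x_k0^n_k0 = 1 - \<alpha> / p\<close>, with \<open>p\<close> the product of the other
  factors, and has a root over the complex numbers.\<close>

lemma point_exists:
  assumes t: "\<And>l. l \<in> L \<Longrightarrow> t l \<in> A"
  shows "\<exists>x. (\<forall>l\<in>L. x l = t l) \<and> evp x (Ueq d n \<alpha>) = 0 \<and> x k0 \<noteq> 0"
proof -
  define p where "p = (\<Prod>l\<in>L. 1 - t l ^ n l)"
  \<comment> \<open>\<open>1 \<le> d\<close> provides at least one factor; it has modulus at least
    \<open>1 + cmod \<alpha>\<close>, the others at least \<open>1\<close>.\<close>
  have Lne: "L \<noteq> {}"
  proof -
    have "(if k0 = 0 then 1 else 0) \<in> L" using d by (auto simp: L_def)
    then show ?thesis by auto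
  qed
  have "cmod p \<ge> 1 + cmod \<alpha>"
  proof -
    have fac: "cmod (1 - t l ^ n l) \<ge> 1 + cmod \<alpha>" if "l \<in> L" for l
      using A_norm[OF t[OF that]] n[OF L_le[OF that]] by (simp add: norm_minus_commute)
    obtain a where a: "a \<in> L" using Lne by auto
    have "(1 + cmod \<alpha>) * 1 \<le> cmod (1 - t a ^ n a) * (\<Prod>l\<in>L - {a}. cmod (1 - t l ^ n l))"
    proof (rule mult_mono)
      show "1 \<le> (\<Prod>l\<in>L - {a}. cmod (1 - t l ^ n l))"
      proof (rule prod_ge_1)
        fix l assume "l \<in> L - {a}"
        then have "1 + cmod \<alpha> \<le> cmod (1 - t l ^ n l)" using fac[of l] by simp
        then show "1 \<le> cmod (1 - t l ^ n l)" using norm_ge_zero[of \<alpha>] by linarith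
      qed
    qed (use fac a in auto)
    also have "\<dots> = cmod p" unfolding p_def prod_norm[symmetric] using a finL by (simp add: prod.remove[of L a])
    finally show ?thesis by simp
  qed
  then have p1: "cmod p > cmod \<alpha>" by simp
  then have p0: "p \<noteq> 0" using norm_ge_zero[of \<alpha>] by auto
  \<comment> \<open>Thus the root is nonzero, which keeps the partial derivative of the equation in
    \<open>x_k0\<close> from vanishing at the point.\<close>
  have ne: "1 - \<alpha> / p \<noteq> 0" using p0 p1 by (auto simp: field_simps)
  have "card {z. z ^ n k0 = 1 - \<alpha> / p} = n k0" using n[OF k0(1)] ne by (intro card_nth_roots) auto
  then obtain z where z: "z ^ n k0 = 1 - \<alpha> / p"
    using n[OF k0(1)] by (metis (mono_tags, lifting) card.empty empty_Collect_eq not_one_le_zero)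
  let ?x = "t(k0 := z)"
  have k: "k0 \<notin> L" by (simp add: L_def)
  have "(\<Prod>k\<le>d. 1 - ?x k ^ n k) = (1 - ?x k0 ^ n k0) * (\<Prod>k\<in>L. 1 - ?x k ^ n k)"
    unfolding L_def using k0 by (intro prod.remove) auto
  also have "(\<Prod>k\<in>L. 1 - ?x k ^ n k) = p" unfolding p_def using k by (intro prod.cong) auto
  also have "(1 - ?x k0 ^ n k0) * p = \<alpha>" using z p0 by simp
  finally have "evp ?x (Ueq d n \<alpha>) = 0" by (simp add: Ueq_def evp_prod)
  moreover have "z \<noteq> 0" using z ne n[OF k0(1)] by (auto simp: zero_power)
  moreover have "?x l = t l" if "l \<in> L" for l using that k by auto
  ultimately show ?thesis by (intro exI[of _ ?x]) simp
qed

lemma coeff_basis: "basis r T S = (if S = T then \<Prod>l\<in>L. F l (l \<in> T) (r l) else 0)"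
  by (simp add: basis_def dterm_def)

lemma coeff_B: "B Y c S = (if S \<subseteq> L then \<Sum>r\<in>Y. Const (c r S) * (\<Prod>l\<in>L. F l (l \<in> S) (r l)) else 0)"
proof -
  have "B Y c S = (\<Sum>r\<in>Y. \<Sum>T\<in>Pow L. if T = S then Const (c r S) * (\<Prod>l\<in>L. F l (l \<in> S) (r l)) else 0)"
    unfolding B_def form_apply by (intro sum.cong) (auto simp: cmul_apply coeff_basis)
  then show ?thesis using finL by auto
qed

text \<open>Wedging with \<open>dG\<close> kills the relations \<open>dG \<and> b\<close>; the coefficient at \<open>S \<union> {k0}\<close> then shows that
  the coefficient at \<open>S\<close> vanishes at every point of the variety with \<open>x\<^sub>k\<^sub>0 \<noteq> 0\<close>.\<close>

lemma indep_U: indep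
  unfolding indep_def
proof (intro allI impI ballI)
  fix X c r0 S
  assume X: "finite X" "X \<subseteq> R" and rel: "B X c \<in> rels G" and r0: "r0 \<in> X" and S: "S \<subseteq> L" and al: "allowed r0 S"
  let ?D = "dpoly (Ueq d n \<alpha>)"
  obtain a b where ab: "B X c = pmult (Ueq d n \<alpha>) a + wedge ?D b" using rel by (auto simp: rels_def)
  have fS: "finite S" using S finL finite_subset by blast
  have k0S: "k0 \<notin> S" using S by (auto simp: L_def)
  have "wedge ?D (B X c) = pmult (Ueq d n \<alpha>) (wedge ?D a)"
    by (simp add: ab wedge_simps wedge_1form_self flip: wedge_assoc)
  moreover have "wedge ?D (B X c) (insert k0 S) = Const (sgn_sets {k0} S) * pderiv_mp k0 (Ueq d n \<alpha>) * B X c S"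
  proof -
    have "wedge ?D (B X c) (insert k0 S) = (\<Sum>k\<in>insert k0 S. Const (sgn_sets {k} (insert k0 S - {k})) * ?D {k} * B X c (insert k0 S - {k}))"
      using fS by (intro wedge_1form_left) auto
    also have "\<dots> = (\<Sum>k\<in>insert k0 S. if k = k0 then Const (sgn_sets {k0} S) * ?D {k0} * B X c S else 0)"
    proof (rule sum.cong[OF refl])
      fix k assume k: "k \<in> insert k0 S"
      have "insert k0 S - {k0} = S" using k0S by auto
      \<comment> \<open>For \<open>k \<noteq> k0\<close> the set still contains \<open>k0\<close>,
        while \<open>B X c\<close> has coefficients only at subsets of \<open>L\<close>; a single
        term survives.\<close>
      moreover have "B X c (insert k0 S - {k}) = 0" if "k \<noteq> k0"
      proof -
        have "\<not> insert k0 S - {k} \<subseteq> L" using that unfolding L_def by blast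
        then show ?thesis by (simp add: coeff_B)
      qed
      ultimately show "Const (sgn_sets {k} (insert k0 S - {k})) * ?D {k} * B X c (insert k0 S - {k}) = (if k = k0 then Const (sgn_sets {k0} S) * ?D {k0} * B X c S else 0)"
        by simp
    qed
    finally show ?thesis using fS by simp
  qed
  ultimately have key: "Const (sgn_sets {k0} S) * pderiv_mp k0 (Ueq d n \<alpha>) * B X c S = Ueq d n \<alpha> * wedge ?D a (insert k0 S)"
    by (simp add: pmult_apply)
  have dk0: "pderiv_mp k0 (Ueq d n \<alpha>) = Const \<alpha> * (w k0 * P k0)"
  proof -
    have "pderiv_mp k0 (Ueq d n \<alpha>) = ?D {k0}" by simp
    also have "\<dots> = Const \<alpha> * (\<Sum>k\<le>d. if k = k0 then w k0 * P k0 else 0)"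
      unfolding dpoly_Ueq cmul_apply form_apply by (auto simp: dterm_def intro!: arg_cong2[where f = "(*)"] sum.cong)
    finally show ?thesis using k0 by simp
  qed
  have van: "evp x (B X c S) = 0" if x: "evp x (Ueq d n \<alpha>) = 0" "x k0 \<noteq> 0" for x
  proof -
    have of_nat: "evp x (of_nat k) = of_nat k" for k using evp_Const[of x "of_nat k"] by (simp add: Const_of_nat)
    have "evp x (w k0) \<noteq> 0" using evp_uw[OF x(1) k0(1)] by auto
    moreover have "evp x (P k0) \<noteq> 0" using x n[OF k0(1)] by (simp add: P_def of_nat)
    ultimately have "evp x (pderiv_mp k0 (Ueq d n \<alpha>)) \<noteq> 0" using \<alpha> by (simp add: dk0)
    then show ?thesis using arg_cong[OF key, of "evp x"] x by simp
  qed
  \<comment> \<open>At pairs that are not allowed some factor is the zero function, so these terms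
    are discarded before independence is applied.\<close>
  define X' where "X' = {r \<in> X. allowed r S}"
  show "c r0 S = 0"
  proof (rule tensor_indep[where \<phi> = "\<lambda>l. \<phi> l (l \<in> S)" and O' = "\<lambda>l. ok_idx l (l \<in> S)" and A = "\<lambda>_. A" and X = X' and c = "\<lambda>r. c r S" and L = L])
    show "finite L" by (rule finL)
    show "indep_fam (\<phi> l (l \<in> S)) (ok_idx l (l \<in> S)) A" if "l \<in> L" for l by (rule indep_\<phi>[OF that])
    show "finite X'" using X by (simp add: X'_def)
    show "r l \<in> ok_idx l (l \<in> S)" if "r \<in> X'" "l \<in> L" for r l
      using that X by (auto simp: X'_def ok_idx_def R_def allowed_def)
    show "r = r'" if "r \<in> X'" "r' \<in> X'" "\<And>l. l \<in> L \<Longrightarrow> r l = r' l" for r r'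
    proof
      fix l
      have "r \<in> R" "r' \<in> R" using that X by (auto simp: X'_def)
      then show "r l = r' l"
        using that(3)[of l] R_None[of r l] R_None[of r' l] by (cases "l \<in> L") auto
    qed
    show "r0 \<in> X'" using r0 al by (simp add: X'_def)
    fix t assume t: "\<And>l. l \<in> L \<Longrightarrow> t l \<in> A"
    obtain x where x: "\<And>l. l \<in> L \<Longrightarrow> x l = t l" "evp x (Ueq d n \<alpha>) = 0" "x k0 \<noteq> 0" using point_exists[of t] t by blast
    have "0 = evp x (B X c S)" using van[OF x(2,3)] by simp
    also have "\<dots> = (\<Sum>r\<in>X. c r S * (\<Prod>l\<in>L. \<phi> l (l \<in> S) (r l) (t l)))"
      using S by (simp add: coeff_B evp_sum evp_prod evp_F[OF x(2)] x(1) L_le)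
    also have "\<dots> = (\<Sum>r\<in>X'. c r S * (\<Prod>l\<in>L. \<phi> l (l \<in> S) (r l) (t l)))"
    proof (rule sum.mono_neutral_right)
      show "\<forall>r\<in>X - X'. c r S * (\<Prod>l\<in>L. \<phi> l (l \<in> S) (r l) (t l)) = 0"
      proof
        fix r assume "r \<in> X - X'"
        then obtain l where "l \<in> I" "r l = None" "l \<notin> S" by (auto simp: X'_def allowed_def)
        then have "\<exists>l\<in>L. \<phi> l (l \<in> S) (r l) (t l) = 0" using I_sub by (auto simp: \<phi>_def intro!: bexI[of _ l])
        then have "(\<Prod>l\<in>L. \<phi> l (l \<in> S) (r l) (t l)) = 0" using finL by (meson prod_zero)
        then show "c r S * (\<Prod>l\<in>L. \<phi> l (l \<in> S) (r l) (t l)) = 0" by simp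
      qed
    qed (use X in \<open>auto simp: X'_def\<close>)
    finally show "(\<Sum>r\<in>X'. c r S * (\<Prod>l\<in>L. \<phi> l (l \<in> S) (r l) (t l))) = 0" by simp
  qed
qed

end

section \<open>The model of the torus\<close>

locale tsetup =
  fixes LT :: "nat set"
  assumes finLT: "finite LT"
begin

abbreviation TG where "TG \<equiv> Tgens LT"
abbreviation TV where "TV \<equiv> Tvars LT"
definition uT where "uT l = Var (2 * l) - 1"
definition wT where "wT l = Var (2 * l + 1)"

lemma finTV: "finite TV" using finLT by (simp add: Tvars_def)

lemma uwT: "l \<in> LT \<Longrightarrow> uT l * wT l - 1 \<in> ideal TG"
proof -
  assume "l \<in> LT"
  then have "Var (2 * l + 1) * (Var (2 * l) - 1) - 1 \<in> TG" by (auto simp: Tgens_def)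
  moreover have "finite TG" using finLT by (simp add: Tgens_def)
  ultimately show ?thesis using ideal_gen by (simp add: uT_def wT_def mult.commute)
qed

lemma duT: "dpoly (uT l) = dterm {2 * l} 1"
  by (simp add: uT_def dpoly_simps dpoly_Var)

sublocale log_model TG LT "{}" "\<lambda>l. 2 * l" "\<lambda>l. ufun (uT l) (wT l)" "\<lambda>l. udiff (uT l) (wT l) 1"
proof
  show "finite LT" by (rule finLT)
  show "strict_mono (\<lambda>l::nat. 2 * l)" by (simp add: strict_mono_def)
  fix l assume l: "l \<in> LT"
  show "dpoly (ufun (uT l) (wT l) None) = 0" by (simp add: ufun_def dpoly_simps)
  show "ext_d (dterm {2 * l} (udiff (uT l) (wT l) 1 None)) \<in> rels TG"
    using log_closed[OF uwT[OF l] duT, of 1 0] by (simp add: udiff_def dpoly_simps)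
  show "dpoly (ufun (uT l) (wT l) (Some m)) - dterm {2 * l} (udiff (uT l) (wT l) 1 (Some m)) \<in> rels TG" for m
    by (rule ufun_d[OF uwT[OF l] duT])
qed auto

lemma fspan_eq: "fspan l \<sigma> = lspan TG (uspan (uT l) (wT l) 1)"
proof -
  have "{F l \<sigma> \<rho> |\<rho>. ok l \<rho>} = (if \<sigma> then {udiff (uT l) (wT l) 1 \<rho> |\<rho>. \<rho> \<noteq> Some 0} else {ufun (uT l) (wT l) \<rho> |\<rho>. \<rho> \<noteq> Some 0})"
    by (auto simp: F_def ok_def)
  then show ?thesis by (simp add: fspan_def ufun_span udiff_span)
qed

lemma spanned_Var: "k \<in> TV \<Longrightarrow> z \<in> spanned \<Longrightarrow> pmult (Var k) z \<in> spanned"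
proof -
  assume "k \<in> TV" and z: "z \<in> spanned"
  then obtain l where l: "l \<in> LT" "k = 2 * l \<or> k = 2 * l + 1" by (auto simp: Tvars_def)
  have u: "pmult (uT l) z \<in> spanned" by (rule spanned_pmult[OF l(1) _ z]) (auto simp: fspan_eq intro: uspan_u(1)[OF uwT[OF l(1)]])
  have w: "pmult (wT l) z \<in> spanned" by (rule spanned_pmult[OF l(1) _ z]) (auto simp: fspan_eq intro: uspan_u(2)[OF uwT[OF l(1)]])
  from spanned_add[OF u z] w show ?thesis using l(2) by (auto simp: uT_def wT_def pmult_simps)
qed

lemma spanned_poly: "poly_in TV p \<Longrightarrow> z \<in> spanned \<Longrightarrow> pmult p z \<in> spanned"
proof (induction p arbitrary: z rule: poly_in_induct)
  case (Const c)
  then show ?case using spanned_cmul[of z c] by (simp add: cmul_def)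
next
  case (mult p q)
  then show ?case by (simp flip: pmult_simps(10))
qed (auto simp: pmult_simps spanned_Var spanned_add)

text \<open>The differential of the inverse coordinate is eliminated by
  \<open>dz = - z^2 dy\<close>, which holds modulo the relations.\<close>

lemma spanned_dVar: "k \<in> TV \<Longrightarrow> z \<in> spanned \<Longrightarrow> wedge (dterm {k} 1) z \<in> spanned"
proof -
  assume "k \<in> TV" and z: "z \<in> spanned"
  then obtain l where l: "l \<in> LT" "k = 2 * l \<or> k = 2 * l + 1" by (auto simp: Tvars_def)
  have u: "wedge (dterm {2 * l} 1) z \<in> spanned" by (rule spanned_wedge[OF l(1) _ z]) (auto simp: fspan_eq)
  have "dterm {2 * l + 1} 1 + pmult (wT l * wT l) (dterm {2 * l} 1) \<in> rels TG"
    using dpoly_inverse[OF uwT[OF l(1)]] by (simp only: duT) (simp add: wT_def dpoly_Var)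
  then have "wedge (dterm {2 * l + 1} 1 + pmult (wT l * wT l) (dterm {2 * l} 1)) z \<in> spanned"
    by (intro rels_spanned rels_wedge_right)
  moreover have "cmul (- 1) (pmult (wT l * wT l) (wedge (dterm {2 * l} 1) z)) \<in> spanned"
    using l u by (intro spanned_cmul spanned_poly poly_in_mult) (auto simp: wT_def Tvars_def)
  ultimately have "wedge (dterm {2 * l + 1} 1) z \<in> spanned"
    using spanned_add by (fastforce simp: wedge_simps cmul_simps simp del: pmult_dterm)
  then show ?thesis using u l(2) by auto
qed

lemma spanned_dterm_one: "finite S \<Longrightarrow> S \<subseteq> TV \<Longrightarrow> dterm S 1 \<in> spanned"
proof (induction S rule: finite_induct)
  case empty
  have "dterm ((\<lambda>l. 2 * l) ` {}) (\<Prod>l\<in>LT. 1) \<in> spanned" by (rule tensor_spanned) (auto simp: fspan_eq uspan_mem0)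
  then show ?case by simp
next
  case (insert a S)
  let ?s = "sgn_sets {a} S"
  have "cmul ?s (wedge (dterm {a} 1) (dterm S 1)) \<in> spanned" using insert by (intro spanned_cmul spanned_dVar) auto
  moreover have "Const ?s * Const ?s = 1" by (simp flip: Const_mult)
  ultimately show ?case using insert by (simp add: wedge_dterm)
qed

lemma form_spanned: "is_form TV q x \<Longrightarrow> x \<in> spanned"
proof -
  assume x: "is_form TV q x"
  then have "x = (\<Sum>S\<in>Pow TV. dterm S (x S))" by (intro dform_eq_sum_dterm finTV) (auto simp: is_form_def)
  moreover have "dterm S (x S) \<in> spanned" if "S \<subseteq> TV" for S
  proof (cases "x S = 0")
    case False
    then have "poly_in TV (x S)" using x by (auto simp: is_form_def)
    from spanned_poly[OF this spanned_dterm_one[OF finite_subset[OF that finTV] that]] show ?thesis by simp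
  qed (simp add: rels_spanned)
  ultimately show ?thesis using spanned_sum by (metis (no_types, lifting) PowD)
qed

lemma TG_in: "g \<in> TG \<Longrightarrow> poly_in TV g"
  by (auto simp: Tgens_def Tvars_def intro!: poly_in_diff poly_in_mult)

lemma T_basis_form: "M \<subseteq> LT \<Longrightarrow> is_form TV (card M) (basis N M)"
proof -
  assume M: "M \<subseteq> LT"
  have "poly_in TV (\<Prod>l\<in>LT. F l (l \<in> M) None)"
  proof (intro poly_in_prod)
    fix l assume l: "l \<in> LT"
    have "F l (l \<in> M) None = (if l \<in> M then wT l else 1)" by (simp add: F_def ufun_def udiff_def)
    then show "poly_in TV (F l (l \<in> M) None)" using l by (simp add: wT_def Tvars_def)
  qed
  moreover have "card ((\<lambda>l. 2 * l) ` M) = card M" by (rule card_image) (auto simp: inj_on_def)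
  ultimately show ?thesis using M by (auto simp: is_form_def basis_def dterm_def Tvars_def)
qed

text \<open>\<open>closed_span\<close> does not control the degree. As the basis forms are
  homogeneous, projection to degree \<open>q\<close> retains exactly those with
  \<open>card M = q\<close>.\<close>

lemma T_span:
  assumes indep "is_form TV q x" "ext_d x \<in> rels TG"
  shows "\<exists>c0. x - (\<Sum>M\<in>{M. M \<subseteq> LT \<and> card M = q}. cmul (c0 M) (basis N M)) \<in> exacts TG"
proof -
  obtain X c where X: "finite X" "X \<subseteq> R" "x - B X c \<in> rels TG" using form_spanned[OF assms(2)] by (auto simp: spanned_def)
  from closed_span[OF assms(1) X assms(3)] obtain c0 where
    c0: "x - (\<Sum>M\<in>{M. {} \<subseteq> M \<and> M \<subseteq> LT}. cmul (c0 M) (basis N M)) \<in> exacts TG" by blast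
  have "filt (formQ TV q) (x - (\<Sum>M\<in>{M. {} \<subseteq> M \<and> M \<subseteq> LT}. cmul (c0 M) (basis N M))) \<in> exacts TG"
    by (rule filt_exacts[of _ _ "formQ' TV q", OF _ d_compatible_formQ c0]) (use TG_in mult_invariant_formQ in auto)
  moreover have "filt (formQ TV q) (\<Sum>M\<in>{M. {} \<subseteq> M \<and> M \<subseteq> LT}. cmul (c0 M) (basis N M)) = (\<Sum>M\<in>{M. M \<subseteq> LT \<and> card M = q}. cmul (c0 M) (basis N M))"
    unfolding filt_sum filt_simps
  proof (rule sum.mono_neutral_cong_right)
    show "finite {M. {} \<subseteq> M \<and> M \<subseteq> LT}" using finLT by simp
    have h: "supp_in (formQ TV (card M)) (basis N M)" if "M \<subseteq> LT" for M using T_basis_form[OF that] by (simp add: is_form_supp_in)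
    show "\<forall>M\<in>{M. {} \<subseteq> M \<and> M \<subseteq> LT} - {M. M \<subseteq> LT \<and> card M = q}. cmul (c0 M) (filt (formQ TV q) (basis N M)) = 0"
    proof
      fix M assume "M \<in> {M. {} \<subseteq> M \<and> M \<subseteq> LT} - {M. M \<subseteq> LT \<and> card M = q}"
      then have "filt (formQ TV q) (basis N M) = 0" by (intro filt_supp_in_disj[OF h]) (auto simp: formQ_def)
      then show "cmul (c0 M) (filt (formQ TV q) (basis N M)) = 0" by (simp add: cmul_simps)
    qed
    show "cmul (c0 M) (filt (formQ TV q) (basis N M)) = cmul (c0 M) (basis N M)" if "M \<in> {M. M \<subseteq> LT \<and> card M = q}" for M
      using h[of M] that by (auto simp: filt_supp_in)
  qed auto
  moreover have "filt (formQ TV q) x = x" using assms(2) by (simp add: is_form_supp_in filt_supp_in)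
  ultimately show ?thesis by (auto simp: filt_simps)
qed

end

section \<open>The comparison map\<close>

context usetup
begin

abbreviation LT where "LT \<equiv> Lset d i k0"

lemma LT_eq: "LT = L - I" by (auto simp: Lset_def L_def)

sublocale T: tsetup LT
  by standard (simp add: Lset_def)

abbreviation op where "op \<equiv> omega_pull d n \<alpha> i k0"
abbreviation \<omega> where "\<omega> \<equiv> omega d n \<alpha> i"
abbreviation pm where "pm \<equiv> pmap d n \<alpha>"

text \<open>The factors of \<omega> are the cokernel representatives \<open>g k None\<close>,
  already in increasing order, so no sign appears.\<close>

lemma omega_dterm: "\<omega> = dterm I (\<Prod>k\<in>I. g k None)"
proof -
  have "\<omega> = wset (\<lambda>k. dterm {k} (Var k ^ (i k - 1) * w k)) I"
    unfolding omega_def wset_def dterm_def ..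
  also have "\<dots> = dterm I (\<Prod>k\<in>I. Var k ^ (i k - 1) * w k)"
    using I_sub finL finite_subset by (intro wset_dterm) blast
  also have "(\<Prod>k\<in>I. Var k ^ (i k - 1) * w k) = (\<Prod>k\<in>I. g k None)"
    by (intro prod.cong) (auto simp: g_def tdiff_def)
  finally show ?thesis .
qed

lemma omega_closed: "ext_d \<omega> \<in> rels G"
  unfolding omega_dterm using g_closed[of I N] I_sub finL finite_subset[of I L] by simp

lemma op_wedge: "op x = wedge \<omega> (pullback T.TV pm x)"
  by (simp add: omega_pull_def)

lemma op_simps:
  "op (a + b) = op a + op b" "op (a - b) = op a - op b" "op (cmul c a) = cmul c (op a)"
  by (simp_all add: op_wedge pullback_simps wedge_simps)

lemma op_sum: "op (\<Sum>x\<in>Y. h x) = (\<Sum>x\<in>Y. op (h x))"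
  by (simp add: op_wedge pullback_sum wedge_sum_right)

lemma pm_simps: "subst_mp pm (T.uT l) = u l" "subst_mp pm (T.wT l) = w l"
  by (simp_all add: T.uT_def T.wT_def u_def pmap_def)

lemma LT_le: "l \<in> LT \<Longrightarrow> l \<le> d" by (auto simp: Lset_def)

lemma op_rels: "x \<in> rels T.TG \<Longrightarrow> op x \<in> rels G"
proof -
  assume x: "x \<in> rels T.TG"
  have "subst_mp pm h \<in> ideal G" if h: "h \<in> T.TG" for h
  proof -
    obtain l where l: "l \<in> LT" "h = T.wT l * T.uT l - 1"
      using h unfolding Tgens_def T.wT_def T.uT_def by blast
    then show ?thesis using uw[OF LT_le[OF l(1)]] by (simp add: pm_simps mult.commute)
  qed
  from pullback_rels[OF T.finTV T.TG_in this x] show ?thesis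
    unfolding op_wedge by (rule rels_wedge_left)
qed

text \<open>\<omega> is closed modulo relations, and on a form of degree \<open>card I\<close> the
  twist is multiplication by a sign.\<close>

lemma op_ext_d:
  assumes "is_form T.TV q x"
  shows "ext_d (op x) - cmul ((- 1) ^ card I) (op (ext_d x)) \<in> rels G"
proof -
  have "poly_in T.TV (x S)" for S using assms by (cases "x S = 0") (auto simp: is_form_def)
  then have 1: "ext_d (op x) = wedge (ext_d \<omega>) (pullback T.TV pm x) + wedge (twist \<omega>) (pullback T.TV pm (ext_d x))"
    by (simp add: op_wedge ext_d_wedge pullback_ext_d[OF T.finTV])
  have "twist \<omega> = cmul ((- 1) ^ card I) \<omega>"
    by (auto simp: omega_dterm twist_def dterm_def fun_eq_iff cmul_apply Const_power Const_uminus)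
  then have "ext_d (op x) - cmul ((- 1) ^ card I) (op (ext_d x)) = wedge (ext_d \<omega>) (pullback T.TV pm x)"
    by (simp only: 1) (simp add: op_wedge)
  then show ?thesis using omega_closed by (simp add: rels_wedge_right)
qed

lemma wset_pm:
  "finite M \<Longrightarrow> wset (\<lambda>v. dpoly (pm v)) ((\<lambda>l. 2 * l) ` M) = dterm M (\<Prod>l\<in>M. P l)"
proof (induction M rule: finite_linorder_min_induct)
  case empty
  then show ?case by (simp add: one_form_dterm)
next
  case (insert b A)
  have "b \<notin> A" using insert by auto
  have "2 * b < s" if "s \<in> (\<lambda>l. 2 * l) ` A" for s using insert that by auto
  then have "wset (\<lambda>v. dpoly (pm v)) ((\<lambda>l. 2 * l) ` insert b A) = wedge (dpoly (pm (2 * b))) (dterm A (\<Prod>l\<in>A. P l))"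
    using insert by (simp add: wset_insert_min)
  also have "dpoly (pm (2 * b)) = dterm {b} (P b)"
    by (simp add: pmap_def dpoly_Var_power P_def)
  also have "wedge (dterm {b} (P b)) (dterm A (\<Prod>l\<in>A. P l)) = dterm (insert b A) (\<Prod>l\<in>insert b A. P l)"
  proof -
    have "sgn_sets {b} A = 1" using insert by (intro sgn_sets_less) auto
    then show ?thesis using insert \<open>b \<notin> A\<close> by (simp add: wedge_dterm)
  qed
  finally show ?case .
qed

lemma subst_upow: "subst_mp pm (upow (T.uT l) (T.wT l) m) = upow (u l) (w l) m"
  by (simp add: upow_def pm_simps)

text \<open>On the torus \<open>u\<close> is a coordinate up to a constant and has derivative
  \<open>1\<close>; the factor \<open>P l\<close> comes from the pullback of \<open>dy_l\<close>,
  which is \<open>P l dx_l\<close>.\<close>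

lemma subst_F: "l \<in> LT \<Longrightarrow> subst_mp pm (T.F l \<sigma> \<rho>) * (if \<sigma> then P l else 1) = F l \<sigma> \<rho>"
  by (cases \<rho>) (auto simp: T.F_def F_def f_def g_def ufun_def udiff_def LT_eq subst_upow pm_simps)

text \<open>\<omega> supplies the factors at \<open>I\<close>, where \<open>r\<close> is
  \<open>None\<close>, and the pullback supplies those outside \<open>I\<close>. Only the shuffle
  sign of \<open>I\<close> and \<open>M\<close> remains.\<close>

lemma op_basis:
  assumes M: "M \<subseteq> LT" and r: "\<And>l. l \<notin> LT \<Longrightarrow> r l = None"
  shows "op (T.basis r M) = cmul (sgn_sets I M) (basis r (I \<union> M))"
proof -
  have fM: "finite M" using M T.finLT finite_subset by blast
  have fI: "finite I" using I_sub finL finite_subset by blast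
  have dis: "I \<inter> M = {}" using M by (auto simp: LT_eq)
  have "pullback T.TV pm (T.basis r M) = pmult (subst_mp pm (\<Prod>l\<in>LT. T.F l (l \<in> M) (r l))) (dterm M (\<Prod>l\<in>M. P l))"
    unfolding T.basis_def using M by (subst pullback_dterm[OF T.finTV]) (auto simp: Tvars_def wset_pm[OF fM])
  also have "\<dots> = dterm M (\<Prod>l\<in>LT. F l (l \<in> M) (r l))"
  proof -
    have "(\<Prod>l\<in>M. P l) = (\<Prod>l\<in>LT. if l \<in> M then P l else 1)"
      using M T.finLT by (simp add: prod.If_cases Int_absorb1)
    moreover have "(\<Prod>l\<in>LT. F l (l \<in> M) (r l)) = (\<Prod>l\<in>LT. subst_mp pm (T.F l (l \<in> M) (r l)) * (if l \<in> M then P l else 1))"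
      by (intro prod.cong refl) (rule subst_F[symmetric])
    ultimately show ?thesis by (simp add: subst_prod prod.distrib)
  qed
  finally have "op (T.basis r M) = dterm (I \<union> M) (Const (sgn_sets I M) * (\<Prod>k\<in>I. g k None) * (\<Prod>l\<in>LT. F l (l \<in> M) (r l)))"
    unfolding op_wedge omega_dterm by (simp add: wedge_dterm fI fM dis)
  moreover have "(\<Prod>l\<in>L. F l (l \<in> I \<union> M) (r l)) = (\<Prod>k\<in>I. g k None) * (\<Prod>l\<in>LT. F l (l \<in> M) (r l))"
  proof -
    have "(\<Prod>l\<in>L. F l (l \<in> I \<union> M) (r l)) = (\<Prod>l\<in>L - I. F l (l \<in> I \<union> M) (r l)) * (\<Prod>l\<in>I. F l (l \<in> I \<union> M) (r l))"
      by (rule prod.subset_diff[OF I_sub finL])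
    moreover have "(\<Prod>l\<in>I. F l (l \<in> I \<union> M) (r l)) = (\<Prod>k\<in>I. g k None)"
      using r by (intro prod.cong) (auto simp: F_def LT_eq)
    moreover have "(\<Prod>l\<in>L - I. F l (l \<in> I \<union> M) (r l)) = (\<Prod>l\<in>LT. F l (l \<in> M) (r l))"
      by (intro prod.cong) (auto simp: LT_eq)
    ultimately show ?thesis by (simp add: mult.commute)
  qed
  ultimately show ?thesis by (simp add: basis_def mult.assoc)
qed

lemma T_R_sub: "r \<in> T.R \<Longrightarrow> r \<in> R \<and> (\<forall>l. l \<notin> LT \<longrightarrow> r l = None)"
  unfolding T.R_def R_def ok_def T.ok_def using LT_eq by auto

text \<open>The map \<open>op\<close> sends relations to relations and distinct basis forms to
  distinct basis forms of the variety, up to sign; a dependence on the torus would therefore give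
  one on the variety.\<close>

lemma indep_T: T.indep
  unfolding T.indep_def
proof (intro allI impI ballI)
  fix X c r0 M
  assume X: "finite X" "X \<subseteq> T.R" and rel: "T.B X c \<in> rels T.TG" and r0: "r0 \<in> X" and M: "M \<subseteq> LT"
  \<comment> \<open>The coefficients of the image: only sets containing \<open>I\<close> occur, and
    removing \<open>I\<close> recovers the torus index.\<close>
  define c' where "c' r S = (if I \<subseteq> S then sgn_sets I (S - I) * c r (S - I) else 0)" for r S
  have "op (T.B X c) = B X c'"
    unfolding T.B_def B_def op_sum
  proof (rule sum.cong[OF refl])
    fix r assume "r \<in> X"
    then have r: "\<And>l. l \<notin> LT \<Longrightarrow> r l = None" using X T_R_sub by blast
    have "(\<Sum>S\<in>Pow LT. op (cmul (c r S) (T.basis r S))) = (\<Sum>S\<in>Pow LT. cmul (c' r (I \<union> S)) (basis r (I \<union> S)))"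
    proof (rule sum.cong[OF refl])
      fix S assume "S \<in> Pow LT"
      then have S: "S \<subseteq> LT" by auto
      then have "I \<union> S - I = S" by (auto simp: LT_eq)
      moreover have "op (T.basis r S) = cmul (sgn_sets I S) (basis r (I \<union> S))" by (rule op_basis[OF S]) (rule r)
      ultimately show "op (cmul (c r S) (T.basis r S)) = cmul (c' r (I \<union> S)) (basis r (I \<union> S))"
        by (simp add: op_simps c'_def cmul_simps mult.commute)
    qed
    also have "\<dots> = (\<Sum>S\<in>(\<lambda>S. I \<union> S) ` Pow LT. cmul (c' r S) (basis r S))"
      by (subst sum.reindex) (auto simp: inj_on_def LT_eq)
    also have "\<dots> = (\<Sum>S\<in>Pow L. cmul (c' r S) (basis r S))"
    proof (rule sum.mono_neutral_left)
      show "(\<union>) I ` Pow LT \<subseteq> Pow L" using I_sub by (auto simp: LT_eq)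
      show "\<forall>S\<in>Pow L - (\<union>) I ` Pow LT. cmul (c' r S) (basis r S) = 0"
      proof
        fix S assume S: "S \<in> Pow L - (\<union>) I ` Pow LT"
        have "\<not> I \<subseteq> S"
        proof
          assume "I \<subseteq> S"
          then have "S = I \<union> (S - I)" "S - I \<in> Pow LT" using S by (auto simp: LT_eq)
          then show False using S by blast
        qed
        then show "cmul (c' r S) (basis r S) = 0" by (simp add: c'_def cmul_simps)
      qed
    qed (simp add: finL)
    finally show "(\<Sum>S\<in>Pow LT. op (cmul (c r S) (T.basis r S))) = (\<Sum>S\<in>Pow L. cmul (c' r S) (basis r S))" .
  qed
  then have "B X c' \<in> rels G" using op_rels[OF rel] by simp
  moreover have "X \<subseteq> R" using X T_R_sub by blast
  moreover have "I \<union> M \<subseteq> L" "allowed r0 (I \<union> M)" using M I_sub by (auto simp: LT_eq allowed_def)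
  ultimately have "c' r0 (I \<union> M) = 0" using indepD[OF indep_U X(1)] r0 by blast
  moreover have "I \<union> M - I = M" using M by (auto simp: LT_eq)
  ultimately show "c r0 M = 0" by (simp add: c'_def)
qed

end

section \<open>Weights of the torus action\<close>

text \<open>\<open>dx_k\<close> counts like \<open>x_k\<close>. So the differential preserves the
  weight, and the group acts on such a term by the character \<open>a\<close>
  (\<open>act_factor\<close>).\<close>

definition weight :: "nat \<Rightarrow> (nat \<Rightarrow> nat) \<Rightarrow> (nat \<Rightarrow> nat) \<Rightarrow> term_pred" where
  "weight d n a m S \<longleftrightarrow> (\<forall>k\<le>d. (lk m k + of_bool (k \<in> S)) mod n k = a k mod n k)"

definition wform :: "nat \<Rightarrow> (nat \<Rightarrow> nat) \<Rightarrow> (nat \<Rightarrow> nat) \<Rightarrow> nat \<Rightarrow> term_pred" where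
  "wform d n a q m S \<longleftrightarrow> formQ {..d} q m S \<and> weight d n a m S"

definition wform' :: "nat \<Rightarrow> (nat \<Rightarrow> nat) \<Rightarrow> (nat \<Rightarrow> nat) \<Rightarrow> nat \<Rightarrow> term_pred" where
  "wform' d n a q m S \<longleftrightarrow> formQ' {..d} q m S \<and> weight d n a m S"

definition wpoly :: "nat \<Rightarrow> (nat \<Rightarrow> nat) \<Rightarrow> (nat \<Rightarrow> nat) \<Rightarrow> mpoly \<Rightarrow> bool" where
  "wpoly d n a = psupp_in (\<lambda>m. ky m \<subseteq> {..d} \<and> (\<forall>k\<le>d. lk m k mod n k = a k mod n k))"

lemma wpoly_mult:
  assumes "wpoly d n a p" "wpoly d n b q" shows "wpoly d n (\<lambda>k. a k + b k) (p * q)"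
  unfolding wpoly_def
  by (rule psupp_in_mult[OF assms[unfolded wpoly_def]]) (auto simp: keys_add_nat lookup_add intro: mod_add_cong)

lemma wpoly_add: "wpoly d n a p \<Longrightarrow> wpoly d n a q \<Longrightarrow> wpoly d n a (p + q)"
  unfolding wpoly_def by (rule psupp_in_add)

lemma wpoly_diff: "wpoly d n a p \<Longrightarrow> wpoly d n a q \<Longrightarrow> wpoly d n a (p - q)"
  unfolding wpoly_def by (rule psupp_in_diff)

lemma wpoly_cong: "wpoly d n a p \<Longrightarrow> (\<And>k. k \<le> d \<Longrightarrow> a k mod n k = b k mod n k) \<Longrightarrow> wpoly d n b p"
  by (auto simp: wpoly_def psupp_in_def)

lemma wpoly_Const: "wpoly d n (\<lambda>_. 0) (Const c)"
  by (auto simp: wpoly_def psupp_in_def Const_def split: if_splits)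

lemma wpoly_1: "wpoly d n (\<lambda>_. 0) 1"
  using wpoly_Const[of d n 1] by simp

lemma wpoly_Const_mult: "wpoly d n a p \<Longrightarrow> wpoly d n a (Const c * p)"
  unfolding wpoly_def by (rule psupp_in_Const_mult)

lemma wpoly_Var_power: "k \<le> d \<Longrightarrow> wpoly d n (\<lambda>l. if l = k then e else 0) (Var k ^ e)"
proof (induction e)
  case 0
  then show ?case using wpoly_1 by (simp add: if_distrib cong: if_cong)
next
  case (Suc e)
  have "wpoly d n (\<lambda>l. if l = k then 1 else 0) (Var k)"
    using Suc by (auto simp: wpoly_def psupp_in_def Var_def lookup_single when_def)
  from wpoly_mult[OF this Suc.IH] Suc.prems show ?case
    by (auto elim!: wpoly_cong)
qed

lemma wpoly_prod:
  "finite A \<Longrightarrow> (\<And>x. x \<in> A \<Longrightarrow> wpoly d n (a x) (h x)) \<Longrightarrow> wpoly d n (\<lambda>k. \<Sum>x\<in>A. a x k) (\<Prod>x\<in>A. h x)"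
  by (induction A rule: finite_induct) (auto simp: wpoly_1 intro: wpoly_mult)

text \<open>Weight zero defines a subring containing the \<open>x_k^n_k\<close>, hence also the
  equation and the inverses \<open>uinv\<close>. This makes the relations homogeneous and puts every
  pullback from the torus in weight zero.\<close>

lemma gp0_mult: "wpoly d n (\<lambda>_. 0) p \<Longrightarrow> wpoly d n (\<lambda>_. 0) q \<Longrightarrow> wpoly d n (\<lambda>_. 0) (p * q)"
  using wpoly_mult[of d n "\<lambda>_. 0" p "\<lambda>_. 0" q] by simp

lemma gp0_prod: "finite A \<Longrightarrow> (\<And>x. x \<in> A \<Longrightarrow> wpoly d n (\<lambda>_. 0) (h x)) \<Longrightarrow> wpoly d n (\<lambda>_. 0) (\<Prod>x\<in>A. h x)"
  using wpoly_prod[of A d n "\<lambda>_ _. 0" h] by simp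

lemma gp0_y: "k \<le> d \<Longrightarrow> wpoly d n (\<lambda>_. 0) (Var k ^ n k)"
  by (rule wpoly_cong[OF wpoly_Var_power]) auto

lemma gp0_uinv: "wpoly d n (\<lambda>_. 0) (uinv d n \<alpha> k)"
proof -
  have "wpoly d n (\<lambda>_. 0) (\<Prod>l\<in>{..d} - {k}. 1 - Var l ^ n l)"
    by (intro gp0_prod wpoly_diff wpoly_1 gp0_y) auto
  from wpoly_Const_mult[OF this, of "- (1 / \<alpha>)"] show ?thesis
    by (simp add: uinv_def Const_uminus mult.commute)
qed

lemma gp0_Ueq: "wpoly d n (\<lambda>_. 0) (Ueq d n \<alpha>)"
  unfolding Ueq_def by (intro wpoly_diff gp0_prod wpoly_1 gp0_y wpoly_Const) auto

lemma poly_in_Ueq: "poly_in {..d} (Ueq d n \<alpha>)"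
  using gp0_Ueq[of d n \<alpha>] by (auto simp: wpoly_def psupp_in_def poly_in_def)

lemma gp0_subst:
  assumes "poly_in W p" "\<And>v. v \<in> W \<Longrightarrow> wpoly d n (\<lambda>_. 0) (\<phi> v)" shows "wpoly d n (\<lambda>_. 0) (subst_mp \<phi> p)"
  using assms(1) by (induction p rule: poly_in_induct) (auto intro: assms(2) wpoly_Const wpoly_add gp0_mult)

lemma weight_add: "(\<And>k. k \<le> d \<Longrightarrow> lk m0 k mod n k = 0) \<Longrightarrow> weight d n a (m0 + m) S = weight d n a m S"
proof -
  assume *: "\<And>k. k \<le> d \<Longrightarrow> lk m0 k mod n k = 0"
  have "(lk (m0 + m) k + of_bool (k \<in> S)) mod n k = (lk m k + of_bool (k \<in> S)) mod n k" if "k \<le> d" for k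
  proof -
    from *[OF \<open>k \<le> d\<close>] obtain t where "lk m0 k = n k * t" by (auto simp: mod_eq_0_iff_dvd dvd_def)
    then show ?thesis by (simp add: lookup_add add.assoc)
  qed
  then show ?thesis by (simp add: weight_def)
qed

lemma mult_invariant_wform: "wpoly d n (\<lambda>_. 0) p \<Longrightarrow> mult_invariant (wform d n a q) p \<and> mult_invariant (wform' d n a q) p"
  unfolding mult_invariant_def wform_def wform'_def wpoly_def psupp_in_def
  by (auto simp: weight_add formQ_def formQ'_def keys_add_nat)

lemma d_compatible_wform: "d_compatible (wform d n a q) (wform' d n a q)"
  unfolding d_compatible_def wform_def wform'_def
proof (intro allI impI)
  fix m :: "nat \<Rightarrow>\<^sub>0 nat" and S :: "nat set" and k assume "finite S" "k \<notin> S"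
  then have "formQ {..d} q m (insert k S) = formQ' {..d} q (m + sg k 1) S"
    using d_compatible_formQ by (auto simp: d_compatible_def)
  moreover have "lk m l + of_bool (l \<in> insert k S) = lk (m + sg k 1) l + of_bool (l \<in> S)" for l
    using \<open>k \<notin> S\<close> by (cases "l = k") (simp_all add: lookup_add lookup_single when_def)
  then have "weight d n a m (insert k S) = weight d n a (m + sg k 1) S"
    by (simp only: weight_def)
  ultimately show "(formQ {..d} q m (insert k S) \<and> weight d n a m (insert k S)) = (formQ' {..d} q (m + sg k 1) S \<and> weight d n a (m + sg k 1) S)"
    by simp
qed

lemma wform'_Suc: "wform' d n a (Suc q) = wform d n a q"
  by (auto simp: fun_eq_iff wform_def wform'_def formQ_def formQ'_def finite_subset)

lemma supp_in_wform_is_form: "supp_in (wform d n a q) \<eta> \<Longrightarrow> is_form {..d} q \<eta>"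
  unfolding is_form_supp_in by (erule supp_in_mono) (simp add: wform_def)

lemma supp_in_pmult_wpoly:
  assumes "wpoly d n (\<lambda>_. 0) p" "supp_in (wform d n a q) \<eta>" shows "supp_in (wform d n a q) (pmult p \<eta>)"
  unfolding supp_in_psupp_in pmult_apply
proof
  fix S
  have "psupp_in (\<lambda>m. wform d n a q m S) (\<eta> S)" using assms(2) by (simp add: supp_in_psupp_in)
  with assms(1) show "psupp_in (\<lambda>m. wform d n a q m S) (p * \<eta> S)"
    unfolding wpoly_def by (rule psupp_in_mult) (auto simp: wform_def weight_add formQ_def keys_add_nat)
qed

lemma supp_in_dterm_wpoly:
  assumes "wpoly d n b p" "S \<subseteq> {..d}" "\<And>k. k \<le> d \<Longrightarrow> (b k + of_bool (k \<in> S)) mod n k = a k mod n k"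
  shows "supp_in (wform d n a (card S)) (dterm S p)"
  unfolding supp_in_dterm psupp_in_def
proof
  fix m assume "m \<in> ky p"
  then have m: "ky m \<subseteq> {..d}" "\<And>k. k \<le> d \<Longrightarrow> lk m k mod n k = b k mod n k" using assms(1) by (auto simp: wpoly_def psupp_in_def)
  have "(lk m k + of_bool (k \<in> S)) mod n k = a k mod n k" if "k \<le> d" for k
    using m(2)[OF that] assms(3)[OF that] by (metis mod_add_left_eq)
  then show "wform d n a (card S) m S" using m assms(2) by (simp add: wform_def formQ_def weight_def)
qed

lemma supp_in_wedge_wform:
  assumes "supp_in (wform d n a q) x" "supp_in (wform d n b r) y"
  shows "supp_in (wform d n (\<lambda>k. a k + b k) (q + r)) (wedge x y)"
proof (rule supp_in_wedge[OF assms])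
  fix m m' S T
  assume *: "wform d n a q m S" "wform d n b r m' T" "finite S" "finite T" "S \<inter> T = {}"
  have "weight d n (\<lambda>k. a k + b k) (m + m') (S \<union> T)"
    unfolding weight_def
  proof (intro allI impI)
    fix k assume "k \<le> d"
    then have "(lk m k + of_bool (k \<in> S) + (lk m' k + of_bool (k \<in> T))) mod n k = (a k + b k) mod n k"
      using * by (intro mod_add_cong) (auto simp: wform_def weight_def)
    moreover have "lk (m + m') k + of_bool (k \<in> S \<union> T) = lk m k + of_bool (k \<in> S) + (lk m' k + of_bool (k \<in> T))"
      using *(5) by (auto simp: lookup_add)
    ultimately show "(lk (m + m') k + of_bool (k \<in> S \<union> T)) mod n k = (a k + b k) mod n k" by simp
  qed
  then show "wform d n (\<lambda>k. a k + b k) (q + r) (m + m') (S \<union> T)"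
    using * by (auto simp: wform_def formQ_def keys_add_nat card_Un_disjoint)
qed

lemma dpoly_ext_d: "dpoly p = ext_d (dterm {} p)"
proof -
  have "wedge (dpoly p) one_form = dpoly p" by (rule wedge_one_right) simp
  then show ?thesis by (simp add: ext_d_dterm one_form_dterm)
qed

lemma supp_in_dpoly: "wpoly d n (\<lambda>_. 0) p \<Longrightarrow> supp_in (wform d n (\<lambda>_. 0) 1) (dpoly p)"
proof -
  assume "wpoly d n (\<lambda>_. 0) p"
  then have "supp_in (wform d n (\<lambda>_. 0) (card ({}::nat set))) (dterm {} p)" by (rule supp_in_dterm_wpoly[where b = "\<lambda>_. 0"]) auto
  then have "supp_in (wform' d n (\<lambda>_. 0) 1) (dterm {} p)" by (simp add: wform'_Suc)
  from supp_in_ext_d[OF d_compatible_wform this] show ?thesis by (simp add: dpoly_ext_d)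
qed

lemma supp_in_wset:
  "finite S \<Longrightarrow> (\<And>v. v \<in> S \<Longrightarrow> supp_in (wform d n (\<lambda>_. 0) 1) (w v)) \<Longrightarrow> supp_in (wform d n (\<lambda>_. 0) (card S)) (wset w S)"
proof (induction S rule: finite_linorder_min_induct)
  case empty
  have "supp_in (wform d n (\<lambda>_. 0) (card ({}::nat set))) (dterm {} 1)" by (rule supp_in_dterm_wpoly[where b = "\<lambda>_. 0", OF wpoly_1]) auto
  then show ?case by (simp add: one_form_dterm)
next
  case (insert b A)
  have "b \<notin> A" using insert by auto
  then show ?case using insert supp_in_wedge_wform[of d n "\<lambda>_. 0" 1 "w b" "\<lambda>_. 0" "card A" "wset w A"]
    by (simp add: wset_insert_min)
qed

lemma supp_in_pullback:
  assumes "finite W" "is_form W q x" "\<And>v. v \<in> W \<Longrightarrow> wpoly d n (\<lambda>_. 0) (\<phi> v)"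
  shows "supp_in (wform d n (\<lambda>_. 0) q) (pullback W \<phi> x)"
  unfolding pullback_wset
proof (rule supp_in_sum)
  fix S assume "S \<in> Pow W"
  then have S: "S \<subseteq> W" "finite S" using assms(1) finite_subset by auto
  show "supp_in (wform d n (\<lambda>_. 0) q) (pmult (subst_mp \<phi> (x S)) (wset (\<lambda>v. dpoly (\<phi> v)) S))"
  proof (cases "x S = 0")
    case False
    then have "card S = q" "poly_in W (x S)" using assms(2) by (auto simp: is_form_def)
    moreover have "supp_in (wform d n (\<lambda>_. 0) (card S)) (wset (\<lambda>v. dpoly (\<phi> v)) S)"
      using S assms(3) by (intro supp_in_wset supp_in_dpoly) auto
    ultimately show ?thesis using assms(3) by (auto intro!: supp_in_pmult_wpoly gp0_subst)
  qed (simp add: pmult_simps)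
qed

lemma mu_power_mod: "z \<in> mu N \<Longrightarrow> z ^ e = z ^ (e mod N)"
proof -
  assume "z \<in> mu N"
  then have "z ^ N = 1" by (simp add: mu_def)
  have "z ^ e = z ^ (N * (e div N) + e mod N)" by simp
  also have "\<dots> = z ^ (e mod N)" unfolding power_add power_mult using \<open>z ^ N = 1\<close> by simp
  finally show ?thesis .
qed

lemma lookup_act_form:
  "lk (act_form \<nu> \<eta> S) m = (\<Prod>k\<in>S. \<nu> k) * (\<Prod>k\<in>ky m. \<nu> k ^ lk m k) * lk (\<eta> S) m"
proof -
  have "finite {m. (\<Prod>k\<in>ky m. \<nu> k ^ lk m k) * lk (\<eta> S) m \<noteq> 0}"
    by (rule finite_subset[of _ "ky (\<eta> S)"]) (auto simp: in_keys_iff)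
  then show ?thesis by (simp add: act_form_def act_poly_def mult.assoc)
qed

text \<open>Each \<nu> \<open>k\<close> is a root of unity of order dividing \<open>n k\<close>, so
  only the exponent modulo \<open>n k\<close> matters, with \<open>dx_k\<close> contributing one
  more factor.\<close>

lemma act_factor:
  assumes "wform d n a q m S" "\<And>k. k \<le> d \<Longrightarrow> \<nu> k \<in> mu (n k)"
  shows "(\<Prod>k\<in>S. \<nu> k) * (\<Prod>k\<in>ky m. \<nu> k ^ lk m k) = chi d a \<nu>"
proof -
  have S: "S \<subseteq> {..d}" and m: "ky m \<subseteq> {..d}" and w: "\<And>k. k \<le> d \<Longrightarrow> (lk m k + of_bool (k \<in> S)) mod n k = a k mod n k"
    using assms(1) by (auto simp: wform_def formQ_def weight_def)
  have "(\<Prod>k\<in>S. \<nu> k) = (\<Prod>k\<le>d. \<nu> k ^ of_bool (k \<in> S))"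
    using S by (intro prod.mono_neutral_cong_left) auto
  moreover have "(\<Prod>k\<in>ky m. \<nu> k ^ lk m k) = (\<Prod>k\<le>d. \<nu> k ^ lk m k)"
    using m by (intro prod.mono_neutral_cong_left) (auto simp: in_keys_iff)
  ultimately have "(\<Prod>k\<in>S. \<nu> k) * (\<Prod>k\<in>ky m. \<nu> k ^ lk m k) = (\<Prod>k\<le>d. \<nu> k ^ (lk m k + of_bool (k \<in> S)))"
    by (simp add: power_add prod.distrib mult.commute)
  also have "\<dots> = (\<Prod>k\<le>d. \<nu> k ^ a k)"
  proof (rule prod.cong[OF refl])
    fix k assume "k \<in> {..d}"
    then have "\<nu> k \<in> mu (n k)" "(lk m k + of_bool (k \<in> S)) mod n k = a k mod n k" using assms(2) w by auto
    then show "\<nu> k ^ (lk m k + of_bool (k \<in> S)) = \<nu> k ^ a k" by (metis mu_power_mod)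
  qed
  finally show ?thesis by (simp add: chi_def)
qed

lemma filt_act_form:
  assumes "\<And>k. k \<le> d \<Longrightarrow> \<nu> k \<in> mu (n k)"
  shows "filt (wform d n a q) (act_form \<nu> \<eta>) = cmul (chi d a \<nu>) (filt (wform d n a q) \<eta>)"
proof
  fix S
  show "filt (wform d n a q) (act_form \<nu> \<eta>) S = cmul (chi d a \<nu>) (filt (wform d n a q) \<eta>) S"
    unfolding filt_def cmul_apply
    by (rule poly_mapping_eqI) (auto simp: lookup_restr lookup_act_form act_factor[OF _ assms])
qed

lemma act_form_supp_in:
  assumes "supp_in (wform d n a q) \<eta>" "\<And>k. k \<le> d \<Longrightarrow> \<nu> k \<in> mu (n k)"
  shows "act_form \<nu> \<eta> = cmul (chi d a \<nu>) \<eta>"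
proof
  fix S
  show "act_form \<nu> \<eta> S = cmul (chi d a \<nu>) \<eta> S"
  proof (rule poly_mapping_eqI)
    fix m show "lk (act_form \<nu> \<eta> S) m = lk (cmul (chi d a \<nu>) \<eta> S) m"
    proof (cases "m \<in> ky (\<eta> S)")
      case True
      then have "wform d n a q m S" using assms(1) by (auto simp: supp_in_def)
      then show ?thesis by (simp add: lookup_act_form cmul_apply act_factor[OF _ assms(2)])
    next
      case False
      then show ?thesis by (simp add: lookup_act_form cmul_apply in_keys_iff)
    qed
  qed
qed

text \<open>One representative for each character of the group; the value zero beyond
  \<open>d\<close> makes representatives unique and the set finite.\<close>

definition Box :: "nat \<Rightarrow> (nat \<Rightarrow> nat) \<Rightarrow> (nat \<Rightarrow> nat) set" where
  "Box d n = {a. (\<forall>k\<le>d. a k < n k) \<and> (\<forall>k>d. a k = 0)}"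

lemma finite_Box: "finite (Box d n)"
proof (rule finite_subset)
  have "n k \<le> (\<Sum>k\<le>d. n k)" if "k \<le> d" for k using that by (intro member_le_sum) auto
  then show "Box d n \<subseteq> {a. \<forall>k. (k \<in> {..d} \<longrightarrow> a k \<in> {..\<Sum>k\<le>d. n k}) \<and> (k \<notin> {..d} \<longrightarrow> a k = 0)}"
    by (force simp: Box_def)
  show "finite {a. \<forall>k. (k \<in> {..d} \<longrightarrow> a k \<in> {..\<Sum>k\<le>d. n k}) \<and> (k \<notin> {..d} \<longrightarrow> a k = (0::nat))}"
    by (rule finite_set_of_finite_funs) auto
qed

lemma Qset_Box: "Qset d n \<subseteq> Box d n"
  by (auto simp: Qset_def Box_def)

text \<open>The residues of the exponents of a term single out exactly one element of
  \<open>Box\<close>, so every term occurs in exactly one summand.\<close>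

lemma sum_filt_Box:
  assumes "is_form {..d} q \<eta>" "\<And>k. k \<le> d \<Longrightarrow> 1 \<le> n k"
  shows "(\<Sum>a\<in>Box d n. filt (wform d n a q) \<eta>) = \<eta>"
proof
  fix S
  show "(\<Sum>a\<in>Box d n. filt (wform d n a q) \<eta>) S = \<eta> S"
  proof (rule poly_mapping_eqI)
    fix m
    have "lk ((\<Sum>a\<in>Box d n. filt (wform d n a q) \<eta>) S) m = (\<Sum>a\<in>Box d n. if wform d n a q m S then lk (\<eta> S) m else 0)"
      unfolding form_apply by (simp add: lookup_sum filt_def lookup_restr)
    also have "\<dots> = lk (\<eta> S) m"
    proof (cases "m \<in> ky (\<eta> S)")
      case True
      then have fq: "formQ {..d} q m S" using assms(1) by (auto simp: is_form_supp_in supp_in_def)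
      define b where "b k = (if k \<le> d then (lk m k + of_bool (k \<in> S)) mod n k else 0)" for k
      have "(lk m k + of_bool (k \<in> S)) mod n k < n k" if "k \<le> d" for k
        using assms(2)[OF that] by (intro mod_less_divisor) simp
      then have bB: "b \<in> Box d n" by (simp add: Box_def b_def)
      have "wform d n a q m S \<longleftrightarrow> a = b" if "a \<in> Box d n" for a
      proof
        assume "wform d n a q m S"
        then have "b k = a k" for k
          using that by (cases "k \<le> d") (auto simp: wform_def weight_def b_def Box_def)
        then show "a = b" by auto
      next
        assume "a = b"
        then show "wform d n a q m S" using fq by (auto simp: wform_def weight_def b_def)
      qed
      then have "(\<Sum>a\<in>Box d n. if wform d n a q m S then lk (\<eta> S) m else 0) = (\<Sum>a\<in>Box d n. if a = b then lk (\<eta> S) m else 0)"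
        by (intro sum.cong) auto
      then show ?thesis using bB finite_Box by simp
    next
      case False
      then have "lk (\<eta> S) m = 0" by (simp add: in_keys_iff)
      then show ?thesis by (simp only: if_cancel sum.neutral_const)
    qed
    finally show "lk ((\<Sum>a\<in>Box d n. filt (wform d n a q) \<eta>) S) m = lk (\<eta> S) m" .
  qed
qed

lemma prim_root:
  assumes "0 < N" "a < N" "b < N" "a \<noteq> b"
  shows "cis (2 * pi / real N) \<in> mu N" "cis (2 * pi / real N) ^ a \<noteq> cis (2 * pi / real N) ^ b"
proof -
  have pw: "cis (2 * pi / real N) ^ k = cis (2 * pi * real k / real N)" for k
    by (simp add: DeMoivre ac_simps)
  show "cis (2 * pi / real N) \<in> mu N" using assms(1) by (simp add: mu_def pw)
  have "inj_on (\<lambda>k. cis (2 * pi * real k / real N)) {..<N}"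
    using bij_betw_roots_unity[of N] assms(1) by (auto simp: bij_betw_def)
  then show "cis (2 * pi / real N) ^ a \<noteq> cis (2 * pi / real N) ^ b"
    unfolding pw using assms by (auto simp: inj_on_def)
qed

text \<open>A primitive root of unity at one coordinate where \<open>a\<close> and \<open>b\<close>
  differ, and \<open>1\<close> at all others.\<close>

lemma chi_separates:
  assumes "a \<in> Box d n" "b \<in> Box d n" "a \<noteq> b"
  shows "\<exists>\<nu>. (\<forall>k\<le>d. \<nu> k \<in> mu (n k)) \<and> chi d a \<nu> \<noteq> chi d b \<nu>"
proof -
  obtain k where k: "a k \<noteq> b k" using assms(3) by auto
  have kd: "k \<le> d" using assms(1,2) k by (cases "k \<le> d") (auto simp: Box_def)
  have lt: "a k < n k" "b k < n k" using assms kd by (auto simp: Box_def)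
  define \<nu> where "\<nu> l = (if l = k then cis (2 * pi / real (n k)) else 1)" for l
  have "chi d c \<nu> = cis (2 * pi / real (n k)) ^ c k" for c
  proof -
    have "chi d c \<nu> = (\<Prod>l\<le>d. if l = k then cis (2 * pi / real (n k)) ^ c k else 1)"
      unfolding chi_def by (intro prod.cong) (auto simp: \<nu>_def)
    then show ?thesis using kd by simp
  qed
  moreover have "\<forall>l\<le>d. \<nu> l \<in> mu (n l)" using prim_root(1)[of "n k" "a k" "b k"] lt k by (auto simp: \<nu>_def mu_def)
  ultimately show ?thesis using prim_root(2)[of "n k" "a k" "b k"] lt k by (intro exI[of _ \<nu>]) auto
qed

lemma HU_closed_iff: "\<eta> \<in> HU_closed d n \<alpha> j \<longleftrightarrow> is_form {..d} j \<eta> \<and> ext_d \<eta> \<in> rels {Ueq d n \<alpha>}"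
  unfolding HU_closed_def Uvars_def by (rule closed_forms_iff) (auto simp: poly_in_Ueq)

lemma HU_exact_iff: "\<eta> \<in> HU_exact d n \<alpha> j \<longleftrightarrow> is_form {..d} j \<eta> \<and> \<eta> \<in> exacts {Ueq d n \<alpha>}"
  unfolding HU_exact_def Uvars_def by (rule exact_forms_iff) (auto simp: poly_in_Ueq)

lemma eig_closedI:
  assumes "supp_in (wform d n i j) \<eta>" "ext_d \<eta> \<in> rels {Ueq d n \<alpha>}"
  shows "\<eta> \<in> eig_closed d n \<alpha> i j"
  using assms unfolding eig_closed_def
  by (auto simp: HU_closed_iff HU_exact_iff act_form_supp_in supp_in_wform_is_form)

lemma filt_wform_exacts: "\<eta> \<in> exacts {Ueq d n \<alpha>} \<Longrightarrow> filt (wform d n a q) \<eta> \<in> exacts {Ueq d n \<alpha>}"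
  by (rule filt_exacts[OF _ d_compatible_wform]) (use mult_invariant_wform[OF gp0_Ueq] in auto)

text \<open>The weight components other than the \<open>i\<close>-th are exact, since some group element acts on them by
  a scalar different from \<open>chi d i \<nu>\<close>.\<close>

lemma eig_reduce:
  assumes \<eta>: "\<eta> \<in> eig_closed d n \<alpha> i j" and n: "\<And>k. k \<le> d \<Longrightarrow> 1 \<le> n k" and i: "i \<in> Box d n"
  shows "\<eta> - filt (wform d n i j) \<eta> \<in> exacts {Ueq d n \<alpha>}" "ext_d (filt (wform d n i j) \<eta>) \<in> rels {Ueq d n \<alpha>}"
proof -
  let ?G = "{Ueq d n \<alpha>}"
  have form: "is_form {..d} j \<eta>" and cl: "ext_d \<eta> \<in> rels ?G"
    and act: "\<And>\<nu>. (\<forall>k\<le>d. \<nu> k \<in> mu (n k)) \<Longrightarrow> act_form \<nu> \<eta> - cmul (chi d i \<nu>) \<eta> \<in> exacts ?G"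
    using \<eta> by (auto simp: eig_closed_def HU_closed_iff HU_exact_iff)
  have "filt (wform d n i (Suc j)) (ext_d \<eta>) \<in> rels ?G"
    by (rule filt_rels[OF _ d_compatible_wform cl]) (use mult_invariant_wform[OF gp0_Ueq] in auto)
  then show "ext_d (filt (wform d n i j) \<eta>) \<in> rels ?G" by (simp add: filt_ext_d[OF d_compatible_wform] wform'_Suc)
  have z: "filt (wform d n a j) \<eta> \<in> exacts ?G" if a: "a \<in> Box d n" "a \<noteq> i" for a
  proof -
    obtain \<nu> where \<nu>: "\<forall>k\<le>d. \<nu> k \<in> mu (n k)" "chi d a \<nu> \<noteq> chi d i \<nu>"
      using chi_separates[OF a(1) i a(2)] by blast
    have "filt (wform d n a j) (act_form \<nu> \<eta> - cmul (chi d i \<nu>) \<eta>) \<in> exacts ?G"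
      by (rule filt_wform_exacts[OF act[OF \<nu>(1)]])
    then have "cmul (chi d a \<nu> - chi d i \<nu>) (filt (wform d n a j) \<eta>) \<in> exacts ?G"
      using \<nu>(1) by (simp add: filt_simps filt_act_form cmul_simps)
    from exacts_cmul[OF this, of "1 / (chi d a \<nu> - chi d i \<nu>)"] show ?thesis
      using \<nu>(2) by (simp only: cmul_simps(8)) (simp add: cmul_simps(7))
  qed
  have "\<eta> - filt (wform d n i j) \<eta> = (\<Sum>a\<in>Box d n. filt (wform d n a j) \<eta>) - filt (wform d n i j) \<eta>"
    by (simp add: sum_filt_Box[OF form n])
  also have "\<dots> = (\<Sum>a\<in>Box d n - {i}. filt (wform d n a j) \<eta>)"
    using finite_Box[of d n] i by (simp add: sum.remove)
  also have "\<dots> \<in> exacts ?G" by (intro exacts_sum z) auto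
  finally show "\<eta> - filt (wform d n i j) \<eta> \<in> exacts ?G" .
qed

section \<open>Eigenspaces of the cohomology\<close>

context usetup
begin

lemma basis_N: "I \<subseteq> S \<Longrightarrow> S \<subseteq> L \<Longrightarrow> basis N S = dterm S (\<Prod>l\<in>S. g l None)"
proof -
  assume S: "I \<subseteq> S" "S \<subseteq> L"
  have "(\<Prod>l\<in>L - S. f l None) = 1" using S by (intro prod.neutral) (auto simp: f_def ufun_def)
  then show ?thesis using prod_F[OF S(2), of N] by (simp add: basis_def)
qed

lemma wpoly_g_None:
  assumes "l \<le> d" shows "wpoly d n (\<lambda>k. if k = l then (if l \<in> I then i l - 1 else n l - 1) else 0) (g l None)"
proof -
  have w: "wpoly d n (\<lambda>k. (if k = l then e else 0) + 0) (Var l ^ e * w l)" for e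
    by (rule wpoly_mult[OF wpoly_Var_power[OF assms] gp0_uinv])
  have "g l None = (if l \<in> I then Var l ^ (i l - 1) * w l else Const (of_nat (n l)) * (Var l ^ (n l - 1) * w l))"
    by (simp add: g_def tdiff_def udiff_def P_def Const_of_nat mult.assoc)
  then show ?thesis using w[of "i l - 1"] wpoly_Const_mult[OF w[of "n l - 1"]] by auto
qed

text \<open>The block \<open>x^(i-1) dx\<close> has weight \<open>i\<close>, the block
  \<open>x^(n-1) dx\<close> has weight zero, and the inverse \<open>w\<close> has weight
  zero.\<close>

lemma basis_supp_in:
  assumes S: "I \<subseteq> S" "S \<subseteq> L" shows "supp_in (wform d n i (card S)) (basis N S)"
proof -
  let ?e = "\<lambda>l. if l \<in> I then i l - 1 else n l - 1"
  have fS: "finite S" using S finL finite_subset by blast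
  have Sd: "S \<subseteq> {..d}" using S L_le by auto
  have "wpoly d n (\<lambda>k. \<Sum>l\<in>S. if k = l then ?e l else 0) (\<Prod>l\<in>S. g l None)"
    using S by (intro wpoly_prod fS wpoly_g_None L_le) auto
  moreover have "(\<Sum>l\<in>S. if k = l then ?e l else 0) = (if k \<in> S then ?e k else 0)" for k
    using fS by simp
  ultimately have wpoly: "wpoly d n (\<lambda>k. if k \<in> S then ?e k else 0) (\<Prod>l\<in>S. g l None)" by simp
  show ?thesis unfolding basis_N[OF S]
  proof (rule supp_in_dterm_wpoly[OF wpoly Sd])
    fix k assume k: "k \<le> d"
    show "((if k \<in> S then ?e k else 0) + of_bool (k \<in> S)) mod n k = i k mod n k"
      using S I_bounds[of k] not_I[OF k] n[OF k] by (cases "k \<in> I"; cases "k \<in> S") auto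
  qed
qed

lemma basis_eig:
  assumes "I \<subseteq> S" "S \<subseteq> L" "card S = j" shows "basis N S \<in> eig_closed d n \<alpha> i j"
  using basis_supp_in[OF assms(1,2)] E_closed[OF assms(2)] assms(3) by (auto intro: eig_closedI)

text \<open>The index set of the basis in degree \<open>j\<close>: \<open>basis N S\<close> vanishes
  unless \<open>S\<close> contains \<open>I\<close>.\<close>

definition usets where "usets j = {S. I \<subseteq> S \<and> S \<subseteq> L \<and> card S = j}"

lemma finite_usets: "finite (usets j)"
  by (rule finite_subset[of _ "Pow L"]) (auto simp: usets_def finL)

lemma i_Box: "i \<in> Box d n" using iQ Qset_Box by auto

lemma supp_in_wform_spanned: "supp_in (wform d n i q) \<eta> \<Longrightarrow> \<eta> \<in> spanned"
  by (rule graded_spanned, erule supp_in_mono) (auto simp: wform_def gradedP_def formQ_def weight_def)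

lemma supp_in_wform'_spanned: "supp_in (wform' d n i q) \<eta> \<Longrightarrow> \<eta> \<in> spanned"
  by (rule graded_spanned, erule supp_in_mono) (auto simp: wform'_def gradedP_def formQ'_def weight_def)

lemma filt_basis:
  assumes "I \<subseteq> S" "S \<subseteq> L" shows "filt (wform d n i j) (basis N S) = (if card S = j then basis N S else 0)"
proof (cases "card S = j")
  case True then show ?thesis using filt_supp_in[OF basis_supp_in[OF assms]] by simp
next
  case False
  have "filt (wform d n i j) (basis N S) = 0"
    by (rule filt_supp_in_disj[OF basis_supp_in[OF assms]]) (use False in \<open>auto simp: wform_def formQ_def\<close>)
  then show ?thesis using False by simp
qed

text \<open>Up to an exact form a class is represented by its component of weight \<open>i\<close>,
  which is spanned. \<open>closed_span\<close> applies to it, and projection to degree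
  \<open>j\<close> discards the basis forms of other degrees.\<close>

lemma U_span:
  assumes "\<eta> \<in> eig_closed d n \<alpha> i j"
  shows "\<exists>c0. \<eta> - (\<Sum>S\<in>usets j. cmul (c0 S) (basis N S)) \<in> exacts G"
proof -
  let ?\<eta> = "filt (wform d n i j) \<eta>"
  note red = eig_reduce[OF assms n i_Box]
  obtain Y c where Y: "finite Y" "Y \<subseteq> R" "?\<eta> - B Y c \<in> rels G"
    using supp_in_wform_spanned[OF supp_in_filt, of j \<eta>] by (auto simp: spanned_def)
  from closed_span[OF indep_U Y red(2)] obtain c0 where
    c0: "?\<eta> - (\<Sum>S\<in>{S. I \<subseteq> S \<and> S \<subseteq> L}. cmul (c0 S) (basis N S)) \<in> exacts G" by blast
  have "filt (wform d n i j) (?\<eta> - (\<Sum>S\<in>{S. I \<subseteq> S \<and> S \<subseteq> L}. cmul (c0 S) (basis N S))) \<in> exacts G"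
    by (rule filt_wform_exacts[OF c0])
  moreover have "filt (wform d n i j) (\<Sum>S\<in>{S. I \<subseteq> S \<and> S \<subseteq> L}. cmul (c0 S) (basis N S)) = (\<Sum>S\<in>usets j. cmul (c0 S) (basis N S))"
    unfolding filt_sum filt_simps
    by (rule sum.mono_neutral_cong_right) (auto simp: usets_def filt_basis cmul_simps finL)
  ultimately have "?\<eta> - (\<Sum>S\<in>usets j. cmul (c0 S) (basis N S)) \<in> exacts G"
    by (simp add: filt_simps filt_supp_in[OF supp_in_filt])
  from exacts_add[OF red(1) this] show ?thesis by auto
qed

text \<open>A primitive may be arbitrary, but its component of weight \<open>i\<close> is again a
  primitive and is spanned, as \<open>E_indep\<close> requires.\<close>

lemma U_indep:
  assumes "(\<Sum>S\<in>usets j. cmul (c0 S) (basis N S)) \<in> exacts G" "S \<in> usets j"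
  shows "c0 S = 0"
proof -
  let ?E = "\<Sum>S\<in>usets j. cmul (c0 S) (basis N S)"
  obtain \<theta> where \<theta>: "?E - ext_d \<theta> \<in> rels G" using assms(1) by (auto simp: exacts_def)
  let ?\<theta> = "filt (wform' d n i j) \<theta>"
  have "filt (wform d n i j) (?E - ext_d \<theta>) \<in> rels G"
    by (rule filt_rels[OF _ d_compatible_wform \<theta>]) (use mult_invariant_wform[OF gp0_Ueq] in auto)
  moreover have "filt (wform d n i j) ?E = ?E"
    unfolding filt_sum filt_simps by (intro sum.cong) (auto simp: usets_def filt_basis)
  ultimately have 1: "?E - ext_d ?\<theta> \<in> rels G" by (simp add: filt_simps filt_ext_d[OF d_compatible_wform])
  obtain Y c where Y: "finite Y" "Y \<subseteq> R" "?\<theta> - B Y c \<in> rels G"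
    using supp_in_wform'_spanned[OF supp_in_filt, of j \<theta>] by (auto simp: spanned_def)
  show ?thesis
    by (rule E_indep[OF indep_U Y _ 1 assms(2)]) (auto simp: usets_def)
qed

section \<open>The comparison map on cohomology\<close>

lemma op_supp_in: "is_form T.TV q x \<Longrightarrow> supp_in (wform d n i (card I + q)) (op x)"
proof -
  assume x: "is_form T.TV q x"
  have "\<omega> = basis N I" using I_sub by (simp add: omega_dterm basis_N)
  then have "supp_in (wform d n i (card I)) \<omega>" using basis_supp_in[of I] I_sub by simp
  moreover have "supp_in (wform d n (\<lambda>_. 0) q) (pullback T.TV pm x)"
  proof (rule supp_in_pullback[OF T.finTV x])
    fix v assume "v \<in> T.TV"
    then have "v div 2 \<le> d" by (auto simp: Tvars_def LT_le)
    then show "wpoly d n (\<lambda>_. 0) (pm v)" by (simp add: pmap_def gp0_y gp0_uinv)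
  qed
  ultimately have "supp_in (wform d n (\<lambda>k. i k + 0) (card I + q)) (op x)"
    unfolding op_wedge by (rule supp_in_wedge_wform)
  then show ?thesis by simp
qed

lemma T_closed_iff: "x \<in> closed_forms T.TV T.TG q \<longleftrightarrow> is_form T.TV q x \<and> ext_d x \<in> rels T.TG"
  by (rule closed_forms_iff[OF T.finTV T.TG_in])

lemma T_exact_iff: "x \<in> exact_forms T.TV T.TG q \<longleftrightarrow> is_form T.TV q x \<and> x \<in> exacts T.TG"
  by (rule exact_forms_iff[OF T.finTV T.TG_in])

lemma op_closed:
  assumes "x \<in> closed_forms T.TV T.TG q" shows "op x \<in> eig_closed d n \<alpha> i (card I + q)"
proof (rule eig_closedI)
  have x: "is_form T.TV q x" "ext_d x \<in> rels T.TG" using assms by (auto simp: T_closed_iff)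
  show "supp_in (wform d n i (card I + q)) (op x)" by (rule op_supp_in[OF x(1)])
  show "ext_d (op x) \<in> rels G"
    using rels_add[OF op_ext_d[OF x(1)] rels_cmul[OF op_rels[OF x(2)], of "(- 1) ^ card I"]] by simp
qed

text \<open>The image of a primitive, multiplied by \<open>(-1) ^ card I\<close>, is a primitive of
  the image: the sign of \<open>op_ext_d\<close> squares to one.\<close>

lemma op_exact:
  assumes "x \<in> exact_forms T.TV T.TG q" shows "op x \<in> HU_exact d n \<alpha> (card I + q)"
proof -
  have x: "is_form T.TV q x" using assms by (simp add: T_exact_iff)
  obtain \<theta> where \<theta>: "if q = 0 then \<theta> = 0 else is_form T.TV (q - 1) \<theta>" "x - ext_d \<theta> \<in> rels T.TG"
    using assms rel_forms_rels unfolding exact_forms_def by blast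
  have "is_form T.TV (q - 1) \<theta>" using \<theta>(1) by (cases "q = 0") (auto simp: is_form_supp_in)
  then have 1: "ext_d (op \<theta>) - cmul ((- 1) ^ card I) (op (ext_d \<theta>)) \<in> rels G" by (rule op_ext_d)
  have sq: "(- 1) ^ card I * (- 1) ^ card I = (1::complex)" by (simp flip: power_mult_distrib)
  have "op (x - ext_d \<theta>) - cmul ((- 1) ^ card I) (ext_d (op \<theta>) - cmul ((- 1) ^ card I) (op (ext_d \<theta>))) \<in> rels G"
    by (intro rels_diff rels_cmul op_rels \<theta>(2) 1)
  then have "op x - ext_d (cmul ((- 1) ^ card I) (op \<theta>)) \<in> rels G"
    by (simp add: op_simps cmul_simps ext_d_cmul sq)
  then have "op x \<in> exacts G" by (rule exactsI)
  then show ?thesis using supp_in_wform_is_form[OF op_supp_in[OF x]] by (simp add: HU_exact_iff)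
qed

definition tsets where "tsets q = {M. M \<subseteq> LT \<and> card M = q}"

lemma bij_tsets: "bij_betw (\<lambda>M. I \<union> M) (tsets q) (usets (card I + q))"
proof (rule bij_betw_byWitness[where f' = "\<lambda>S. S - I"])
  have fin: "finite I" "\<And>M. M \<subseteq> LT \<Longrightarrow> finite M" using I_sub finL T.finLT finite_subset by blast+
  show "\<forall>M\<in>tsets q. I \<union> M - I = M" by (auto simp: tsets_def LT_eq)
  show "\<forall>S\<in>usets (card I + q). I \<union> (S - I) = S" by (auto simp: usets_def)
  have "card (I \<union> M) = card I + card M" if "M \<subseteq> LT" for M
    using fin that by (intro card_Un_disjoint) (auto simp: LT_eq)
  then show "(\<lambda>M. I \<union> M) ` tsets q \<subseteq> usets (card I + q)" using I_sub by (auto simp: tsets_def usets_def LT_eq)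
  have "card (S - I) = card S - card I" if "I \<subseteq> S" for S
    using fin that by (intro card_Diff_subset)
  then show "(\<lambda>S. S - I) ` usets (card I + q) \<subseteq> tsets q" by (auto simp: tsets_def usets_def LT_eq)
qed

lemma op_basis_N: "M \<subseteq> LT \<Longrightarrow> op (T.basis N M) = cmul (sgn_sets I M) (basis N (I \<union> M))"
  by (rule op_basis) auto

lemma T_basis_closed: "M \<in> tsets q \<Longrightarrow> T.basis N M \<in> closed_forms T.TV T.TG q"
  using T.T_basis_form[of M] T.E_closed[of M] by (auto simp: T_closed_iff tsets_def)

lemma sum_closed_T:
  "(\<Sum>M\<in>tsets q. cmul (c M) (T.basis N M)) \<in> closed_forms T.TV T.TG q"
proof -
  have "supp_in (formQ T.TV q) (\<Sum>M\<in>tsets q. cmul (c M) (T.basis N M))"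
    using T_basis_closed by (intro supp_in_sum supp_in_cmul) (auto simp: T_closed_iff is_form_supp_in)
  moreover have "ext_d (\<Sum>M\<in>tsets q. cmul (c M) (T.basis N M)) \<in> rels T.TG"
    unfolding ext_d_sum ext_d_cmul using T_basis_closed by (intro rels_sum rels_cmul) (auto simp: T_closed_iff)
  ultimately show ?thesis by (simp add: T_closed_iff is_form_supp_in)
qed

lemma op_sum_tsets:
  "op (\<Sum>M\<in>tsets q. cmul (c M) (T.basis N M)) = (\<Sum>S\<in>usets (card I + q). cmul (c (S - I) * sgn_sets I (S - I)) (basis N S))"
proof -
  have "op (\<Sum>M\<in>tsets q. cmul (c M) (T.basis N M)) = (\<Sum>M\<in>tsets q. cmul (c M * sgn_sets I M) (basis N (I \<union> M)))"
    unfolding op_sum by (intro sum.cong) (auto simp: op_simps op_basis_N tsets_def cmul_simps)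
  also have "\<dots> = (\<Sum>M\<in>tsets q. cmul (c ((I \<union> M) - I) * sgn_sets I ((I \<union> M) - I)) (basis N (I \<union> M)))"
  proof (rule sum.cong[OF refl])
    fix M assume "M \<in> tsets q"
    then have "I \<union> M - I = M" by (auto simp: tsets_def LT_eq)
    then show "cmul (c M * sgn_sets I M) (basis N (I \<union> M)) = cmul (c ((I \<union> M) - I) * sgn_sets I ((I \<union> M) - I)) (basis N (I \<union> M))"
      by simp
  qed
  also have "\<dots> = (\<Sum>S\<in>usets (card I + q). cmul (c (S - I) * sgn_sets I (S - I)) (basis N S))"
    by (rule sum.reindex_bij_betw[OF bij_tsets])
  finally show ?thesis .
qed

text \<open>Up to an exact form \<open>x\<close> is a combination of the torus basis. Its image is
  the same combination of basis forms of the variety up to signs, so exactness of the image makes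
  every coefficient zero.\<close>

lemma op_inj:
  assumes x: "x \<in> closed_forms T.TV T.TG q" and ex: "op x \<in> HU_exact d n \<alpha> (card I + q)"
  shows "x \<in> exact_forms T.TV T.TG q"
proof -
  have xf: "is_form T.TV q x" "ext_d x \<in> rels T.TG" using x by (auto simp: T_closed_iff)
  from T.T_span[OF indep_T xf] obtain c0 where
    c0: "x - (\<Sum>M\<in>tsets q. cmul (c0 M) (T.basis N M)) \<in> exacts T.TG" by (auto simp: tsets_def)
  let ?s = "\<Sum>M\<in>tsets q. cmul (c0 M) (T.basis N M)"
  have "is_form T.TV q (x - ?s)"
    using xf sum_closed_T[of c0 q] by (auto simp: T_closed_iff is_form_supp_in intro: supp_in_diff)
  then have "x - ?s \<in> exact_forms T.TV T.TG q" using c0 by (simp add: T_exact_iff)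
  from op_exact[OF this] have "op x - op ?s \<in> exacts G" by (simp add: HU_exact_iff op_simps)
  then have "op ?s \<in> exacts G" using ex exacts_diff[of "op x" G "op x - op ?s"] by (simp add: HU_exact_iff)
  then have z: "c0 (S - I) * sgn_sets I (S - I) = 0" if "S \<in> usets (card I + q)" for S
    unfolding op_sum_tsets using U_indep[of "\<lambda>S. c0 (S - I) * sgn_sets I (S - I)"] that by blast
  have "c0 M = 0" if "M \<in> tsets q" for M
  proof -
    have "I \<union> M \<in> usets (card I + q)" using bij_tsets[of q] that by (auto simp: bij_betw_def)
    moreover have "I \<union> M - I = M" using that by (auto simp: tsets_def LT_eq)
    ultimately show ?thesis using z[of "I \<union> M"] by simp
  qed
  then have "?s = 0" by (intro sum.neutral) (auto simp: cmul_simps)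
  then show ?thesis using c0 xf by (simp add: T_exact_iff)
qed

text \<open>The coefficients of the preimage are corrected by \<open>sgn_sets I M\<close>, which
  cancels against the sign introduced by the map.\<close>

lemma op_surj:
  assumes \<eta>: "\<eta> \<in> eig_closed d n \<alpha> i (card I + q)"
  shows "\<exists>x\<in>closed_forms T.TV T.TG q. \<eta> - op x \<in> HU_exact d n \<alpha> (card I + q)"
proof -
  obtain c0 where c0: "\<eta> - (\<Sum>S\<in>usets (card I + q). cmul (c0 S) (basis N S)) \<in> exacts G" using U_span[OF \<eta>] by blast
  let ?x = "\<Sum>M\<in>tsets q. cmul (c0 (I \<union> M) * sgn_sets I M) (T.basis N M)"
  have "op ?x = (\<Sum>S\<in>usets (card I + q). cmul (c0 S) (basis N S))"
    unfolding op_sum_tsets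
  proof (rule sum.cong[OF refl])
    fix S assume "S \<in> usets (card I + q)"
    then have "I \<union> (S - I) = S" by (auto simp: usets_def)
    then show "cmul (c0 (I \<union> (S - I)) * sgn_sets I (S - I) * sgn_sets I (S - I)) (basis N S) = cmul (c0 S) (basis N S)"
      by (simp add: mult.assoc)
  qed
  moreover have x: "?x \<in> closed_forms T.TV T.TG q" by (rule sum_closed_T)
  moreover have "is_form {..d} (card I + q) \<eta>" using \<eta> by (simp add: eig_closed_def HU_closed_iff)
  moreover have "is_form {..d} (card I + q) (op ?x)"
    using op_closed[OF x] by (simp add: eig_closed_def HU_closed_iff)
  ultimately have "\<eta> - op ?x \<in> HU_exact d n \<alpha> (card I + q)"
    using c0 by (auto simp: HU_exact_iff is_form_supp_in intro: supp_in_diff)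
  then show ?thesis using x by blast
qed

section \<open>Dimension of the eigenspace\<close>

lemma card_I: "card I \<le> d"
proof -
  have "card I \<le> card L" using I_sub finL by (rule card_mono[rotated])
  then show ?thesis using k0 by (simp add: L_def)
qed

lemma usets_empty: "j < card I \<Longrightarrow> usets j = {}"
proof -
  assume j: "j < card I"
  have "card I \<le> card S" if "I \<subseteq> S" "S \<subseteq> L" for S
    using that finL finite_subset by (intro card_mono) blast+
  then have "card S \<noteq> j" if "I \<subseteq> S" "S \<subseteq> L" for S using j that by (metis leD)
  then show ?thesis by (auto simp: usets_def)
qed

text \<open>Removing \<open>I\<close> leaves a subset of \<open>LT\<close> with
  \<open>j - card I\<close> elements, and \<open>LT\<close> has \<open>d - card I\<close>. For
  \<open>j < card I\<close> there is no such set, and the binomial coefficient vanishes since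
  \<open>d - j > d - card I\<close>.\<close>

lemma card_usets: "j \<le> d \<Longrightarrow> card (usets j) = (d - card I) choose (d - j)"
proof (cases "j < card I")
  case True
  assume "j \<le> d"
  then show ?thesis using True card_I by (simp add: usets_empty)
next
  case False
  assume jd: "j \<le> d"
  define q where "q = j - card I"
  have j: "j = card I + q" using False by (simp add: q_def)
  have "card LT = d - card I"
  proof -
    have "card LT = card L - card I" unfolding LT_eq using I_sub finL finite_subset by (intro card_Diff_subset) blast+
    then show ?thesis using k0 by (simp add: L_def)
  qed
  then have "card (tsets q) = (d - card I) choose q"
    using n_subsets[OF T.finLT, of q] by (simp add: tsets_def)
  also have "\<dots> = (d - card I) choose (d - j)"
    using jd j by (subst binomial_symmetric) (auto intro: arg_cong[where f = "(choose) (d - card I)"])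
  finally show ?thesis using bij_betw_same_card[OF bij_tsets[of q]] j by simp
qed

lemma dim_eig:
  assumes "j \<le> d"
  shows "quot_dim (eig_closed d n \<alpha> i j) (HU_exact d n \<alpha> j) ((d - card I) choose (d - j))"
proof -
  define m where "m = card (usets j)"
  obtain b where b: "bij_betw b {..<m} (usets j)"
    using ex_bij_betw_nat_finite[OF finite_usets, of j] by (auto simp: m_def atLeast0LessThan)
  have sums: "(\<Sum>k<m. cmul (c (b k)) (basis N (b k))) = (\<Sum>S\<in>usets j. cmul (c S) (basis N S))" for c
    by (rule sum.reindex_bij_betw[OF b])
  define b' where "b' = the_inv_into {..<m} b"
  have b': "b' (b k) = k" if "k < m" for k
    using b that by (simp add: b'_def the_inv_into_f_f bij_betw_def)
  have bE: "b k \<in> usets j" if "k < m" for k using b that by (auto simp: bij_betw_def)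
  have form: "is_form {..d} j (\<Sum>S\<in>usets j. cmul (c S) (basis N S))" for c
    using basis_eig unfolding is_form_supp_in
    by (intro supp_in_sum supp_in_cmul) (auto simp: usets_def eig_closed_def HU_closed_iff is_form_supp_in)
  have "quot_dim (eig_closed d n \<alpha> i j) (HU_exact d n \<alpha> j) m"
    unfolding quot_dim_def
  proof (intro exI[of _ "\<lambda>k. basis N (b k)"] conjI allI impI ballI)
    fix k assume "k < m"
    then show "basis N (b k) \<in> eig_closed d n \<alpha> i j" using bE by (auto simp: usets_def intro: basis_eig)
  next
    fix c k assume c: "(\<Sum>k<m. cmul (c k) (basis N (b k))) \<in> HU_exact d n \<alpha> j" and k: "k < m"
    have "(\<Sum>k<m. cmul (c k) (basis N (b k))) = (\<Sum>k<m. cmul (c (b' (b k))) (basis N (b k)))"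
      by (intro sum.cong) (auto simp: b')
    also have "\<dots> = (\<Sum>S\<in>usets j. cmul (c (b' S)) (basis N S))" by (rule sums)
    finally have "(\<Sum>S\<in>usets j. cmul (c (b' S)) (basis N S)) \<in> exacts G" using c by (simp add: HU_exact_iff)
    from U_indep[OF this bE[OF k]] show "c k = 0" by (simp add: b' k)
  next
    fix \<eta> assume \<eta>: "\<eta> \<in> eig_closed d n \<alpha> i j"
    obtain c0 where c0: "\<eta> - (\<Sum>S\<in>usets j. cmul (c0 S) (basis N S)) \<in> exacts G" using U_span[OF \<eta>] by blast
    have "is_form {..d} j \<eta>" using \<eta> by (simp add: eig_closed_def HU_closed_iff)
    then have "\<eta> - (\<Sum>S\<in>usets j. cmul (c0 S) (basis N S)) \<in> HU_exact d n \<alpha> j"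
      using c0 form by (auto simp: HU_exact_iff is_form_supp_in intro: supp_in_diff)
    then show "\<exists>c. \<eta> - (\<Sum>k<m. cmul (c k) (basis N (b k))) \<in> HU_exact d n \<alpha> j"
      by (intro exI[of _ "\<lambda>k. c0 (b k)"]) (simp add: sums)
  qed
  then show ?thesis by (simp add: m_def card_usets[OF assms])
qed

lemma eig_exact:
  assumes "j < card I" shows "eig_closed d n \<alpha> i j \<subseteq> HU_exact d n \<alpha> j"
proof
  fix \<eta> assume \<eta>: "\<eta> \<in> eig_closed d n \<alpha> i j"
  then have "is_form {..d} j \<eta>" by (simp add: eig_closed_def HU_closed_iff)
  moreover have "\<eta> \<in> exacts G" using U_span[OF \<eta>] usets_empty[OF assms] by auto
  ultimately show "\<eta> \<in> HU_exact d n \<alpha> j" by (simp add: HU_exact_iff)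
qed

end

section \<open>Generation by logarithmic forms\<close>

text \<open>Wedge products of \<open>x^e dx / (x^n - 1)\<close>. They are homogeneous for the
  weights and mediate between basis forms and logarithmic forms.\<close>

definition mono_form :: "nat \<Rightarrow> (nat \<Rightarrow> nat) \<Rightarrow> complex \<Rightarrow> nat set \<Rightarrow> (nat \<Rightarrow> nat) \<Rightarrow> dform" where
  "mono_form d n \<alpha> K e = dterm K (\<Prod>k\<in>K. Var k ^ e k * uinv d n \<alpha> k)"

lemma gen_form_dterm:
  "finite K \<Longrightarrow> gen_form d n \<alpha> K \<nu> = dterm K (\<Prod>k\<in>K. (\<Sum>m<n k. Const (\<nu> k ^ (n k - 1 - m)) * Var k ^ m) * uinv d n \<alpha> k)"
proof -
  assume "finite K"
  have "gen_form d n \<alpha> K \<nu> = wset (\<lambda>k. dterm {k} ((\<Sum>m<n k. Const (\<nu> k ^ (n k - 1 - m)) * Var k ^ m) * uinv d n \<alpha> k)) K"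
    unfolding gen_form_def dlog_form_def wset_def dterm_def ..
  then show ?thesis by (simp only: wset_dterm[OF \<open>finite K\<close>])
qed

text \<open>Distributing over the geometric sums in the numerators gives one summand for each choice
  \<open>e\<close> of exponents.\<close>

lemma gen_form_expand:
  assumes "finite K"
  shows "gen_form d n \<alpha> K \<nu> = (\<Sum>e\<in>PiE K (\<lambda>k. {..<n k}). cmul (\<Prod>k\<in>K. \<nu> k ^ (n k - 1 - e k)) (mono_form d n \<alpha> K e))"
proof -
  have "(\<Prod>k\<in>K. (\<Sum>m<n k. Const (\<nu> k ^ (n k - 1 - m)) * Var k ^ m) * uinv d n \<alpha> k)
      = (\<Prod>k\<in>K. \<Sum>m\<in>{..<n k}. Const (\<nu> k ^ (n k - 1 - m)) * (Var k ^ m * uinv d n \<alpha> k))"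
    by (simp add: sum_distrib_right mult.assoc)
  also have "\<dots> = (\<Sum>e\<in>PiE K (\<lambda>k. {..<n k}). \<Prod>k\<in>K. Const (\<nu> k ^ (n k - 1 - e k)) * (Var k ^ e k * uinv d n \<alpha> k))"
    using assms by (intro prod_sum_PiE) auto
  finally show ?thesis
    by (simp add: gen_form_dterm[OF assms] mono_form_def dterm_sum prod.distrib Const_prod)
qed

lemma finite_mu: "0 < N \<Longrightarrow> finite (mu N)"
  by (simp add: mu_def finite_nth_roots)

text \<open>If \<open>N\<close> does not divide \<open>e\<close>, multiplication by a primitive root
  permutes \<open>mu N\<close> but multiplies the sum by a constant different from one.\<close>

lemma sum_mu:
  assumes "0 < N"
  shows "(\<Sum>z\<in>mu N. z ^ e) = (if N dvd e then of_nat N else 0)"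
proof (cases "N dvd e")
  case True
  have "z ^ e = 1" if "z \<in> mu N" for z using mu_power_mod[OF that, of e] True by simp
  then have "(\<Sum>z\<in>mu N. z ^ e) = of_nat (card (mu N))" by simp
  also have "card (mu N) = N" using card_roots_unity_eq[OF assms] by (simp add: mu_def)
  finally show ?thesis using True by simp
next
  case False
  define \<zeta> where "\<zeta> = cis (2 * pi / real N)"
  have e: "e mod N \<noteq> 0" using False by (simp add: mod_eq_0_iff_dvd)
  note pr = prim_root[of N "e mod N" 0, folded \<zeta>_def]
  have \<zeta>: "\<zeta> \<in> mu N" "\<zeta> ^ (e mod N) \<noteq> 1" using pr assms e by auto
  then have ne: "\<zeta> ^ e \<noteq> 1" using mu_power_mod[OF \<zeta>(1), of e] by simp
  have \<zeta>0: "\<zeta> \<noteq> 0" by (simp add: \<zeta>_def)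
  have "bij_betw (\<lambda>z. \<zeta> * z) (mu N) (mu N)"
    by (rule bij_betw_byWitness[where f' = "\<lambda>z. z / \<zeta>"])
       (use \<zeta>(1) \<zeta>0 in \<open>auto simp: mu_def power_mult_distrib power_divide\<close>)
  from sum.reindex_bij_betw[OF this, of "\<lambda>z. z ^ e"]
  have "\<zeta> ^ e * (\<Sum>z\<in>mu N. z ^ e) = (\<Sum>z\<in>mu N. z ^ e)"
    by (simp add: power_mult_distrib sum_distrib_left)
  then show ?thesis using ne False by simp
qed

text \<open>Discrete Fourier inversion: the total exponent of \<open>z\<close> at the monomial
  \<open>m'\<close> is \<open>N + m - m'\<close>, and summing over \<open>mu N\<close> leaves only
  \<open>m' = m\<close>.\<close>

lemma fourier:
  assumes "m < N"
  shows "(\<Sum>z\<in>mu N. Const (z ^ (m + 1) / of_nat N) * (\<Sum>m'<N. Const (z ^ (N - 1 - m')) * Var k ^ m')) = Var k ^ m"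
proof -
  have N: "0 < N" using assms by simp
  have "(\<Sum>z\<in>mu N. Const (z ^ (m + 1) / of_nat N) * (\<Sum>m'<N. Const (z ^ (N - 1 - m')) * Var k ^ m'))
      = (\<Sum>z\<in>mu N. \<Sum>m'<N. Const (z ^ (m + 1) / of_nat N * z ^ (N - 1 - m')) * Var k ^ m')"
    by (simp only: sum_distrib_left Const_mult mult.assoc)
  also have "\<dots> = (\<Sum>m'<N. \<Sum>z\<in>mu N. Const (z ^ (m + 1) / of_nat N * z ^ (N - 1 - m')) * Var k ^ m')"
    by (rule sum.swap)
  also have "\<dots> = (\<Sum>m'<N. if m' = m then Var k ^ m else 0)"
  proof (rule sum.cong[OF refl])
    fix m' assume m': "m' \<in> {..<N}"
    have cs: "Const (\<Sum>z\<in>Y. h z) = (\<Sum>z\<in>Y. Const (h z))" for Y :: "complex set" and h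
      by (induction Y rule: infinite_finite_induct) (simp_all add: Const_add)
    have "(\<Sum>z\<in>mu N. Const (z ^ (m + 1) / of_nat N * z ^ (N - 1 - m')) * Var k ^ m')
        = Const ((\<Sum>z\<in>mu N. z ^ (m + 1 + (N - 1 - m'))) / of_nat N) * Var k ^ m'"
      by (simp add: sum_divide_distrib cs sum_distrib_right power_add mult.assoc)
    also have "(\<Sum>z\<in>mu N. z ^ (m + 1 + (N - 1 - m'))) = (if N dvd m + 1 + (N - 1 - m') then of_nat N else 0)"
      by (rule sum_mu[OF N])
    also have "(N dvd m + 1 + (N - 1 - m')) = (m' = m)"
    proof
      assume "N dvd m + 1 + (N - 1 - m')"
      then obtain t where t: "m + 1 + (N - 1 - m') = N * t" by (auto simp: dvd_def)
      \<comment> \<open>The exponent is positive and below \<open>2N\<close>, so the only multiple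
        of \<open>N\<close> it can equal is \<open>N\<close> itself.\<close>
      have "m + 1 + (N - 1 - m') < N * 2" using assms m' by auto
      then have "N * t < N * 2" by (simp only: t)
      then have "t < 2" by simp
      moreover have "t \<noteq> 0" using t by (intro notI) simp
      ultimately have "t = 1" by simp
      then show "m' = m" using t assms m' by auto
    next
      assume "m' = m"
      then have "m + 1 + (N - 1 - m') = N" using assms by auto
      then show "N dvd m + 1 + (N - 1 - m')" by simp
    qed
    finally show "(\<Sum>z\<in>mu N. Const (z ^ (m + 1) / of_nat N * z ^ (N - 1 - m')) * Var k ^ m') = (if m' = m then Var k ^ m else 0)"
      using N by simp
  qed
  also have "\<dots> = Var k ^ m" using assms by simp
  finally show ?thesis .
qed

lemma mono_form_fourier:
  assumes "finite K" "\<And>k. k \<in> K \<Longrightarrow> e k < n k"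
  shows "mono_form d n \<alpha> K e = (\<Sum>\<nu>\<in>PiE K (\<lambda>k. mu (n k)). cmul (\<Prod>k\<in>K. \<nu> k ^ (e k + 1) / of_nat (n k)) (gen_form d n \<alpha> K \<nu>))"
proof -
  let ?s = "\<lambda>k z. (\<Sum>m<n k. Const (z ^ (n k - 1 - m)) * Var k ^ m)"
  have "(\<Prod>k\<in>K. Var k ^ e k * uinv d n \<alpha> k) = (\<Prod>k\<in>K. \<Sum>z\<in>mu (n k). Const (z ^ (e k + 1) / of_nat (n k)) * (?s k z * uinv d n \<alpha> k))"
  proof (rule prod.cong[OF refl])
    fix k assume "k \<in> K"
    then show "Var k ^ e k * uinv d n \<alpha> k = (\<Sum>z\<in>mu (n k). Const (z ^ (e k + 1) / of_nat (n k)) * (?s k z * uinv d n \<alpha> k))"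
      unfolding fourier[OF assms(2)[OF \<open>k \<in> K\<close>], of k, symmetric] by (simp only: sum_distrib_right mult.assoc)
  qed
  also have "\<dots> = (\<Sum>\<nu>\<in>PiE K (\<lambda>k. mu (n k)). \<Prod>k\<in>K. Const (\<nu> k ^ (e k + 1) / of_nat (n k)) * (?s k (\<nu> k) * uinv d n \<alpha> k))"
    using assms finite_mu by (intro prod_sum_PiE) force+
  finally show ?thesis
    by (simp add: gen_form_dterm[OF assms(1)] mono_form_def dterm_sum prod.distrib Const_prod)
qed

context usetup
begin

text \<open>Outside \<open>I\<close> the basis uses \<open>du / u\<close>, which carries the factor
  \<open>n k\<close>; these constants are the only difference.\<close>

lemma basis_mono_form:
  assumes S: "I \<subseteq> S" "S \<subseteq> L" and e: "\<And>k. k \<in> S \<Longrightarrow> e k = (if k \<in> I then i k - 1 else n k - 1)"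
  shows "basis N S = cmul (\<Prod>k\<in>S. if k \<in> I then 1 else of_nat (n k)) (mono_form d n \<alpha> S e)"
proof -
  have "(\<Prod>l\<in>S. g l None) = (\<Prod>l\<in>S. Const (if l \<in> I then 1 else of_nat (n l)) * (Var l ^ e l * w l))"
    by (intro prod.cong) (auto simp: g_def tdiff_def udiff_def P_def Const_of_nat e mult.assoc)
  then show ?thesis by (simp add: basis_N[OF S] mono_form_def prod.distrib Const_prod)
qed

end

text \<open>For the weight read off from the exponents, the form is a nonzero multiple of a basis
  form, hence closed and of that weight.\<close>

lemma mono_form_eig:
  assumes d: "1 \<le> d" and n: "\<forall>k\<le>d. 1 \<le> n k" and \<alpha>: "\<alpha> \<noteq> 0" and K: "K \<subseteq> {..d}" "card K = j" "j \<le> d"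
    and e: "\<And>k. k \<in> K \<Longrightarrow> e k < n k"
  shows "\<exists>i\<in>Qset d n. cmul c (mono_form d n \<alpha> K e) \<in> eig_closed d n \<alpha> i j"
proof -
  \<comment> \<open>Since \<open>j \<le> d\<close>, some coordinate \<open>k0\<close> is missing
    from \<open>K\<close>; it has character zero, which puts the weight into
    \<open>Qset\<close>.\<close>
  have "card K < card {..d}" using K by simp
  then have "K \<noteq> {..d}" by auto
  then obtain k0 where kk: "k0 \<le> d" "k0 \<notin> K" using K by auto
  \<comment> \<open>The weight of \<open>x^e dx / (x^n - 1)\<close> is \<open>e + 1\<close> modulo
    \<open>n\<close>, the differential counting once.\<close>
  define i where "i k = (if k \<in> K then (e k + 1) mod n k else 0)" for k
  have iQ: "i \<in> Qset d n"
    using kk K n by (auto simp: Qset_def i_def intro!: mod_less_divisor exI[of _ k0])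
  interpret usetup d n \<alpha> i k0
    by standard (use d n \<alpha> iQ kk in \<open>auto simp: i_def\<close>)
  have IK: "I \<subseteq> K" by (auto simp: Iset_def i_def split: if_splits)
  have KL: "K \<subseteq> L" using K kk by (auto simp: L_def)
  have fK: "finite K" using K finite_subset by blast
  have base_exp: "e k = (if k \<in> I then i k - 1 else n k - 1)" if "k \<in> K" for k
  proof -
    have kd: "k \<le> d" using that K by auto
    show ?thesis
    proof (cases "e k + 1 < n k")
      case True
      then have "i k = e k + 1" using that by (simp add: i_def)
      then show ?thesis using kd by (simp add: Iset_def)
    next
      \<comment> \<open>The largest exponent \<open>n k - 1\<close> has trivial character; this is
        the block used by the basis outside \<open>I\<close>.\<close>
      case False
      then have "e k + 1 = n k" using e[OF that] by simp
      moreover from this have "i k = 0" using that by (simp add: i_def)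
      ultimately show ?thesis by (simp add: Iset_def)
    qed
  qed
  let ?c = "\<Prod>k\<in>K. if k \<in> I then 1 else of_nat (n k) :: complex"
  have "n k \<noteq> 0" if "k \<in> K" for k using n[of k] K that by auto
  then have c0: "?c \<noteq> 0" using fK by (auto simp: prod_zero_iff)
  have "cmul (c / ?c) (basis N K) = cmul c (mono_form d n \<alpha> K e)"
    using c0 by (simp only: basis_mono_form[OF IK KL base_exp] cmul_simps(8)) simp
  moreover have "cmul (c / ?c) (basis N K) \<in> eig_closed d n \<alpha> i j"
    using supp_in_cmul[OF basis_supp_in[OF IK KL]] rels_cmul[OF E_closed[OF KL]] K(2)
    by (auto intro!: eig_closedI simp: ext_d_cmul)
  ultimately show ?thesis using iQ by auto
qed

section \<open>The part indexed by \<open>Qset\<close> and the span of the logarithmic forms\<close>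

lemma finite_Qset: "finite (Qset d n)"
  using finite_subset[OF Qset_Box finite_Box] .

lemma eig_closed_add: "a \<in> eig_closed d n \<alpha> i j \<Longrightarrow> b \<in> eig_closed d n \<alpha> i j \<Longrightarrow> a + b \<in> eig_closed d n \<alpha> i j"
proof -
  assume *: "a \<in> eig_closed d n \<alpha> i j" "b \<in> eig_closed d n \<alpha> i j"
  have "act_form \<nu> (a + b) = act_form \<nu> a + act_form \<nu> b" for \<nu>
    by (rule ext, rule poly_mapping_eqI) (simp add: form_apply lookup_add lookup_act_form algebra_simps)
  then have "act_form \<nu> (a + b) - cmul c (a + b) = (act_form \<nu> a - cmul c a) + (act_form \<nu> b - cmul c b)" for \<nu> c
    by (simp add: cmul_simps)
  then show ?thesis using *
    by (auto simp: eig_closed_def HU_closed_iff HU_exact_iff is_form_supp_in ext_d_simps intro: supp_in_add rels_add exacts_add)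
qed

lemma eig_closed_0: "0 \<in> eig_closed d n \<alpha> i j"
  by (rule eig_closedI) (simp_all add: ext_d_simps)

lemma eig_Qpart: "i \<in> Qset d n \<Longrightarrow> \<eta> \<in> eig_closed d n \<alpha> i j \<Longrightarrow> \<eta> \<in> Qpart d n \<alpha> j"
proof -
  assume i: "i \<in> Qset d n" and \<eta>: "\<eta> \<in> eig_closed d n \<alpha> i j"
  let ?s = "\<lambda>i'. if i' = i then \<eta> else 0"
  have "(\<Sum>i'\<in>Qset d n. ?s i') = \<eta>" using i finite_Qset by simp
  moreover have "0 \<in> HU_exact d n \<alpha> j" by (simp add: HU_exact_iff is_form_supp_in)
  moreover have "\<forall>i'\<in>Qset d n. ?s i' \<in> eig_closed d n \<alpha> i' j" using \<eta> eig_closed_0 by auto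
  moreover have "is_form (Uvars d) j \<eta>" using \<eta> by (simp add: eig_closed_def HU_closed_iff Uvars_def)
  ultimately show ?thesis unfolding Qpart_def by (intro CollectI conjI exI[of _ ?s]) auto
qed

lemma Qpart_add: "a \<in> Qpart d n \<alpha> j \<Longrightarrow> b \<in> Qpart d n \<alpha> j \<Longrightarrow> a + b \<in> Qpart d n \<alpha> j"
proof -
  assume "a \<in> Qpart d n \<alpha> j" "b \<in> Qpart d n \<alpha> j"
  then obtain s t where st: "is_form (Uvars d) j a" "is_form (Uvars d) j b"
    "\<forall>i\<in>Qset d n. s i \<in> eig_closed d n \<alpha> i j" "\<forall>i\<in>Qset d n. t i \<in> eig_closed d n \<alpha> i j"
    "a - (\<Sum>i\<in>Qset d n. s i) \<in> HU_exact d n \<alpha> j" "b - (\<Sum>i\<in>Qset d n. t i) \<in> HU_exact d n \<alpha> j"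
    by (auto simp: Qpart_def)
  have eq: "a + b - (\<Sum>i\<in>Qset d n. s i + t i) = (a - (\<Sum>i\<in>Qset d n. s i)) + (b - (\<Sum>i\<in>Qset d n. t i))"
    by (simp add: sum.distrib algebra_simps)
  have "a + b - (\<Sum>i\<in>Qset d n. s i + t i) \<in> HU_exact d n \<alpha> j"
    unfolding eq using st(5,6) by (auto simp: HU_exact_iff is_form_supp_in intro: supp_in_add exacts_add)
  then show ?thesis unfolding Qpart_def using st(1-4)
    by (intro CollectI conjI exI[of _ "\<lambda>i. s i + t i"]) (auto simp: is_form_supp_in intro: supp_in_add eig_closed_add)
qed

lemma Qpart_sum:
  assumes "\<And>x. x \<in> Y \<Longrightarrow> h x \<in> Qpart d n \<alpha> j" "i \<in> Qset d n"
  shows "(\<Sum>x\<in>Y. h x) \<in> Qpart d n \<alpha> j"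
proof -
  have 0: "0 \<in> Qpart d n \<alpha> j" by (rule eig_Qpart[OF assms(2) eig_closed_0])
  show ?thesis using assms(1)
    by (induction Y rule: infinite_finite_induct) (auto intro: 0 Qpart_add)
qed

lemma gen_form_Qpart:
  assumes d: "1 \<le> d" and n: "\<forall>k\<le>d. 1 \<le> n k" and \<alpha>: "\<alpha> \<noteq> 0" and K: "K \<subseteq> {..d}" "card K = j" "j \<le> d"
  shows "gen_form d n \<alpha> K \<nu> \<in> Qpart d n \<alpha> j"
proof -
  have fK: "finite K" using K finite_subset by blast
  have "(\<lambda>_. 0) \<in> Qset d n" using n by (auto simp: Qset_def Suc_le_eq)
  then show ?thesis unfolding gen_form_expand[OF fK]
  proof (rule Qpart_sum[rotated])
    fix e assume "e \<in> PiE K (\<lambda>k. {..<n k})"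
    then have "\<And>k. k \<in> K \<Longrightarrow> e k < n k" by auto
    then show "cmul (\<Prod>k\<in>K. \<nu> k ^ (n k - 1 - e k)) (mono_form d n \<alpha> K e) \<in> Qpart d n \<alpha> j"
      using mono_form_eig[OF d n \<alpha> K] eig_Qpart by blast
  qed
qed

text \<open>Roots outside \<open>K\<close> do not affect \<open>gen_form\<close>; \<open>PiE\<close>
  fixes them, which leaves finitely many indices.\<close>

definition log_idx :: "nat \<Rightarrow> (nat \<Rightarrow> nat) \<Rightarrow> nat \<Rightarrow> (nat set \<times> (nat \<Rightarrow> complex)) set" where
  "log_idx d n j = Sigma {K. K \<subseteq> {..d} \<and> card K = j} (\<lambda>K. PiE K (\<lambda>k. mu (n k)))"

lemma finite_log_idx: "\<forall>k\<le>d. 1 \<le> n k \<Longrightarrow> finite (log_idx d n j)"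
proof -
  assume n: "\<forall>k\<le>d. 1 \<le> n k"
  have "finite (PiE K (\<lambda>k. mu (n k)))" if "K \<subseteq> {..d}" for K
  proof (rule finite_PiE)
    show "finite K" using that finite_subset by blast
    fix k assume "k \<in> K"
    then have "1 \<le> n k" using n that by auto
    then show "finite (mu (n k))" by (intro finite_mu) simp
  qed
  then show ?thesis unfolding log_idx_def by (intro finite_SigmaI) auto
qed

definition log_span :: "nat \<Rightarrow> (nat \<Rightarrow> nat) \<Rightarrow> complex \<Rightarrow> nat \<Rightarrow> dform set" where
  "log_span d n \<alpha> j = {\<eta>. \<exists>c. \<eta> - (\<Sum>x\<in>log_idx d n j. cmul (c x) (gen_form d n \<alpha> (fst x) (snd x))) \<in> exacts {Ueq d n \<alpha>}}"

lemma log_span_add: "a \<in> log_span d n \<alpha> j \<Longrightarrow> b \<in> log_span d n \<alpha> j \<Longrightarrow> a + b \<in> log_span d n \<alpha> j"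
proof -
  assume "a \<in> log_span d n \<alpha> j" "b \<in> log_span d n \<alpha> j"
  then obtain c e where
    1: "a - (\<Sum>x\<in>log_idx d n j. cmul (c x) (gen_form d n \<alpha> (fst x) (snd x))) \<in> exacts {Ueq d n \<alpha>}"
    and 2: "b - (\<Sum>x\<in>log_idx d n j. cmul (e x) (gen_form d n \<alpha> (fst x) (snd x))) \<in> exacts {Ueq d n \<alpha>}"
    by (auto simp: log_span_def)
  from exacts_add[OF 1 2] show ?thesis unfolding log_span_def
    by (intro CollectI exI[of _ "\<lambda>x. c x + e x"]) (simp add: cmul_simps sum.distrib algebra_simps)
qed

lemma exacts_log_span: "a \<in> exacts {Ueq d n \<alpha>} \<Longrightarrow> a \<in> log_span d n \<alpha> j"
  unfolding log_span_def by (intro CollectI exI[of _ "\<lambda>_. 0"]) (simp add: cmul_simps)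

lemma log_span_cmul: "a \<in> log_span d n \<alpha> j \<Longrightarrow> cmul t a \<in> log_span d n \<alpha> j"
proof -
  assume "a \<in> log_span d n \<alpha> j"
  then obtain c where 1: "a - (\<Sum>x\<in>log_idx d n j. cmul (c x) (gen_form d n \<alpha> (fst x) (snd x))) \<in> exacts {Ueq d n \<alpha>}"
    by (auto simp: log_span_def)
  from exacts_cmul[OF 1, of t] show ?thesis unfolding log_span_def
    by (intro CollectI exI[of _ "\<lambda>x. t * c x"]) (simp add: cmul_simps cmul_sum)
qed

lemma log_span_sum: "(\<And>x. x \<in> Y \<Longrightarrow> h x \<in> log_span d n \<alpha> j) \<Longrightarrow> (\<Sum>x\<in>Y. h x) \<in> log_span d n \<alpha> j"
  by (induction Y rule: infinite_finite_induct) (auto intro: log_span_add exacts_log_span)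

lemma gen_form_log_span:
  assumes n: "\<forall>k\<le>d. 1 \<le> n k" and x: "(K, \<nu>) \<in> log_idx d n j" shows "gen_form d n \<alpha> K \<nu> \<in> log_span d n \<alpha> j"
proof -
  let ?c = "\<lambda>y. if y = (K, \<nu>) then 1 else 0 :: complex"
  have "(\<Sum>y\<in>log_idx d n j. cmul (?c y) (gen_form d n \<alpha> (fst y) (snd y))) = (\<Sum>y\<in>log_idx d n j. if y = (K, \<nu>) then gen_form d n \<alpha> K \<nu> else 0)"
    by (intro sum.cong) (auto simp: cmul_simps)
  then have "(\<Sum>y\<in>log_idx d n j. cmul (?c y) (gen_form d n \<alpha> (fst y) (snd y))) = gen_form d n \<alpha> K \<nu>"
    using x finite_log_idx[OF n, of j] by simp
  then show ?thesis unfolding log_span_def by (intro CollectI exI[of _ ?c]) simp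
qed

text \<open>Modulo exact forms \<eta> is a combination of basis forms; each is a constant multiple
  of a \<open>mono_form\<close>, which Fourier inversion writes through logarithmic forms.\<close>

lemma eig_log_span:
  assumes d: "1 \<le> d" and nn: "\<forall>k\<le>d. 1 \<le> n k" and \<alpha>: "\<alpha> \<noteq> 0" and i: "i \<in> Qset d n"
    and \<eta>: "\<eta> \<in> eig_closed d n \<alpha> i j"
  shows "\<eta> \<in> log_span d n \<alpha> j"
proof -
  obtain k0 where k0: "k0 \<le> d" "i k0 = 0" using i by (auto simp: Qset_def)
  interpret usetup d n \<alpha> i k0 by standard (use d nn \<alpha> i k0 in auto)
  have basis: "basis N S \<in> log_span d n \<alpha> j" if "S \<in> usets j" for S
  proof -
    have S: "I \<subseteq> S" "S \<subseteq> L" "card S = j" using that by (auto simp: usets_def)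
    have fS: "finite S" using S finL finite_subset by blast
    let ?e = "\<lambda>k. if k \<in> I then i k - 1 else n k - 1"
    have lt: "?e k < n k" if "k \<in> S" for k using I_bounds[of k] nn S that L_le[of k] by fastforce
    have eq: "mono_form d n \<alpha> S ?e = (\<Sum>\<nu>\<in>PiE S (\<lambda>k. mu (n k)). cmul (\<Prod>k\<in>S. \<nu> k ^ (?e k + 1) / of_nat (n k)) (gen_form d n \<alpha> S \<nu>))"
      by (rule mono_form_fourier[OF fS]) (rule lt)
    have "mono_form d n \<alpha> S ?e \<in> log_span d n \<alpha> j"
      unfolding eq using S L_le by (intro log_span_sum log_span_cmul gen_form_log_span[OF nn]) (auto simp: log_idx_def)
    then show ?thesis using basis_mono_form[OF S(1,2), of ?e] log_span_cmul by simp
  qed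
  obtain c0 where c0: "\<eta> - (\<Sum>S\<in>usets j. cmul (c0 S) (basis N S)) \<in> exacts G" using U_span[OF \<eta>] by blast
  have "(\<eta> - (\<Sum>S\<in>usets j. cmul (c0 S) (basis N S))) + (\<Sum>S\<in>usets j. cmul (c0 S) (basis N S)) \<in> log_span d n \<alpha> j"
    by (intro log_span_add exacts_log_span[OF c0] log_span_sum log_span_cmul basis)
  then show ?thesis by simp
qed

theorem theorem3p9:
  fixes d j :: nat and n :: "nat \<Rightarrow> nat" and \<alpha> :: complex
  assumes "1 \<le> d" and "\<forall>k\<le>d. 1 \<le> n k" and "\<alpha> \<noteq> 0" and "\<alpha> \<noteq> 1" and "j \<le> d"
  shows "(\<forall>K \<nu>. K \<subseteq> {..d} \<and> card K = j \<and> (\<forall>k\<in>K. \<nu> k \<in> mu (n k)) \<longrightarrow>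
            gen_form d n \<alpha> K \<nu> \<in> Qpart d n \<alpha> j)
       \<and> (\<forall>\<eta>\<in>Qpart d n \<alpha> j. \<exists>F c. finite F \<and>
            (\<forall>(K, \<nu>)\<in>F. K \<subseteq> {..d} \<and> card K = j \<and> (\<forall>k\<in>K. \<nu> k \<in> mu (n k))) \<and>
            \<eta> - (\<Sum>(K, \<nu>)\<in>F. cmul (c (K, \<nu>)) (gen_form d n \<alpha> K \<nu>)) \<in> HU_exact d n \<alpha> j)
       \<and> (\<forall>i\<in>Qset d n. \<forall>k0\<le>d. i k0 = 0 \<longrightarrow>
            (let s = card (Iset d i); L = Lset d i k0 in
              (if s \<le> j then
                 (\<forall>x\<in>closed_forms (Tvars L) (Tgens L) (j - s).
                     omega_pull d n \<alpha> i k0 x \<in> eig_closed d n \<alpha> i j)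
               \<and> (\<forall>x\<in>exact_forms (Tvars L) (Tgens L) (j - s).
                     omega_pull d n \<alpha> i k0 x \<in> HU_exact d n \<alpha> j)
               \<and> (\<forall>x\<in>closed_forms (Tvars L) (Tgens L) (j - s).
                     omega_pull d n \<alpha> i k0 x \<in> HU_exact d n \<alpha> j \<longrightarrow>
                     x \<in> exact_forms (Tvars L) (Tgens L) (j - s))
               \<and> (\<forall>\<eta>\<in>eig_closed d n \<alpha> i j. \<exists>x\<in>closed_forms (Tvars L) (Tgens L) (j - s).
                     \<eta> - omega_pull d n \<alpha> i k0 x \<in> HU_exact d n \<alpha> j)
               else eig_closed d n \<alpha> i j \<subseteq> HU_exact d n \<alpha> j)
              \<and> quot_dim (eig_closed d n \<alpha> i j) (HU_exact d n \<alpha> j) ((d - s) choose (d - j))))"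
proof (intro conjI allI impI ballI)
  show "gen_form d n \<alpha> K \<nu> \<in> Qpart d n \<alpha> j" if "K \<subseteq> {..d} \<and> card K = j \<and> (\<forall>k\<in>K. \<nu> k \<in> mu (n k))" for K \<nu>
    using gen_form_Qpart[OF assms(1-3), of K j \<nu>] that assms(5) by auto
next
  fix \<eta> assume \<eta>: "\<eta> \<in> Qpart d n \<alpha> j"
  then obtain s where form: "is_form {..d} j \<eta>" and s: "\<forall>i\<in>Qset d n. s i \<in> eig_closed d n \<alpha> i j"
    "\<eta> - (\<Sum>i\<in>Qset d n. s i) \<in> exacts {Ueq d n \<alpha>}" by (auto simp: Qpart_def HU_exact_iff Uvars_def)
  have "(\<eta> - (\<Sum>i\<in>Qset d n. s i)) + (\<Sum>i\<in>Qset d n. s i) \<in> log_span d n \<alpha> j"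
    by (rule log_span_add[OF exacts_log_span[OF s(2)] log_span_sum]) (use s eig_log_span[OF assms(1-3)] in auto)
  then obtain c where c: "\<eta> - (\<Sum>x\<in>log_idx d n j. cmul (c x) (gen_form d n \<alpha> (fst x) (snd x))) \<in> exacts {Ueq d n \<alpha>}"
    by (auto simp: log_span_def)
  \<comment> \<open>\<open>HU_exact\<close> also asks for a homogeneous form, so the degree of each
    generator has to be known; it is read off from its membership in \<open>Qpart\<close>.\<close>
  have "is_form {..d} j (gen_form d n \<alpha> (fst x) (snd x))" if "x \<in> log_idx d n j" for x
    using that gen_form_Qpart[OF assms(1-3), of "fst x" j "snd x"] assms(5) by (auto simp: log_idx_def Qpart_def Uvars_def)
  then have "is_form {..d} j (\<eta> - (\<Sum>x\<in>log_idx d n j. cmul (c x) (gen_form d n \<alpha> (fst x) (snd x))))"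
    using form unfolding is_form_supp_in by (intro supp_in_diff supp_in_sum supp_in_cmul) auto
  with c have "\<eta> - (\<Sum>(K, \<nu>)\<in>log_idx d n j. cmul (c (K, \<nu>)) (gen_form d n \<alpha> K \<nu>)) \<in> HU_exact d n \<alpha> j"
    by (simp add: HU_exact_iff case_prod_unfold)
  moreover have "\<forall>(K, \<nu>)\<in>log_idx d n j. K \<subseteq> {..d} \<and> card K = j \<and> (\<forall>k\<in>K. \<nu> k \<in> mu (n k))"
    by (auto simp: log_idx_def)
  ultimately show "\<exists>F c. finite F \<and>
            (\<forall>(K, \<nu>)\<in>F. K \<subseteq> {..d} \<and> card K = j \<and> (\<forall>k\<in>K. \<nu> k \<in> mu (n k))) \<and>
            \<eta> - (\<Sum>(K, \<nu>)\<in>F. cmul (c (K, \<nu>)) (gen_form d n \<alpha> K \<nu>)) \<in> HU_exact d n \<alpha> j"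
    using finite_log_idx[OF assms(2), of j] by blast
next
  fix i k0 assume i: "i \<in> Qset d n" "k0 \<le> d" "i k0 = 0"
  \<comment> \<open>The given \<open>k0\<close> is the coordinate eliminated in the model, so every
    admissible choice is covered.\<close>
  interpret usetup d n \<alpha> i k0 by standard (use assms i in auto)
  note dim = dim_eig[OF assms(5)]
  show "let s = card (Iset d i); L = Lset d i k0 in
              (if s \<le> j then
                 (\<forall>x\<in>closed_forms (Tvars L) (Tgens L) (j - s).
                     omega_pull d n \<alpha> i k0 x \<in> eig_closed d n \<alpha> i j)
               \<and> (\<forall>x\<in>exact_forms (Tvars L) (Tgens L) (j - s).
                     omega_pull d n \<alpha> i k0 x \<in> HU_exact d n \<alpha> j)
               \<and> (\<forall>x\<in>closed_forms (Tvars L) (Tgens L) (j - s).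
                     omega_pull d n \<alpha> i k0 x \<in> HU_exact d n \<alpha> j \<longrightarrow>
                     x \<in> exact_forms (Tvars L) (Tgens L) (j - s))
               \<and> (\<forall>\<eta>\<in>eig_closed d n \<alpha> i j. \<exists>x\<in>closed_forms (Tvars L) (Tgens L) (j - s).
                     \<eta> - omega_pull d n \<alpha> i k0 x \<in> HU_exact d n \<alpha> j)
               else eig_closed d n \<alpha> i j \<subseteq> HU_exact d n \<alpha> j)
              \<and> quot_dim (eig_closed d n \<alpha> i j) (HU_exact d n \<alpha> j) ((d - s) choose (d - j))"
  proof (cases "card (Iset d i) \<le> j")
    case True
    define q where "q = j - card (Iset d i)"
    have j: "j = card (Iset d i) + q" using True by (simp add: q_def)
    show ?thesis unfolding Let_def
      using dim op_closed[of _ q] op_exact[of _ q] op_inj[of _ q] op_surj[of _ q]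
      by (simp add: True flip: q_def j)
  next
    case False
    then show ?thesis unfolding Let_def using dim eig_exact[of j] by simp
  qed
qed

end
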